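(* Let $(X,d,\mu)$ be a space of homogeneous type, $\mathcal{D}$ a dyadic family on $X$ such that $X$ is itself a quadrant for $\mathcal{D}$, $\mathcal{H}$ a Haar system associated to $\mathcal{D}$, and $\delta$ the dyadic metric induced by $\mathcal{D}$. Let $(\alpha_h)_{h\in\mathcal{H}}$ be a bounded sequence in $\mathbb{R}$. Then the operator $$\mathcal{P}f(x)=\sum_{Q\in\tilde{\mathcal{D}}}\ \sum_{h\in\mathcal{H},\,Q(h)=Q}\langle f,h\rangle\left(\sum_{R\in\mathcal{L}(Q)}\ \sum_{\tilde h\in\mathcal{H}(R)}\alpha_{\tilde h}\,\tilde h(x)\right)$$ is a Calderón–Zygmund type operator on the space $(X,\delta,\mu)$. Hence $\mathcal{P}$ is bounded on $L^p(X,\mu)$ for $1<p<\infty$ and of weak type $(1,1)$.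
   Context: **Space of homogeneous type.** A quasi-distance on a set $X$ is a nonnegative symmetric function $d$ on $X\times X$ with $d(x,y)=0$ iff $x=y$ and $d(x,y)\le K[d(x,z)+d(z,y)]$ for all $x,y,z\in X$ and some constant $K$. $(X,d,\mu)$ is a space of homogeneous type if $d$ is a quasi-distance, $\mu$ is a positive Borel measure defined on a $\sigma$-algebra containing the balls, and there is a constant $A$ with $0<\mu(B(x,2r))\le A\,\mu(B(x,r))<\infty$ for all $x\in X$, $r>0$. **Dyadic family.** $\mathcal{D}=\bigcup_{j\in\mathbb{Z}}\mathcal{D}^j$ is a dyadic family on $X$ with parameter $\lambda\in(0,1)$ if each $\mathcal{D}^j$ is a family of Borel subsets (cubes) of $X$ such that: (d.1) for every $j$ the cubes in $\mathcal{D}^j$ are pairwise disjoint; (d.2) $X=\bigcup_{Q\in\mathcal{D}^j}Q$ for every $j$; (d.3) if $Q\in\mathcal{D}^j$ and $i<j$, there is a unique $\tilde Q\in\mathcal{D}^i$ with $Q\subseteq\tilde Q$; (d.4) if $Q\in\mathcal{D}^j$, $\tilde Q\in\mathcal{D}^i$ and $i\le j$, then $Q\subseteq\tilde Q$ or $Q\cap\tilde Q=\emptyset$; (d.5) there are constants $a_1,a_2>0$ such that for each $j$ and $Q\in\mathcal{D}^j$ there is $x\in Q$ with $B(x,a_1\lambda^j)\subseteq Q\subseteq B(x,a_2\lambda^j)$. For $Q\in\mathcal{D}^j$ put $\mathcal{L}(Q)=\{Q'\in\mathcal{D}^{j+1}:Q'\subseteq Q\}$. Let $\tilde{\mathcal{D}}^j=\{Q\in\mathcal{D}^j:\#\mathcal{L}(Q)>1\}$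 and $\tilde{\mathcal{D}}=\bigcup_{j}\tilde{\mathcal{D}}^j$. The families $\tilde{\mathcal{D}}^j$ are pairwise disjoint, so each $Q\in\tilde{\mathcal{D}}$ belongs to exactly one $\tilde{\mathcal{D}}^j$, and for such $Q$ the set $\mathcal{L}(Q)$ is taken with respect to that level $j$. **Quadrant.** The quadrant containing $Q\in\mathcal{D}$ is $\mathbf{C}(Q)=\bigcup\{Q'\in\mathcal{D}:Q\subseteq Q'\}$. "$X$ is itself a quadrant" means $X=\mathbf{C}(Q)$ for some $Q\in\mathcal{D}$. **Dyadic metric.** $\delta(x,y)=\min\{\mu(Q):x,y\in Q,\ Q\in\tilde{\mathcal{D}}\}$ if $x\ne y$, and $\delta(x,x)=0$. **Haar system.** A Haar system associated to $\mathcal{D}$ is a family $\mathcal{H}$ of simple Borel measurable real functions on $X$ which is an orthonormal basis of $L^2(X,\mu)$ and satisfies: (h.1) for each $h\in\mathcal{H}$ there are a unique $j\in\mathbb{Z}$ and a cube $Q(h)\in\tilde{\mathcal{D}}^j$ such that $\{x:h(x)\ne0\}\subseteq Q(h)$, and this property does not hold for any cube in $\mathcal{D}^{j+1}$; (h.2) for every $Q\in\tilde{\mathcal{D}}$ there are exactly $M_Q=\#\mathcal{L}(Q)-1\ge1$ functions $h\in\mathcal{H}$ with $Q(h)=Q$; the set of these functions is denoted $\mathcal{H}(Q)$; (h.3) $\int_X h\,d\mu=0$ for each $h\in\mathcal{H}$; (h.4) for each $Q\in\tilde{\mathcal{D}}$, if $V_Q$ is the vector space of functions on $Q$ which are constant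 on each $Q'\in\mathcal{L}(Q)$, then $\{\mu(Q)^{-1/2}\chi_Q\}\cup\mathcal{H}(Q)$ is an orthonormal basis of $V_Q$; (h.5) there is a constant $C>0$ such that $|h(x)|\le C|h(y)|$ for almost every $x,y\in Q(h)$ and every $h\in\mathcal{H}$. For a cube $R$ (regarded as a set) which does not belong to $\tilde{\mathcal{D}}$, $\mathcal{H}(R)=\emptyset$. $\langle f,g\rangle$ is the scalar product of $L^2(X,\mu)$, and $\mathcal{S}(\mathcal{H})$ is the linear span of $\mathcal{H}$. **Calderón–Zygmund type operator.** A bounded linear operator $T:L^2(X,\mu)\to L^2(X,\mu)$ is of Calderón–Zygmund type in $(X,\delta,\mu)$ if there is $K\in L^1_{loc}(X\times X\setminus\Delta)$, $\Delta$ the diagonal, such that: (1) for some $C>0$, $|K(x,y)|\le C/\delta(x,y)$ for $x\ne y$; (2) for some $C,\gamma>0$ and all $x\neq y$: (2.a) $|K(x',y)-K(x,y)|\le C\,\delta(x',x)^\gamma/\delta(x,y)^{1+\gamma}$ if $2\delta(x',x)\le\delta(x,y)$, and (2.b) $|K(x,y')-K(x,y)|\le C\,\delta(y,y')^\gamma/\delta(x,y)^{1+\gamma}$ if $2\delta(y',y)\le\delta(x,y)$; (3) for $\varphi,\psi\in\mathcal{S}(\mathcal{H})$ with disjoint supports, $\langle T\varphi,\psi\rangle=\iint_{X\times X}K(x,y)\varphi(x)\psi(y)\,d(\mu\times\mu)(x,y)$. *)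

theory Defs
  imports "HOL-Analysis.Analysis"
begin

section \<open>Spaces of homogeneous type\<close>

text \<open>
  The underlying set of the space is \<open>X = space M\<close>, the measure \<open>\<mu>\<close> is \<open>M\<close>. Functions on \<open>X\<close>
  are total functions whose values outside \<open>space M\<close> are irrelevant.
\<close>

definition quasi_distance :: "'a set \<Rightarrow> ('a \<Rightarrow> 'a \<Rightarrow> real) \<Rightarrow> bool" where
  "quasi_distance X d \<longleftrightarrow>
     (\<forall>x\<in>X. \<forall>y\<in>X. 0 \<le> d x y \<and> d x y = d y x \<and> (d x y = 0 \<longleftrightarrow> x = y)) \<and>
     (\<exists>K. \<forall>x\<in>X. \<forall>y\<in>X. \<forall>z\<in>X. d x y \<le> K * (d x z + d z y))"

definition dball :: "'a set \<Rightarrow> ('a \<Rightarrow> 'a \<Rightarrow> real) \<Rightarrow> 'a \<Rightarrow> real \<Rightarrow> 'a set" where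
  "dball X d x r = {y \<in> X. d x y < r}"

text \<open>The topology of a quasi-distance; the balls themselves need not be open in it.\<close>

definition dopen :: "'a set \<Rightarrow> ('a \<Rightarrow> 'a \<Rightarrow> real) \<Rightarrow> 'a set \<Rightarrow> bool" where
  "dopen X d U \<longleftrightarrow> U \<subseteq> X \<and> (\<forall>x\<in>U. \<exists>r>0. dball X d x r \<subseteq> U)"

definition dborel :: "'a set \<Rightarrow> ('a \<Rightarrow> 'a \<Rightarrow> real) \<Rightarrow> 'a measure" where
  "dborel X d = sigma X {U. dopen X d U}"

definition homogeneous_type :: "'a measure \<Rightarrow> ('a \<Rightarrow> 'a \<Rightarrow> real) \<Rightarrow> bool" where
  "homogeneous_type M d \<longleftrightarrow>
     quasi_distance (space M) d \<and>
     sets (dborel (space M) d) \<subseteq> sets M \<and>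
     (\<forall>x\<in>space M. \<forall>r>0. dball (space M) d x r \<in> sets M) \<and>
     (\<exists>A::real. \<forall>x\<in>space M. \<forall>r>0.
        0 < emeasure M (dball (space M) d x (2 * r)) \<and>
        emeasure M (dball (space M) d x (2 * r))
          \<le> ennreal A * emeasure M (dball (space M) d x r) \<and>
        ennreal A * emeasure M (dball (space M) d x r) < \<infinity>)"

section \<open>Dyadic families\<close>

definition dyadic_family ::
  "'a measure \<Rightarrow> ('a \<Rightarrow> 'a \<Rightarrow> real) \<Rightarrow> real \<Rightarrow> (int \<Rightarrow> 'a set set) \<Rightarrow> bool" where
  "dyadic_family M d lam D \<longleftrightarrow>
     0 < lam \<and> lam < 1 \<and>
     (\<forall>j. D j \<subseteq> sets (dborel (space M) d)) \<and>
     (\<forall>j. disjoint (D j)) \<and>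
     (\<forall>j. space M = \<Union>(D j)) \<and>
     (\<forall>i j. \<forall>Q\<in>D j. i < j \<longrightarrow> (\<exists>!Q'. Q' \<in> D i \<and> Q \<subseteq> Q')) \<and>
     (\<forall>i j. \<forall>Q\<in>D j. \<forall>Q'\<in>D i. i \<le> j \<longrightarrow> Q \<subseteq> Q' \<or> Q \<inter> Q' = {}) \<and>
     (\<exists>a1>0. \<exists>a2>0. \<forall>j. \<forall>Q\<in>D j. \<exists>x\<in>Q.
        dball (space M) d x (a1 * lam powi j) \<subseteq> Q \<and>
        Q \<subseteq> dball (space M) d x (a2 * lam powi j))"

definition subcubes :: "(int \<Rightarrow> 'a set set) \<Rightarrow> int \<Rightarrow> 'a set \<Rightarrow> 'a set set" where
  "subcubes D j Q = {Q' \<in> D (j + 1). Q' \<subseteq> Q}"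

text \<open>In a space of homogeneous type \<open>subcubes D j Q\<close> is finite, by doubling, so that the convention
  \<open>card A = 0\<close> for infinite \<open>A\<close> does not interfere.\<close>

definition branching_level :: "(int \<Rightarrow> 'a set set) \<Rightarrow> int \<Rightarrow> 'a set set" where
  "branching_level D j = {Q \<in> D j. 1 < card (subcubes D j Q)}"

definition branching :: "(int \<Rightarrow> 'a set set) \<Rightarrow> 'a set set" where
  "branching D = (\<Union>j. branching_level D j)"

text \<open>The same set may be a cube of several levels, but for a dyadic family it is branching in at
  most one of them. That level determines \<open>\<L>(Q)\<close>.\<close>

definition cube_level :: "(int \<Rightarrow> 'a set set) \<Rightarrow> 'a set \<Rightarrow> int" where
  "cube_level D Q = (THE j. Q \<in> branching_level D j)"

definition children :: "(int \<Rightarrow> 'a set set) \<Rightarrow> 'a set \<Rightarrow> 'a set set" where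
  "children D Q = subcubes D (cube_level D Q) Q"

definition quadrant :: "(int \<Rightarrow> 'a set set) \<Rightarrow> 'a set \<Rightarrow> 'a set" where
  "quadrant D Q = \<Union>{Q' \<in> (\<Union>j. D j). Q \<subseteq> Q'}"

definition dyadic_dist :: "'a measure \<Rightarrow> (int \<Rightarrow> 'a set set) \<Rightarrow> 'a \<Rightarrow> 'a \<Rightarrow> real" where
  "dyadic_dist M D x y =
     (if x = y then 0
      else (LEAST r. \<exists>Q\<in>branching D. x \<in> Q \<and> y \<in> Q \<and> r = measure M Q))"

section \<open>Lebesgue spaces\<close>

text \<open>\<open>L\<^sup>p\<close> as a set of functions, not of classes; equality of its elements means equality almost
  everywhere.\<close>

definition Lp :: "'a measure \<Rightarrow> real \<Rightarrow> ('a \<Rightarrow> real) set" where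
  "Lp M p = {f \<in> borel_measurable M. integrable M (\<lambda>x. \<bar>f x\<bar> powr p)}"

definition Lp_norm :: "'a measure \<Rightarrow> real \<Rightarrow> ('a \<Rightarrow> real) \<Rightarrow> real" where
  "Lp_norm M p f = (\<integral>x. \<bar>f x\<bar> powr p \<partial>M) powr (1 / p)"

definition L2_inner :: "'a measure \<Rightarrow> ('a \<Rightarrow> real) \<Rightarrow> ('a \<Rightarrow> real) \<Rightarrow> real" where
  "L2_inner M f g = (\<integral>x. f x * g x \<partial>M)"

definition lin_span :: "('a \<Rightarrow> real) set \<Rightarrow> ('a \<Rightarrow> real) set" where
  "lin_span B = {\<lambda>x. \<Sum>b\<in>F. c b * b x | F c. finite F \<and> F \<subseteq> B}"

definition L2_orthonormal_basis :: "'a measure \<Rightarrow> ('a \<Rightarrow> real) set \<Rightarrow> bool" where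
  "L2_orthonormal_basis M B \<longleftrightarrow>
     B \<subseteq> Lp M 2 \<and>
     (\<forall>f\<in>B. \<forall>g\<in>B. L2_inner M f g = (if f = g then 1 else 0)) \<and>
     (\<forall>f\<in>Lp M 2. \<forall>e>0. \<exists>g\<in>lin_span B. Lp_norm M 2 (\<lambda>x. f x - g x) < e)"

definition ae_linear_on :: "'a measure \<Rightarrow> ('a \<Rightarrow> real) set \<Rightarrow> (('a \<Rightarrow> real) \<Rightarrow> 'a \<Rightarrow> real) \<Rightarrow> bool" where
  "ae_linear_on M V T \<longleftrightarrow>
     (\<forall>f\<in>V. \<forall>g\<in>V. \<forall>a b. AE x in M. T (\<lambda>y. a * f y + b * g y) x = a * T f x + b * T g x)"

text \<open>Linearity and the norm bound together imply that such an operator respects equality almost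
  everywhere, that is, acts on classes.\<close>

definition Lp_bounded_linear :: "'a measure \<Rightarrow> real \<Rightarrow> (('a \<Rightarrow> real) \<Rightarrow> 'a \<Rightarrow> real) \<Rightarrow> bool" where
  "Lp_bounded_linear M p T \<longleftrightarrow>
     (\<forall>f\<in>Lp M p. T f \<in> Lp M p) \<and>
     ae_linear_on M (Lp M p) T \<and>
     (\<exists>C. \<forall>f\<in>Lp M p. Lp_norm M p (T f) \<le> C * Lp_norm M p f)"

text \<open>Boundedness on \<open>L\<^sup>p\<close> and weak type (1,1) of an operator that is a priori defined on \<open>L\<^sup>2\<close> only:
  it has an extension from \<open>L\<^sup>2 \<inter> L\<^sup>p\<close> to all of \<open>L\<^sup>p\<close> with the required bound.\<close>

definition extends_bounded_Lp :: "'a measure \<Rightarrow> real \<Rightarrow> (('a \<Rightarrow> real) \<Rightarrow> 'a \<Rightarrow> real) \<Rightarrow> bool" where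
  "extends_bounded_Lp M p T \<longleftrightarrow>
     (\<exists>S. Lp_bounded_linear M p S \<and> (\<forall>f\<in>Lp M 2 \<inter> Lp M p. AE x in M. S f x = T f x))"

definition extends_weak_type_1_1 :: "'a measure \<Rightarrow> (('a \<Rightarrow> real) \<Rightarrow> 'a \<Rightarrow> real) \<Rightarrow> bool" where
  "extends_weak_type_1_1 M T \<longleftrightarrow>
     (\<exists>S. (\<forall>f\<in>Lp M 1. S f \<in> borel_measurable M) \<and>
          ae_linear_on M (Lp M 1) S \<and>
          (\<forall>f\<in>Lp M 2 \<inter> Lp M 1. AE x in M. S f x = T f x) \<and>
          (\<exists>C. \<forall>f\<in>Lp M 1. \<forall>t>0.
             emeasure M {x \<in> space M. t < \<bar>S f x\<bar>} \<le> ennreal (C * Lp_norm M 1 f / t)))"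

text \<open>Unconditional convergence of a series in \<open>L\<^sup>2\<close>, as \<^const>\<open>has_sum\<close> but for the \<open>L\<^sup>2\<close> norm.\<close>

definition L2_has_sum ::
  "'a measure \<Rightarrow> ('i \<Rightarrow> 'a \<Rightarrow> real) \<Rightarrow> ('a \<Rightarrow> real) \<Rightarrow> 'i set \<Rightarrow> bool" where
  "L2_has_sum M F g I \<longleftrightarrow>
     (\<forall>i\<in>I. F i \<in> Lp M 2) \<and> g \<in> Lp M 2 \<and>
     ((\<lambda>J. Lp_norm M 2 (\<lambda>x. (\<Sum>i\<in>J. F i x) - g x)) \<longlongrightarrow> 0) (finite_subsets_at_top I)"

section \<open>Haar systems\<close>

definition minimal_cube :: "'a set \<Rightarrow> (int \<Rightarrow> 'a set set) \<Rightarrow> ('a \<Rightarrow> real) \<Rightarrow> int \<Rightarrow> 'a set \<Rightarrow> bool" where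
  "minimal_cube X D h j Q \<longleftrightarrow>
     Q \<in> branching_level D j \<and> {x \<in> X. h x \<noteq> 0} \<subseteq> Q \<and>
     (\<forall>Q'\<in>D (j + 1). \<not> {x \<in> X. h x \<noteq> 0} \<subseteq> Q')"

definition haar_cube :: "'a set \<Rightarrow> (int \<Rightarrow> 'a set set) \<Rightarrow> ('a \<Rightarrow> real) \<Rightarrow> 'a set" where
  "haar_cube X D h = (THE Q. \<exists>j. minimal_cube X D h j Q)"

text \<open>\<open>\<H>(R)\<close>, with \<open>R\<close> regarded as a set. For a Haar system it is empty unless \<open>R \<in> branching D\<close>.\<close>

definition haar_at ::
  "'a set \<Rightarrow> (int \<Rightarrow> 'a set set) \<Rightarrow> ('a \<Rightarrow> real) set \<Rightarrow> 'a set \<Rightarrow> ('a \<Rightarrow> real) set" where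
  "haar_at X D H R = {h \<in> H. haar_cube X D h = R}"

text \<open>\<open>V\<^sub>Q\<close> consists of functions on \<open>Q\<close>; values outside \<open>Q\<close> are irrelevant.\<close>

definition step_space :: "(int \<Rightarrow> 'a set set) \<Rightarrow> 'a set \<Rightarrow> ('a \<Rightarrow> real) set" where
  "step_space D Q = {f. \<forall>R\<in>children D Q. f constant_on R}"

definition step_space_basis :: "'a measure \<Rightarrow> (int \<Rightarrow> 'a set set) \<Rightarrow> 'a set \<Rightarrow> ('a \<Rightarrow> real) set \<Rightarrow> bool" where
  "step_space_basis M D Q B \<longleftrightarrow>
     B \<subseteq> step_space D Q \<and>
     (\<forall>f\<in>B. \<forall>g\<in>B. (LINT x:Q|M. f x * g x) = (if f = g then 1 else 0)) \<and>
     (\<forall>f\<in>step_space D Q. \<exists>g\<in>lin_span B. \<forall>x\<in>Q. f x = g x)"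

definition haar_system ::
  "'a measure \<Rightarrow> ('a \<Rightarrow> 'a \<Rightarrow> real) \<Rightarrow> (int \<Rightarrow> 'a set set) \<Rightarrow> ('a \<Rightarrow> real) set \<Rightarrow> bool" where
  "haar_system M d D H \<longleftrightarrow>
     (\<forall>h\<in>H. simple_function (dborel (space M) d) h) \<and>
     L2_orthonormal_basis M H \<and>
     (\<forall>h\<in>H. \<exists>!j. \<exists>Q. minimal_cube (space M) D h j Q) \<and>
     (\<forall>Q\<in>branching D. card (haar_at (space M) D H Q) = card (children D Q) - 1) \<and>
     (\<forall>h\<in>H. (\<integral>x. h x \<partial>M) = 0) \<and>
     (\<forall>Q\<in>branching D. step_space_basis M D Q
        (insert (\<lambda>x. measure M Q powr (- 1 / 2) * indicator Q x) (haar_at (space M) D H Q))) \<and>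
     (\<exists>C>0. \<forall>h\<in>H. AE x in M. AE y in M.
        x \<in> haar_cube (space M) D h \<longrightarrow> y \<in> haar_cube (space M) D h \<longrightarrow> \<bar>h x\<bar> \<le> C * \<bar>h y\<bar>)"

section \<open>Operators of Calderon-Zygmund type\<close>

text \<open>Local integrability on the complement of the diagonal: measurability, and integrability on a
  neighbourhood of each point. The topology is the product topology given by \<open>\<delta>\<close>.\<close>

definition off_diag :: "'a set \<Rightarrow> ('a \<times> 'a) set" where
  "off_diag X = {(x, y). x \<in> X \<and> y \<in> X \<and> x \<noteq> y}"

definition L1_loc_off_diag ::
  "'a measure \<Rightarrow> ('a \<Rightarrow> 'a \<Rightarrow> real) \<Rightarrow> ('a \<Rightarrow> 'a \<Rightarrow> real) \<Rightarrow> bool" where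
  "L1_loc_off_diag M \<delta> K \<longleftrightarrow>
     set_borel_measurable (M \<Otimes>\<^sub>M M) (off_diag (space M)) (\<lambda>(x, y). K x y) \<and>
     (\<forall>(x, y)\<in>off_diag (space M). \<exists>r>0.
        dball (space M) \<delta> x r \<times> dball (space M) \<delta> y r \<subseteq> off_diag (space M) \<and>
        set_integrable (M \<Otimes>\<^sub>M M) (dball (space M) \<delta> x r \<times> dball (space M) \<delta> y r) (\<lambda>(x, y). K x y))"

definition CZ_kernel :: "'a measure \<Rightarrow> ('a \<Rightarrow> 'a \<Rightarrow> real) \<Rightarrow> ('a \<Rightarrow> 'a \<Rightarrow> real) \<Rightarrow> bool" where
  "CZ_kernel M \<delta> K \<longleftrightarrow>
     L1_loc_off_diag M \<delta> K \<and>
     (\<exists>C>0. \<forall>x\<in>space M. \<forall>y\<in>space M. x \<noteq> y \<longrightarrow> \<bar>K x y\<bar> \<le> C / \<delta> x y) \<and>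
     (\<exists>C>0. \<exists>\<gamma>>0. \<forall>x\<in>space M. \<forall>y\<in>space M. x \<noteq> y \<longrightarrow>
        (\<forall>x'\<in>space M. 2 * \<delta> x' x \<le> \<delta> x y \<longrightarrow>
           \<bar>K x' y - K x y\<bar> \<le> C * \<delta> x' x powr \<gamma> / \<delta> x y powr (1 + \<gamma>)) \<and>
        (\<forall>y'\<in>space M. 2 * \<delta> y' y \<le> \<delta> x y \<longrightarrow>
           \<bar>K x y' - K x y\<bar> \<le> C * \<delta> y y' powr \<gamma> / \<delta> x y powr (1 + \<gamma>)))"

text \<open>In the integral representation the first argument of the kernel is the variable of the input
  function. Disjointness is required only of the sets where \<open>\<phi>\<close> and \<open>\<psi>\<close> do not vanish.\<close>

definition CZ_operator ::
  "'a measure \<Rightarrow> ('a \<Rightarrow> 'a \<Rightarrow> real) \<Rightarrow> ('a \<Rightarrow> real) set \<Rightarrow> (('a \<Rightarrow> real) \<Rightarrow> 'a \<Rightarrow> real) \<Rightarrow> bool" where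
  "CZ_operator M \<delta> H T \<longleftrightarrow>
     Lp_bounded_linear M 2 T \<and>
     (\<exists>K. CZ_kernel M \<delta> K \<and>
        (\<forall>\<phi>\<in>lin_span H. \<forall>\<psi>\<in>lin_span H.
           {x \<in> space M. \<phi> x \<noteq> 0} \<inter> {x \<in> space M. \<psi> x \<noteq> 0} = {} \<longrightarrow>
           integrable (M \<Otimes>\<^sub>M M) (\<lambda>(x, y). K x y * \<phi> x * \<psi> y) \<and>
           L2_inner M (T \<phi>) \<psi> = (\<integral>(x, y). K x y * \<phi> x * \<psi> y \<partial>(M \<Otimes>\<^sub>M M))))"

section \<open>The operator\<close>

definition haar_shift_term ::
  "'a measure \<Rightarrow> (int \<Rightarrow> 'a set set) \<Rightarrow> ('a \<Rightarrow> real) set \<Rightarrow> (('a \<Rightarrow> real) \<Rightarrow> real) \<Rightarrow>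
   ('a \<Rightarrow> real) \<Rightarrow> 'a set \<Rightarrow> 'a \<Rightarrow> real" where
  "haar_shift_term M D H \<alpha> f Q x =
     (\<Sum>h\<in>haar_at (space M) D H Q. L2_inner M f h *
        (\<Sum>R\<in>children D Q. \<Sum>h'\<in>haar_at (space M) D H R. \<alpha> h' * h' x))"

text \<open>The sum over all branching cubes is taken in \<open>L\<^sup>2\<close>, which determines the result up to equality
  almost everywhere.\<close>

definition haar_shift ::
  "'a measure \<Rightarrow> (int \<Rightarrow> 'a set set) \<Rightarrow> ('a \<Rightarrow> real) set \<Rightarrow> (('a \<Rightarrow> real) \<Rightarrow> real) \<Rightarrow>
   ('a \<Rightarrow> real) \<Rightarrow> 'a \<Rightarrow> real" where
  "haar_shift M D H \<alpha> f = (SOME g. L2_has_sum M (haar_shift_term M D H \<alpha> f) g (branching D))"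

end

theory Submission
  imports Defs
begin

text \<open>
  The Haar functions have integral zero and span a dense subspace of \<open>L\<^sup>2\<close>, so \<open>X\<close> has infinite
  measure, no cube is all of \<open>X\<close>, and every cube is a child of exactly one branching cube, its parent.
  Hence the operator is \<open>f \<mapsto> \<Sum>\<^sub>Q \<langle>f, S\<^sub>Q\<rangle> G\<^sub>Q\<close>, where \<open>S\<^sub>Q\<close> sums the Haar functions of \<open>Q\<close> and
  \<open>G\<^sub>Q\<close> the weighted Haar functions of the children of \<open>Q\<close>. Both families are orthogonal, \<open>S\<^sub>Q\<close> and
  \<open>G\<^sub>Q\<close> vanish off \<open>Q\<close>, are of size \<open>\<mu>(Q)\<^bsup>-1/2\<^esup>\<close> and are constant on the grandchildren
  of \<open>Q\<close>; these properties are symmetric in the two families, so whatever is proved for the operator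
  holds for its adjoint. Bessel's inequality gives the bound on \<open>L\<^sup>2\<close>. The kernel
  \<open>\<Sum>\<^sub>Q S\<^sub>Q(x) G\<^sub>Q(y)\<close> only involves the chain of cubes above the smallest cube containing \<open>x\<close> and \<open>y\<close>,
  whose measures grow geometrically, and it does not change at all when \<open>x\<close> or \<open>y\<close> moves by much less
  than \<open>\<delta>(x, y)\<close>. In the Calderon-Zygmund decomposition of \<open>f\<close> the operator maps the bad part to a
  function supported in the parents of the stopping cubes, which yields the weak type (1,1);
  interpolation gives \<open>1 < p < 2\<close>, and duality \<open>p > 2\<close>.
\<close>

section \<open>Functions with integrable powers\<close>

text \<open>The series is summed in L2 by an arbitrary choice of limit, so the operator is
  determined only up to null sets, and only on L2. It is therefore recorded through its bilinear
  form (\<open>represents\<close>): claims about T f are proved by pairing it with a well chosen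
  test function, and exchanging the two families gives the adjoint. On Lp the operator is built as
  an almost everywhere limit along rapidly converging approximations, since a weak type bound offers
  no norm in which to complete. The weak type bound rests on cancellation. If b has mean zero on a
  stopping cube W, then W contributes to the coefficient of b at Q only if the first function of Q
  varies on W. This forces Q into \<open>parent W\<close>, and the second function of Q vanishes off
  Q. The parents have total measure at most 1/\<kappa> times that of the stopping cubes. The number
  \<kappa>, a lower bound for the fraction of the mass of a cube carried by a child, is the
  geometric constant of all estimates: it bounds the number of children, makes measures grow along
  chains, and compares a cube with its parent.\<close>

definition Lp_nn :: "'a measure \<Rightarrow> real \<Rightarrow> ('a \<Rightarrow> real) \<Rightarrow> ennreal" where
  "Lp_nn M p f = (\<integral>\<^sup>+x. ennreal (\<bar>f x\<bar> powr p) \<partial>M)"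

text \<open>\<open>Lp_nn\<close> is the p-th power of the norm with value infinity outside the
  space. Inequalities between its values can thus be proved before membership is known, and then
  yield membership.\<close>

lemma Lp_iff: "f \<in> Lp M p \<longleftrightarrow> f \<in> borel_measurable M \<and> Lp_nn M p f < \<infinity>"
proof -
  have "integrable M (\<lambda>x. \<bar>f x\<bar> powr p) \<longleftrightarrow> Lp_nn M p f < \<infinity>" if "f \<in> borel_measurable M"
    using that by (simp add: integrable_iff_bounded Lp_nn_def)
  then show ?thesis by (auto simp: Lp_def)
qed

lemma Lp_measurable: "f \<in> Lp M p \<Longrightarrow> f \<in> borel_measurable M"
  by (simp add: Lp_def)

lemma Lp_norm_nn:
  assumes "f \<in> borel_measurable M"
  shows "Lp_norm M p f = enn2real (Lp_nn M p f) powr (1 / p)"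
  using assms unfolding Lp_norm_def Lp_nn_def by (subst integral_eq_nn_integral) auto

lemma Lp_nn_norm:
  assumes "f \<in> Lp M p" "p > 0"
  shows "Lp_nn M p f = ennreal (Lp_norm M p f powr p)"
proof -
  have "Lp_norm M p f powr p = enn2real (Lp_nn M p f)"
    using assms by (simp add: Lp_norm_nn[OF Lp_measurable] powr_powr)
  with assms show ?thesis by (simp add: Lp_iff)
qed

lemma Lp_norm_le_of_nn:
  assumes "f \<in> Lp M p" "g \<in> Lp M p" "p > 0" "K \<ge> 0"
    and "Lp_nn M p g \<le> ennreal K * Lp_nn M p f"
  shows "Lp_norm M p g \<le> K powr (1 / p) * Lp_norm M p f"
proof -
  have "Lp_norm M p g powr p \<le> K * Lp_norm M p f powr p"
    using assms by (simp add: Lp_nn_norm ennreal_mult[symmetric] Lp_norm_def)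
  then have "(Lp_norm M p g powr p) powr (1/p) \<le> (K * Lp_norm M p f powr p) powr (1/p)"
    using assms by (intro powr_mono2) auto
  then show ?thesis using assms by (simp add: powr_powr powr_mult Lp_norm_def)
qed

lemma Lp_nn_mono:
  assumes "p > 0" "\<And>x. x \<in> space M \<Longrightarrow> \<bar>f x\<bar> \<le> \<bar>g x\<bar>"
  shows "Lp_nn M p f \<le> Lp_nn M p g"
  unfolding Lp_nn_def using assms by (intro nn_integral_mono ennreal_leI powr_mono2) auto

lemma Lp_nn_cmult:
  assumes "f \<in> borel_measurable M"
  shows "Lp_nn M p (\<lambda>x. a * f x) = ennreal (\<bar>a\<bar> powr p) * Lp_nn M p f"
  using assms unfolding Lp_nn_def
  by (subst nn_integral_cmult[symmetric]) (auto simp: abs_mult powr_mult ennreal_mult)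

text \<open>Replacing the sum by twice the maximum gives a constant that works for all p > 0, on
  both sides of 1.\<close>

lemma powr_add_le:
  fixes a b p :: real
  assumes "p > 0" "a \<ge> 0" "b \<ge> 0"
  shows "(a + b) powr p \<le> 2 powr p * (a powr p + b powr p)"
proof -
  have "(a + b) powr p \<le> (2 * max a b) powr p"
    using assms by (intro powr_mono2) auto
  also have "\<dots> = 2 powr p * max a b powr p" using assms by (simp add: powr_mult)
  also have "max a b powr p \<le> a powr p + b powr p" by (auto simp: max_def)
  finally show ?thesis by simp
qed

lemma Lp_nn_add:
  assumes p: "p > 0" and [measurable]: "f \<in> borel_measurable M" "g \<in> borel_measurable M"
  shows "Lp_nn M p (\<lambda>x. f x + g x) \<le> ennreal (2 powr p) * (Lp_nn M p f + Lp_nn M p g)"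
proof -
  have "\<bar>f x + g x\<bar> powr p \<le> 2 powr p * (\<bar>f x\<bar> powr p + \<bar>g x\<bar> powr p)" for x
  proof -
    have "\<bar>f x + g x\<bar> powr p \<le> (\<bar>f x\<bar> + \<bar>g x\<bar>) powr p" using p by (intro powr_mono2) auto
    also have "\<dots> \<le> 2 powr p * (\<bar>f x\<bar> powr p + \<bar>g x\<bar> powr p)" using p by (intro powr_add_le) auto
    finally show ?thesis .
  qed
  then have "Lp_nn M p (\<lambda>x. f x + g x) \<le> (\<integral>\<^sup>+x. ennreal (2 powr p * (\<bar>f x\<bar> powr p + \<bar>g x\<bar> powr p)) \<partial>M)"
    unfolding Lp_nn_def by (intro nn_integral_mono ennreal_leI)
  also have "\<dots> = ennreal (2 powr p) * (Lp_nn M p f + Lp_nn M p g)"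
    unfolding Lp_nn_def by (simp add: ennreal_mult ennreal_plus nn_integral_cmult nn_integral_add)
  finally show ?thesis .
qed

lemma Lp_nn_diff:
  assumes p: "p > 0" and [measurable]: "f \<in> borel_measurable M" "g \<in> borel_measurable M"
  shows "Lp_nn M p (\<lambda>x. f x - g x) \<le> ennreal (2 powr p) * (Lp_nn M p f + Lp_nn M p g)"
proof -
  have "Lp_nn M p (\<lambda>x. - g x) = Lp_nn M p g" by (simp add: Lp_nn_def)
  with Lp_nn_add[OF p assms(2), of "\<lambda>x. - g x"] show ?thesis by simp
qed

lemma Lp_lincomb:
  assumes "p > 0" "f \<in> Lp M p" "g \<in> Lp M p"
  shows "(\<lambda>x. a * f x + b * g x) \<in> Lp M p"
proof -
  have [measurable]: "f \<in> borel_measurable M" "g \<in> borel_measurable M"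
    using assms by (auto simp: Lp_iff)
  have "Lp_nn M p (\<lambda>x. a * f x + b * g x)
      \<le> ennreal (2 powr p) * (Lp_nn M p (\<lambda>x. a * f x) + Lp_nn M p (\<lambda>x. b * g x))"
    by (rule Lp_nn_add) (use assms in auto)
  also have "\<dots> < \<infinity>"
    using assms by (simp add: Lp_nn_cmult Lp_iff ennreal_mult_less_top)
  finally show ?thesis by (simp add: Lp_iff)
qed

lemma Lp_add: "p > 0 \<Longrightarrow> f \<in> Lp M p \<Longrightarrow> g \<in> Lp M p \<Longrightarrow> (\<lambda>x. f x + g x) \<in> Lp M p"
  using Lp_lincomb[of p f M g 1 1] by simp

lemma Lp_diff: "p > 0 \<Longrightarrow> f \<in> Lp M p \<Longrightarrow> g \<in> Lp M p \<Longrightarrow> (\<lambda>x. f x - g x) \<in> Lp M p"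
  using Lp_lincomb[of p f M g 1 "-1"] by simp

lemma Lp_cmult: "p > 0 \<Longrightarrow> f \<in> Lp M p \<Longrightarrow> (\<lambda>x. a * f x) \<in> Lp M p"
  using Lp_lincomb[of p f M f a 0] by simp

lemma Lp_zero: "(\<lambda>x. 0) \<in> Lp M p"
  by (simp add: Lp_def)

lemma Lp_sum: "p > 0 \<Longrightarrow> (\<And>i. i \<in> I \<Longrightarrow> f i \<in> Lp M p) \<Longrightarrow> (\<lambda>x. \<Sum>i\<in>I. f i x) \<in> Lp M p"
  by (induction I rule: infinite_finite_induct) (auto intro: Lp_zero Lp_add)

lemma Lp_dominated:
  assumes "p > 0" "g \<in> Lp M p" "f \<in> borel_measurable M" "\<And>x. x \<in> space M \<Longrightarrow> \<bar>f x\<bar> \<le> \<bar>g x\<bar>"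
  shows "f \<in> Lp M p"
  proof -
  have "Lp_nn M p f \<le> Lp_nn M p g" using assms(1,4) by (rule Lp_nn_mono)
  with assms(2,3) show ?thesis by (simp add: Lp_iff order_le_less_trans)
qed

lemma Lp_nn_Chebyshev:
  assumes "p > 0" "t > 0" and [measurable]: "f \<in> borel_measurable M"
  shows "emeasure M {x \<in> space M. t < \<bar>f x\<bar>} \<le> ennreal (1 / t powr p) * Lp_nn M p f"
proof -
  have *: "1 \<le> ennreal (1 / t powr p) * ennreal (\<bar>f x\<bar> powr p)" if "t < \<bar>f x\<bar>" for x
  proof -
    have "t powr p \<le> \<bar>f x\<bar> powr p" using assms that by (intro powr_mono2) auto
    then have "1 \<le> 1 / t powr p * \<bar>f x\<bar> powr p" using assms by (simp add: field_simps)
    then show ?thesis by (subst ennreal_mult[symmetric]) (auto simp flip: ennreal_1 intro!: ennreal_leI)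
  qed
  have "emeasure M {x \<in> space M. t < \<bar>f x\<bar>}
      \<le> emeasure M {x \<in> space M. 1 \<le> ennreal (1 / t powr p) * ennreal (\<bar>f x\<bar> powr p)}"
    using * by (intro emeasure_mono) auto
  also have "\<dots> \<le> ennreal (1 / t powr p) * (\<integral>\<^sup>+x. ennreal (\<bar>f x\<bar> powr p) * indicator (space M) x \<partial>M)"
    by (rule nn_integral_Markov_inequality) auto
  also have "\<dots> = ennreal (1 / t powr p) * Lp_nn M p f"
    unfolding Lp_nn_def by (auto intro!: arg_cong2[where f="(*)"] nn_integral_cong)
  finally show ?thesis .
qed

text \<open>Borel-Cantelli: the exceptional sets have summable measures.\<close>

lemma AE_eventually_le_half_power:
  fixes w :: "nat \<Rightarrow> 'a \<Rightarrow> real"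
  assumes [measurable]: "\<And>n. w n \<in> borel_measurable M" and C: "C \<ge> 0"
    and bd: "\<And>n. emeasure M {x \<in> space M. (1/2) ^ n < \<bar>w n x\<bar>} \<le> ennreal (C * (1/2) ^ n)"
  shows "AE x in M. eventually (\<lambda>n. \<bar>w n x\<bar> \<le> (1/2) ^ n) sequentially"
proof -
  let ?A = "\<lambda>n. {x \<in> space M. (1/2) ^ n < \<bar>w n x\<bar>}"
  have "AE x in M. eventually (\<lambda>n. x \<in> space M - ?A n) sequentially"
  proof (rule borel_cantelli_AE1)
    show "?A n \<in> sets M" for n by measurable
    show "emeasure M (?A n) < \<infinity>" for n using bd[of n] by (simp add: order_le_less_trans)
    have "measure M (?A n) \<le> C * (1/2) ^ n" for n
      unfolding measure_def using bd[of n] C by (intro enn2real_leI) auto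
    then show "summable (\<lambda>n. measure M (?A n))"
      by (auto intro: summable_comparison_test'[where g = "\<lambda>n. C * (1/2) ^ n" and N = 0])
  qed
  then show ?thesis
    by eventually_elim (auto elim!: eventually_mono)
qed

lemma half_power_le_tendsto_0:
  fixes u :: "nat \<Rightarrow> real"
  assumes "eventually (\<lambda>n. \<bar>u n\<bar> \<le> (1/2) ^ n) sequentially"
  shows "u \<longlonglongrightarrow> 0"
proof -
  have "(\<lambda>n. (1/2::real) ^ n) \<longlonglongrightarrow> 0" by (intro LIMSEQ_power_zero) simp
  with assms show ?thesis
    by (intro Lim_null_comparison[of u "\<lambda>n. (1/2) ^ n"]) (simp_all add: real_norm_def)
qed

lemma half_power_le_convergent:
  fixes u :: "nat \<Rightarrow> real"
  assumes "eventually (\<lambda>n. \<bar>u (Suc n) - u n\<bar> \<le> (1/2) ^ n) sequentially"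
  shows "convergent u"
proof -
  obtain N where "\<And>n. n \<ge> N \<Longrightarrow> \<bar>u (Suc n) - u n\<bar> \<le> (1/2) ^ n"
    using assms by (auto simp: eventually_sequentially)
  then have "summable (\<lambda>n. u (Suc n) - u n)"
    by (auto intro: summable_comparison_test'[where g = "\<lambda>n. (1/2) ^ n" and N = N])
  then have "convergent (\<lambda>n. u n - u 0)"
    by (simp add: summable_iff_convergent sum_lessThan_telescope)
  then show ?thesis by (simp add: convergent_diff_const_right_iff)
qed

text \<open>Cutting off large values and restricting to a set of finite measure makes f square
  integrable; dominated convergence controls the error. The pointwise domination by f carries norm
  bounds over to the approximation without any loss in the constant.\<close>

lemma Lp_truncation:
  assumes "sigma_finite_measure M" "p > 0" "f \<in> Lp M p" "\<epsilon> > 0"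
  obtains g where "g \<in> Lp M 2" "g \<in> Lp M p" "\<And>x. \<bar>g x\<bar> \<le> \<bar>f x\<bar>"
    "Lp_nn M p (\<lambda>x. f x - g x) < ennreal \<epsilon>"
proof -
  interpret sigma_finite_measure M by fact
  have [measurable]: "f \<in> borel_measurable M" using assms by (auto simp: Lp_iff)
  obtain A :: "nat \<Rightarrow> 'a set" where A: "range A \<subseteq> sets M" "(\<Union>i. A i) = space M"
    "\<And>i. emeasure M (A i) \<noteq> \<infinity>" "incseq A" using sigma_finite_incseq by blast
  have [measurable]: "A i \<in> sets M" for i using A by auto
  define g where "g n x = (if \<bar>f x\<bar> \<le> real n then f x else 0) * indicator (A n) x" for n x
  have [measurable]: "g n \<in> borel_measurable M" for n unfolding g_def by measurable
  have gf: "\<bar>g n x\<bar> \<le> \<bar>f x\<bar>" for n x by (auto simp: g_def indicator_def)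
  have gLp: "g n \<in> Lp M p" for n by (rule Lp_dominated[of p f]) (use assms gf in auto)
  have gL2: "g n \<in> Lp M 2" for n
  proof -
    have "integrable M (\<lambda>x. \<bar>g n x\<bar> powr 2)"
    proof (rule integrableI_bounded_set[of "A n" _ _ "real n powr 2"])
      show "AE x in M. x \<in> A n \<longrightarrow> norm (\<bar>g n x\<bar> powr 2) \<le> real n powr 2"
        by (intro AE_I2) (auto simp: g_def abs_le_square_iff[symmetric])
    qed (use A in \<open>auto simp: g_def less_top\<close>)
    then show ?thesis by (simp add: Lp_def)
  qed
  have lim: "(\<lambda>n. \<integral>x. \<bar>f x - g n x\<bar> powr p \<partial>M) \<longlonglongrightarrow> (\<integral>x. 0 \<partial>M)"
  proof (rule integral_dominated_convergence[where w = "\<lambda>x. \<bar>f x\<bar> powr p"])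
    show "integrable M (\<lambda>x. \<bar>f x\<bar> powr p)" using assms by (simp add: Lp_def)
    show "AE x in M. (\<lambda>n. \<bar>f x - g n x\<bar> powr p) \<longlonglongrightarrow> 0"
    proof (rule AE_I2)
      fix x assume "x \<in> space M"
      then obtain m where m: "x \<in> A m" using A(2) by blast
      obtain k where k: "\<bar>f x\<bar> \<le> real k" using real_arch_simple by blast
      have "f x - g n x = 0" if "n \<ge> max m k" for n
      proof -
        have "x \<in> A n" using m that \<open>incseq A\<close> by (auto dest: incseqD)
        moreover have "\<bar>f x\<bar> \<le> real n" using k that by simp
        ultimately show ?thesis by (simp add: g_def)
      qed
      then have "\<bar>f x - g n x\<bar> powr p = 0" if "n \<ge> max m k" for n using that assms by simp
      then have "\<forall>\<^sub>F n in sequentially. \<bar>f x - g n x\<bar> powr p = 0"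
        unfolding eventually_sequentially by blast
      then show "(\<lambda>n. \<bar>f x - g n x\<bar> powr p) \<longlonglongrightarrow> 0" by (rule tendsto_eventually)
    qed
    show "AE x in M. norm (\<bar>f x - g n x\<bar> powr p) \<le> \<bar>f x\<bar> powr p" for n
      using assms by (intro AE_I2) (auto simp: g_def indicator_def)
  qed auto
  then have "eventually (\<lambda>n. (\<integral>x. \<bar>f x - g n x\<bar> powr p \<partial>M) < \<epsilon>) sequentially"
    using assms by (auto dest!: order_tendstoD(2)[of _ _ _ \<epsilon>])
  then obtain n where n: "(\<integral>x. \<bar>f x - g n x\<bar> powr p \<partial>M) < \<epsilon>"
    by (auto simp: eventually_sequentially)
  have "(\<lambda>x. f x - g n x) \<in> Lp M p" using assms gLp by (intro Lp_diff)
  then have "Lp_nn M p (\<lambda>x. f x - g n x) = ennreal (\<integral>x. \<bar>f x - g n x\<bar> powr p \<partial>M)"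
    unfolding Lp_nn_def by (intro nn_integral_eq_integral) (auto simp: Lp_def)
  with n assms have "Lp_nn M p (\<lambda>x. f x - g n x) < ennreal \<epsilon>" by (simp add: ennreal_lessI)
  with gL2 gLp gf that show ?thesis by blast
qed

section \<open>Extension from a dense subspace\<close>

text \<open>The class V is a parameter because a bound is first known on the part of Lp inside L2
  and afterwards transferred to all of Lp.\<close>

definition weak_type :: "'a measure \<Rightarrow> real \<Rightarrow> real \<Rightarrow> ('a \<Rightarrow> real) set \<Rightarrow> (('a \<Rightarrow> real) \<Rightarrow> 'a \<Rightarrow> real) \<Rightarrow> bool"
  where
  "weak_type M p C V T \<longleftrightarrow> (\<forall>f\<in>V. \<forall>t>0.
     emeasure M {x \<in> space M. t < \<bar>T f x\<bar>} \<le> ennreal (C / t powr p) * Lp_nn M p f)"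

lemma weak_type_of_strong:
  assumes "p > 0" "K \<ge> 0"
    and "\<And>f. f \<in> V \<Longrightarrow> T f \<in> borel_measurable M"
    and "\<And>f. f \<in> V \<Longrightarrow> Lp_nn M p (T f) \<le> ennreal K * Lp_nn M p f"
  shows "weak_type M p K V T"
  unfolding weak_type_def
proof safe
  fix f and t :: real assume f: "f \<in> V" and t: "0 < t"
  have "emeasure M {x \<in> space M. t < \<bar>T f x\<bar>} \<le> ennreal (1 / t powr p) * Lp_nn M p (T f)"
    using assms f t by (intro Lp_nn_Chebyshev) auto
  also have "\<dots> \<le> ennreal (1 / t powr p) * (ennreal K * Lp_nn M p f)"
    using assms f by (intro mult_left_mono) auto
  also have "\<dots> = ennreal (K / t powr p) * Lp_nn M p f"
    using assms by (simp add: mult.assoc[symmetric] ennreal_mult[symmetric])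
  finally show "emeasure M {x \<in> space M. t < \<bar>T f x\<bar>} \<le> ennreal (K / t powr p) * Lp_nn M p f" .
qed

text \<open>In the exponent n(p + 1) the part np compensates the division by t^p at the level t =
  2^-n; the remaining factor 2^-n is what Borel-Cantelli consumes.\<close>

lemma weak_type_fast_convergence:
  fixes w :: "nat \<Rightarrow> 'a \<Rightarrow> real"
  assumes weak: "weak_type M p C V T" and "C \<ge> 0" "K \<ge> 0" "p > 0"
    and T: "\<And>f. f \<in> V \<Longrightarrow> T f \<in> borel_measurable M"
    and w: "\<And>n. w n \<in> V" "\<And>n. Lp_nn M p (w n) \<le> ennreal (K * (1/2) powr (n * (p + 1)))"
  shows "AE x in M. eventually (\<lambda>n. \<bar>T (w n) x\<bar> \<le> (1/2) ^ n) sequentially"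
proof (rule AE_eventually_le_half_power[where C = "C * K"])
  show "T (w n) \<in> borel_measurable M" for n using T w by auto
  show "emeasure M {x \<in> space M. (1 / 2) ^ n < \<bar>T (w n) x\<bar>} \<le> ennreal (C * K * (1 / 2) ^ n)" for n
  proof -
    have "emeasure M {x \<in> space M. (1 / 2) ^ n < \<bar>T (w n) x\<bar>}
        \<le> ennreal (C / ((1/2) ^ n) powr p) * Lp_nn M p (w n)"
      using weak w unfolding weak_type_def by auto
    also have "\<dots> \<le> ennreal (C / ((1/2) ^ n) powr p) * ennreal (K * (1/2) powr (n * (p + 1)))"
      using w by (intro mult_left_mono) auto
    also have "\<dots> = ennreal (C / ((1/2) ^ n) powr p * (K * (1/2) powr (n * (p + 1))))"
      using assms by (subst ennreal_mult[symmetric]) auto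
    also have "C / ((1/2) ^ n) powr p * (K * (1/2) powr (n * (p + 1))) = C * K * (1/2) ^ n"
    proof -
      have "((1/2::real) ^ n) powr p = (1/2) powr (n * p)"
        by (simp add: powr_realpow[symmetric] powr_powr)
      moreover have "(1/2::real) powr (n * (p + 1)) = (1/2) powr (n * p) * (1/2) ^ n"
        by (simp add: powr_realpow[symmetric] powr_add[symmetric] algebra_simps)
      ultimately show ?thesis by simp
    qed
    finally show ?thesis .
  qed
qed (use assms in auto)

text \<open>The strict inequality t < \<bar>v x\<bar> is an open condition, so it holds for u n x
  from some n on; Fatou's lemma does the rest.\<close>

lemma emeasure_superlevel_liminf:
  assumes [measurable]: "\<And>n. u n \<in> borel_measurable M" "v \<in> borel_measurable M"
    and lim: "AE x in M. (\<lambda>n. u n x) \<longlonglongrightarrow> v x"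
    and bd: "\<And>n. emeasure M {x \<in> space M. t < \<bar>u n x :: real\<bar>} \<le> B"
  shows "emeasure M {x \<in> space M. t < \<bar>v x\<bar>} \<le> B"
proof -
  have "emeasure M {x \<in> space M. t < \<bar>v x\<bar>} = (\<integral>\<^sup>+x. indicator {x \<in> space M. t < \<bar>v x\<bar>} x \<partial>M)"
    by simp
  also have "\<dots> \<le> (\<integral>\<^sup>+x. liminf (\<lambda>n. indicator {x \<in> space M. t < \<bar>u n x\<bar>} x) \<partial>M)"
  proof (rule nn_integral_mono_AE, use lim in eventually_elim)
    fix x assume lim: "(\<lambda>n. u n x) \<longlonglongrightarrow> v x"
    show "indicator {x \<in> space M. t < \<bar>v x\<bar>} x
        \<le> liminf (\<lambda>n. indicator {x \<in> space M. t < \<bar>u n x\<bar>} x :: ennreal)"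
    proof (cases "x \<in> space M \<and> t < \<bar>v x\<bar>")
      case True
      then have "\<forall>\<^sub>F n in sequentially. t < \<bar>u n x\<bar>"
        using order_tendstoD(1)[OF tendsto_rabs[OF lim]] by auto
      then have "\<forall>\<^sub>F n in sequentially. 1 \<le> (indicator {x \<in> space M. t < \<bar>u n x\<bar>} x :: ennreal)"
        by eventually_elim (use True in auto)
      then have "1 \<le> liminf (\<lambda>n. indicator {x \<in> space M. t < \<bar>u n x\<bar>} x :: ennreal)"
        by (rule Liminf_bounded)
      then show ?thesis using True by simp
    qed auto
  qed
  also have "\<dots> \<le> liminf (\<lambda>n. \<integral>\<^sup>+x. indicator {x \<in> space M. t < \<bar>u n x\<bar>} x \<partial>M)"
    by (rule nn_integral_liminf) measurable
  also have "\<dots> = liminf (\<lambda>n. emeasure M {x \<in> space M. t < \<bar>u n x\<bar>})" by simp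
  also have "\<dots> \<le> liminf (\<lambda>n. B)" by (intro Liminf_mono) (simp add: bd)
  also have "\<dots> = B" by (simp add: Liminf_const)
  finally show ?thesis .
qed

lemma Lp_nn_liminf:
  assumes [measurable]: "\<And>n. u n \<in> borel_measurable M" "v \<in> borel_measurable M"
    and lim: "AE x in M. (\<lambda>n. u n x) \<longlonglongrightarrow> v x" and "p > 0"
    and bd: "\<forall>\<^sub>F n in sequentially. Lp_nn M p (u n) \<le> B"
  shows "Lp_nn M p v \<le> B"
proof -
  have "Lp_nn M p v \<le> (\<integral>\<^sup>+x. liminf (\<lambda>n. ennreal (\<bar>u n x\<bar> powr p)) \<partial>M)"
    unfolding Lp_nn_def
  proof (rule nn_integral_mono_AE, use lim in eventually_elim)
    fix x assume lim: "(\<lambda>n. u n x) \<longlonglongrightarrow> v x"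
    have *: "(\<lambda>n. ennreal (\<bar>u n x\<bar> powr p)) \<longlonglongrightarrow> ennreal (\<bar>v x\<bar> powr p)"
      using lim \<open>p > 0\<close> by (intro tendsto_ennrealI tendsto_powr' tendsto_rabs tendsto_const) auto
    show "ennreal (\<bar>v x\<bar> powr p) \<le> liminf (\<lambda>n. ennreal (\<bar>u n x\<bar> powr p))"
      using lim_imp_Liminf[OF sequentially_bot *] by simp
  qed
  also have "\<dots> \<le> liminf (\<lambda>n. Lp_nn M p (u n))"
    unfolding Lp_nn_def by (rule nn_integral_liminf) measurable
  also have "\<dots> \<le> liminf (\<lambda>n. B)" using bd by (rule Liminf_mono)
  also have "\<dots> = B" by (simp add: Liminf_const)
  finally show ?thesis .
qed

text \<open>Approximations g n of f with errors 2^-n(p+1) have images that converge almost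
  everywhere, and S f is that limit. Applied to the difference of two approximating sequences, the
  same fast convergence gives both the agreement with T and linearity. The number K is quantified in
  the conclusion so that one construction serves weak and strong bounds alike.\<close>

theorem Lp_extension:
  assumes sf: "sigma_finite_measure M" and p: "p > 0" and C: "C \<ge> 0"
    and T: "\<And>f. f \<in> Lp M 2 \<Longrightarrow> T f \<in> borel_measurable M"
    and lin: "ae_linear_on M (Lp M 2) T"
    and weak: "weak_type M p C (Lp M 2 \<inter> Lp M p) T"
  obtains S where "\<forall>f\<in>Lp M p. S f \<in> borel_measurable M"
    and "ae_linear_on M (Lp M p) S"
    and "\<forall>f\<in>Lp M 2 \<inter> Lp M p. AE x in M. S f x = T f x"
    and "weak_type M p C (Lp M p) S"
    and "\<forall>K. (\<forall>f\<in>Lp M 2 \<inter> Lp M p. Lp_nn M p (T f) \<le> ennreal K * Lp_nn M p f)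
      \<longrightarrow> (\<forall>f\<in>Lp M p. Lp_nn M p (S f) \<le> ennreal K * Lp_nn M p f)"
proof -
  define V where "V = Lp M 2 \<inter> Lp M p"
  define \<epsilon> where "\<epsilon> n = (1/2::real) powr (real n * (p + 1))" for n :: nat
  have \<epsilon>: "\<epsilon> n > 0" "\<epsilon> (Suc n) \<le> \<epsilon> n" for n
    using p by (auto simp: \<epsilon>_def intro!: powr_mono')
  define ap where "ap f n = (SOME g. g \<in> V \<and> (\<forall>x. \<bar>g x\<bar> \<le> \<bar>f x\<bar>) \<and>
    Lp_nn M p (\<lambda>x. f x - g x) < ennreal (\<epsilon> n))" for f n
  have ap: "ap f n \<in> V \<and> (\<forall>x. \<bar>ap f n x\<bar> \<le> \<bar>f x\<bar>) \<and> Lp_nn M p (\<lambda>x. f x - ap f n x) < ennreal (\<epsilon> n)"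
    if f: "f \<in> Lp M p" for f n
  proof -
    obtain g where "g \<in> V" "\<And>x. \<bar>g x\<bar> \<le> \<bar>f x\<bar>" "Lp_nn M p (\<lambda>x. f x - g x) < ennreal (\<epsilon> n)"
      using Lp_truncation[OF sf p f \<epsilon>(1)[of n]] unfolding V_def by blast
    then have "\<exists>g. g \<in> V \<and> (\<forall>x. \<bar>g x\<bar> \<le> \<bar>f x\<bar>) \<and> Lp_nn M p (\<lambda>x. f x - g x) < ennreal (\<epsilon> n)" by blast
    then show ?thesis unfolding ap_def by (rule someI_ex)
  qed
  \<comment> \<open>\<open>lim\<close> has a value even at points of divergence; these form a null
    set, and \<open>S f\<close> stays measurable.\<close>
  define S where "S f x = lim (\<lambda>n. T (ap f n) x)" for f x
  have TV: "T f \<in> borel_measurable M" if "f \<in> V" for f using that T by (auto simp: V_def)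
  have Vm: "f \<in> borel_measurable M" if "f \<in> V" for f using that by (auto simp: V_def Lp_iff)
  have Vlin: "(\<lambda>x. a * f x + b * g x) \<in> V" if "f \<in> V" "g \<in> V" for f g a b
    using that p Lp_lincomb[of 2] Lp_lincomb[of p] by (auto simp: V_def)
  have Vdiff: "(\<lambda>x. f x - g x) \<in> V" if "f \<in> V" "g \<in> V" for f g
    using Vlin[OF that, of 1 "-1"] by simp
  have linV: "AE x in M. T (\<lambda>y. a * f y + b * g y) x = a * T f x + b * T g x" if "f \<in> V" "g \<in> V" for f g a b
    using that lin by (auto simp: V_def ae_linear_on_def)
  have linVd: "AE x in M. T (\<lambda>y. f y - g y) x = T f x - T g x" if "f \<in> V" "g \<in> V" for f g
    using linV[OF that, of 1 "-1"] by simp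
  have fast: "AE x in M. eventually (\<lambda>n. \<bar>T (w n) x\<bar> \<le> (1/2) ^ n) sequentially"
    if "\<And>n. w n \<in> V" "\<And>n. Lp_nn M p (w n) \<le> ennreal (K * \<epsilon> n)" "K \<ge> 0" for w K
    by (rule weak_type_fast_convergence[where V = V and C = C and K = K and p = p])
       (use that weak C p TV in \<open>auto simp: V_def \<epsilon>_def\<close>)
  have conv: "AE x in M. (\<lambda>n. T (ap f n) x) \<longlonglongrightarrow> S f x" if f: "f \<in> Lp M p" for f
  proof -
    define w where "w n = (\<lambda>x. ap f (Suc n) x - ap f n x)" for n
    note [measurable] = Lp_measurable[OF f] Vm[OF conjunct1[OF ap[OF f]]]
    have wV: "w n \<in> V" for n unfolding w_def using ap[OF f] by (intro Vdiff) auto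
    have "Lp_nn M p (w n) \<le> ennreal (2 powr p * 2 * \<epsilon> n)" for n
    proof -
      have "Lp_nn M p (w n) = Lp_nn M p (\<lambda>x. (f x - ap f n x) - (f x - ap f (Suc n) x))"
        by (simp add: w_def)
      also have "\<dots> \<le> ennreal (2 powr p) * (Lp_nn M p (\<lambda>x. f x - ap f n x) + Lp_nn M p (\<lambda>x. f x - ap f (Suc n) x))"
        by (intro Lp_nn_diff p) measurable
      also have "\<dots> \<le> ennreal (2 powr p) * (ennreal (\<epsilon> n) + ennreal (\<epsilon> n))"
        using ap[OF f, of n] ap[OF f, of "Suc n"] \<epsilon>(2)[of n]
        by (intro mult_left_mono add_mono) (auto intro: less_imp_le order_trans[OF less_imp_le] ennreal_leI)
      also have "\<dots> = ennreal (2 powr p * 2 * \<epsilon> n)"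
        using \<epsilon>(1)[of n] by (simp add: ennreal_mult[symmetric] ennreal_plus[symmetric] del: ennreal_plus)
      finally show ?thesis .
    qed
    from fast[OF wV this] have ev: "AE x in M. eventually (\<lambda>n. \<bar>T (w n) x\<bar> \<le> (1/2) ^ n) sequentially"
      by simp
    have "AE x in M. \<forall>n. T (w n) x = T (ap f (Suc n)) x - T (ap f n) x"
      unfolding AE_all_countable w_def using ap[OF f] by (auto intro: linVd)
    with ev show ?thesis
    proof eventually_elim
      case (elim x)
      then have "convergent (\<lambda>n. T (ap f n) x)"
        by (intro half_power_le_convergent) auto
      then show ?case by (simp add: S_def convergent_LIMSEQ_iff)
    qed
  qed
  have Sm: "S f \<in> borel_measurable M" if f: "f \<in> Lp M p" for f
    unfolding S_def using TV[OF conjunct1[OF ap[OF f]]] by measurable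
  have agree: "AE x in M. S f x = T f x" if f: "f \<in> V" for f
  proof -
    have fp: "f \<in> Lp M p" using f by (auto simp: V_def)
    have "AE x in M. eventually (\<lambda>n. \<bar>T (\<lambda>y. f y - ap f n y) x\<bar> \<le> (1/2) ^ n) sequentially"
      by (rule fast[where K = 1]) (use ap[OF fp] f in \<open>auto intro!: Vdiff intro: less_imp_le\<close>)
    moreover have "AE x in M. \<forall>n. T (\<lambda>y. f y - ap f n y) x = T f x - T (ap f n) x"
      unfolding AE_all_countable using ap[OF fp] f by (auto intro: linVd)
    ultimately show ?thesis using conv[OF fp]
    proof eventually_elim
      case (elim x)
      then have "(\<lambda>n. T f x - T (ap f n) x) \<longlonglongrightarrow> 0" by (intro half_power_le_tendsto_0) auto
      moreover have "(\<lambda>n. T f x - T (ap f n) x) \<longlonglongrightarrow> T f x - S f x"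
        using elim by (intro tendsto_diff) auto
      ultimately show ?case using LIMSEQ_unique by fastforce
    qed
  qed
  have linS: "ae_linear_on M (Lp M p) S"
    unfolding ae_linear_on_def
  proof safe
    fix f g a b assume f: "f \<in> Lp M p" and g: "g \<in> Lp M p"
    define h where "h = (\<lambda>y. a * f y + b * g y)"
    have h: "h \<in> Lp M p" unfolding h_def using f g p by (rule_tac Lp_lincomb)
    define r where "r n = (\<lambda>y. a * ap f n y + b * ap g n y)" for n
    have rV: "r n \<in> V" for n unfolding r_def using ap[OF f] ap[OF g] by (intro Vlin) auto
    note [measurable] = Lp_measurable[OF f] Lp_measurable[OF g] Lp_measurable[OF h]
      Vm[OF conjunct1[OF ap[OF f]]] Vm[OF conjunct1[OF ap[OF g]]] Vm[OF conjunct1[OF ap[OF h]]] Vm[OF rV]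
    \<comment> \<open>Both \<open>r n\<close> and \<open>ap h n\<close> approximate h, so T of their
      difference tends to 0. The constant collects the factors 2^p of two applications of the
      triangle inequality.\<close>
    define K where "K = 2 powr p * (1 + 2 powr p * (\<bar>a\<bar> powr p + \<bar>b\<bar> powr p))"
    have K: "K \<ge> 0" by (simp add: K_def)
    have "Lp_nn M p (\<lambda>y. r n y - ap h n y) \<le> ennreal (K * \<epsilon> n)" for n
    proof -
      have 1: "Lp_nn M p (\<lambda>y. h y - r n y) \<le> ennreal (2 powr p) * (ennreal (\<bar>a\<bar> powr p) * ennreal (\<epsilon> n) + ennreal (\<bar>b\<bar> powr p) * ennreal (\<epsilon> n))"
      proof -
        have "Lp_nn M p (\<lambda>y. h y - r n y) = Lp_nn M p (\<lambda>y. a * (f y - ap f n y) + b * (g y - ap g n y))"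
          by (simp add: h_def r_def algebra_simps)
        also have "\<dots> \<le> ennreal (2 powr p) * (Lp_nn M p (\<lambda>y. a * (f y - ap f n y)) + Lp_nn M p (\<lambda>y. b * (g y - ap g n y)))"
          by (intro Lp_nn_add p) measurable
        also have "\<dots> \<le> ennreal (2 powr p) * (ennreal (\<bar>a\<bar> powr p) * ennreal (\<epsilon> n) + ennreal (\<bar>b\<bar> powr p) * ennreal (\<epsilon> n))"
          using ap[OF f, of n] ap[OF g, of n]
          by (subst (1 2) Lp_nn_cmult) (auto intro!: mult_left_mono add_mono simp: less_imp_le)
        finally show ?thesis .
      qed
      have "Lp_nn M p (\<lambda>y. r n y - ap h n y) = Lp_nn M p (\<lambda>y. (h y - ap h n y) - (h y - r n y))" by simp
      also have "\<dots> \<le> ennreal (2 powr p) * (Lp_nn M p (\<lambda>y. h y - ap h n y) + Lp_nn M p (\<lambda>y. h y - r n y))"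
        by (intro Lp_nn_diff p) measurable
      also have "\<dots> \<le> ennreal (2 powr p) * (ennreal (\<epsilon> n) + ennreal (2 powr p) * (ennreal (\<bar>a\<bar> powr p) * ennreal (\<epsilon> n) + ennreal (\<bar>b\<bar> powr p) * ennreal (\<epsilon> n)))"
        using ap[OF h, of n] 1 by (intro mult_left_mono add_mono) (auto intro: less_imp_le)
      also have "\<dots> = ennreal (K * \<epsilon> n)"
        using \<epsilon>(1)[of n] unfolding K_def
        by (simp add: ennreal_mult[symmetric] ennreal_plus[symmetric] algebra_simps del: ennreal_plus)
      finally show ?thesis .
    qed
    from fast[OF _ this K]
    have "AE x in M. eventually (\<lambda>n. \<bar>T (\<lambda>y. r n y - ap h n y) x\<bar> \<le> (1/2) ^ n) sequentially"
      using rV ap[OF h] Vdiff by auto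
    moreover have "AE x in M. \<forall>n. T (\<lambda>y. r n y - ap h n y) x = T (r n) x - T (ap h n) x"
      unfolding AE_all_countable using ap[OF h] rV by (auto intro: linVd)
    moreover have "AE x in M. \<forall>n. T (r n) x = a * T (ap f n) x + b * T (ap g n) x"
      unfolding AE_all_countable r_def using ap[OF f] ap[OF g] by (auto intro: linV)
    ultimately show "AE x in M. S (\<lambda>y. a * f y + b * g y) x = a * S f x + b * S g x"
      unfolding h_def[symmetric] using conv[OF f] conv[OF g] conv[OF h]
    proof eventually_elim
      case (elim x)
      then have "(\<lambda>n. a * T (ap f n) x + b * T (ap g n) x - T (ap h n) x) \<longlonglongrightarrow> 0"
        by (intro half_power_le_tendsto_0) auto
      moreover have "(\<lambda>n. a * T (ap f n) x + b * T (ap g n) x - T (ap h n) x) \<longlonglongrightarrow> a * S f x + b * S g x - S h x"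
        using elim by (intro tendsto_intros) auto
      ultimately show ?case using LIMSEQ_unique by fastforce
    qed
  qed
  have Lp_ap: "Lp_nn M p (ap f n) \<le> Lp_nn M p f" if "f \<in> Lp M p" for f n
    using ap[OF that] p by (intro Lp_nn_mono) auto
  have "weak_type M p C (Lp M p) S"
    unfolding weak_type_def
  proof safe
    fix f and t :: real assume f: "f \<in> Lp M p" and t: "0 < t"
    show "emeasure M {x \<in> space M. t < \<bar>S f x\<bar>} \<le> ennreal (C / t powr p) * Lp_nn M p f"
    proof (rule emeasure_superlevel_liminf[OF _ Sm[OF f] conv[OF f]])
      fix n
      have "emeasure M {x \<in> space M. t < \<bar>T (ap f n) x\<bar>} \<le> ennreal (C / t powr p) * Lp_nn M p (ap f n)"
        using weak ap[OF f] t unfolding weak_type_def V_def by auto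
      also have "\<dots> \<le> ennreal (C / t powr p) * Lp_nn M p f" by (intro mult_left_mono Lp_ap f) auto
      finally show "emeasure M {x \<in> space M. t < \<bar>T (ap f n) x\<bar>} \<le> ennreal (C / t powr p) * Lp_nn M p f" .
    qed (use TV ap[OF f] in auto)
  qed
  moreover have "Lp_nn M p (S f) \<le> ennreal K * Lp_nn M p f"
    if K: "\<forall>f\<in>Lp M 2 \<inter> Lp M p. Lp_nn M p (T f) \<le> ennreal K * Lp_nn M p f" and f: "f \<in> Lp M p" for K f
  proof (rule Lp_nn_liminf[OF _ Sm[OF f] conv[OF f] p])
    have "Lp_nn M p (T (ap f n)) \<le> ennreal K * Lp_nn M p f" for n
    proof -
      have "Lp_nn M p (T (ap f n)) \<le> ennreal K * Lp_nn M p (ap f n)"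
        using ap[OF f, of n] K by (auto simp: V_def)
      also have "\<dots> \<le> ennreal K * Lp_nn M p f" by (intro mult_left_mono Lp_ap f) auto
      finally show ?thesis .
    qed
    then show "\<forall>\<^sub>F n in sequentially. Lp_nn M p (T (ap f n)) \<le> ennreal K * Lp_nn M p f" by simp
  qed (use TV ap[OF f] in auto)
  ultimately show ?thesis using that Sm linS agree unfolding V_def by blast
qed

section \<open>The Hilbert space of square integrable functions\<close>

lemma L2_iff: "f \<in> Lp M 2 \<longleftrightarrow> f \<in> borel_measurable M \<and> integrable M (\<lambda>x. f x * f x)"
  by (simp add: Lp_def power2_eq_square)

lemma L2_integrable_mult:
  assumes "f \<in> Lp M 2" "g \<in> Lp M 2"
  shows "integrable M (\<lambda>x. f x * g x)"
proof (rule Bochner_Integration.integrable_bound)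
  show "integrable M (\<lambda>x. f x * f x + g x * g x)" using assms by (auto simp: L2_iff)
  show "(\<lambda>x. f x * g x) \<in> borel_measurable M" using assms by (auto simp: L2_iff)
  have "\<bar>a * b\<bar> \<le> a * a + b * b" for a b :: real
  proof -
    have "0 \<le> (\<bar>a\<bar> - \<bar>b\<bar>)\<^sup>2" by simp
    then have "2 * (\<bar>a\<bar> * \<bar>b\<bar>) \<le> a * a + b * b"
      by (simp add: power2_eq_square algebra_simps flip: abs_mult)
    moreover have "0 \<le> \<bar>a\<bar> * \<bar>b\<bar>" by simp
    ultimately show ?thesis unfolding abs_mult by linarith
  qed
  then show "AE x in M. norm (f x * g x) \<le> norm (f x * f x + g x * g x)" by (auto intro!: AE_I2)
qed

lemma L2_inner_commute: "L2_inner M f g = L2_inner M g f"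
  by (simp add: L2_inner_def mult.commute)

lemma L2_inner_add_left:
  "f \<in> Lp M 2 \<Longrightarrow> g \<in> Lp M 2 \<Longrightarrow> h \<in> Lp M 2 \<Longrightarrow>
    L2_inner M (\<lambda>x. f x + g x) h = L2_inner M f h + L2_inner M g h"
  unfolding L2_inner_def by (simp add: distrib_right L2_integrable_mult)

lemma L2_inner_diff_left:
  "f \<in> Lp M 2 \<Longrightarrow> g \<in> Lp M 2 \<Longrightarrow> h \<in> Lp M 2 \<Longrightarrow>
    L2_inner M (\<lambda>x. f x - g x) h = L2_inner M f h - L2_inner M g h"
  unfolding L2_inner_def by (simp add: left_diff_distrib L2_integrable_mult)

lemma L2_inner_cmult_left: "L2_inner M (\<lambda>x. a * f x) h = a * L2_inner M f h"
  unfolding L2_inner_def by (simp add: mult.assoc)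

lemma L2_inner_cmult_right: "L2_inner M h (\<lambda>x. a * f x) = a * L2_inner M h f"
  by (metis L2_inner_commute L2_inner_cmult_left)

lemma L2_inner_add_right:
  "f \<in> Lp M 2 \<Longrightarrow> g \<in> Lp M 2 \<Longrightarrow> h \<in> Lp M 2 \<Longrightarrow>
    L2_inner M h (\<lambda>x. f x + g x) = L2_inner M h f + L2_inner M h g"
  unfolding L2_inner_def by (simp add: distrib_left L2_integrable_mult)

lemma L2_inner_diff_right:
  "f \<in> Lp M 2 \<Longrightarrow> g \<in> Lp M 2 \<Longrightarrow> h \<in> Lp M 2 \<Longrightarrow>
    L2_inner M h (\<lambda>x. f x - g x) = L2_inner M h f - L2_inner M h g"
  unfolding L2_inner_def by (simp add: right_diff_distrib L2_integrable_mult)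

lemma L2_inner_sum_left:
  assumes "\<And>i. i \<in> I \<Longrightarrow> f i \<in> Lp M 2" "h \<in> Lp M 2"
  shows "L2_inner M (\<lambda>x. \<Sum>i\<in>I. f i x) h = (\<Sum>i\<in>I. L2_inner M (f i) h)"
  unfolding L2_inner_def sum_distrib_right
  by (rule Bochner_Integration.integral_sum) (use assms in \<open>auto intro: L2_integrable_mult\<close>)

lemma L2_inner_sum_right:
  assumes "\<And>i. i \<in> I \<Longrightarrow> f i \<in> Lp M 2" "h \<in> Lp M 2"
  shows "L2_inner M h (\<lambda>x. \<Sum>i\<in>I. f i x) = (\<Sum>i\<in>I. L2_inner M h (f i))"
  using L2_inner_sum_left[OF assms] by (simp add: L2_inner_commute)

lemma L2_inner_self_nonneg: "0 \<le> L2_inner M f f"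
  unfolding L2_inner_def by (intro integral_nonneg_AE) auto

lemma L2_norm_eq: "Lp_norm M 2 f = sqrt (L2_inner M f f)"
  using L2_inner_self_nonneg[of M f]
  unfolding Lp_norm_def L2_inner_def by (simp add: power2_eq_square powr_half_sqrt)

lemma Lp_nn_2_eq: "f \<in> Lp M 2 \<Longrightarrow> Lp_nn M 2 f = ennreal (L2_inner M f f)"
  using L2_inner_self_nonneg[of M f] by (simp add: Lp_nn_norm L2_norm_eq)

lemma L2_inner_self_eq_0:
  assumes "f \<in> Lp M 2" "L2_inner M f f = 0"
  shows "AE x in M. f x = 0"
proof -
  have "AE x in M. f x * f x = 0"
    using assms integral_nonneg_eq_0_iff_AE[of M "\<lambda>x. f x * f x"]
    by (auto simp: L2_iff L2_inner_def)
  then show ?thesis by simp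
qed

lemma L2_Cauchy_Schwarz:
  assumes f: "f \<in> Lp M 2" and g: "g \<in> Lp M 2"
  shows "\<bar>L2_inner M f g\<bar> \<le> Lp_norm M 2 f * Lp_norm M 2 g"
proof -
  let ?a = "L2_inner M f f" and ?b = "L2_inner M f g" and ?c = "L2_inner M g g"
  have quad: "0 \<le> ?a + 2 * t * ?b + t * t * ?c" for t
  proof -
    have tg: "(\<lambda>x. t * g x) \<in> Lp M 2" using g by (intro Lp_cmult) auto
    have ftg: "(\<lambda>x. f x + t * g x) \<in> Lp M 2" using f tg by (intro Lp_add) auto
    have "L2_inner M (\<lambda>x. f x + t * g x) (\<lambda>x. f x + t * g x) = ?a + 2 * t * ?b + t * t * ?c"
      using f g tg ftg
      by (simp add: L2_inner_add_left L2_inner_add_right L2_inner_cmult_left L2_inner_cmult_right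
        L2_inner_commute[of M g f] tg algebra_simps)
    then show ?thesis using L2_inner_self_nonneg[of M "\<lambda>x. f x + t * g x"] by simp
  qed
  have "?b\<^sup>2 \<le> ?a * ?c"
  proof (cases "?c = 0")
    case True
    have "?b = 0"
    proof (rule ccontr)
      assume "?b \<noteq> 0"
      \<comment> \<open>If g has norm 0 the form is linear in t, and this t gives it the value
        -1.\<close>
      then show False using quad[of "- (?a + 1) / (2 * ?b)"] True by (simp add: field_simps)
    qed
    then show ?thesis using True by simp
  next
    case False
    then have "?c > 0" using L2_inner_self_nonneg[of M g] by simp
    then show ?thesis using quad[of "- ?b / ?c"] by (simp add: field_simps power2_eq_square)
  qed
  then have "sqrt (?b\<^sup>2) \<le> sqrt (?a * ?c)" by (rule real_sqrt_le_mono)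
  then show ?thesis by (simp add: L2_norm_eq real_sqrt_mult)
qed

text \<open>Pairing with a fixed function is continuous by the Cauchy-Schwarz inequality. This is
  the passage from the L2 series to the numerical series in \<open>represents\<close>.\<close>

lemma L2_has_sum_inner:
  assumes "L2_has_sum M u g I" and v: "v \<in> Lp M 2"
  shows "((\<lambda>i. L2_inner M (u i) v) has_sum L2_inner M g v) I"
proof -
  have u: "u i \<in> Lp M 2" if "i \<in> I" for i using assms that by (auto simp: L2_has_sum_def)
  have g: "g \<in> Lp M 2" using assms by (auto simp: L2_has_sum_def)
  have lim: "((\<lambda>J. Lp_norm M 2 (\<lambda>x. (\<Sum>i\<in>J. u i x) - g x)) \<longlongrightarrow> 0) (finite_subsets_at_top I)"
    using assms by (auto simp: L2_has_sum_def)
  have "\<forall>\<^sub>F J in finite_subsets_at_top I. norm ((\<Sum>i\<in>J. L2_inner M (u i) v) - L2_inner M g v)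
      \<le> Lp_norm M 2 (\<lambda>x. (\<Sum>i\<in>J. u i x) - g x) * Lp_norm M 2 v"
  proof (rule eventually_finite_subsets_at_top_weakI)
    fix J assume J: "finite J" "J \<subseteq> I"
    then have S: "(\<lambda>x. \<Sum>i\<in>J. u i x) \<in> Lp M 2" using u by (intro Lp_sum) auto
    have "(\<Sum>i\<in>J. L2_inner M (u i) v) - L2_inner M g v = L2_inner M (\<lambda>x. (\<Sum>i\<in>J. u i x) - g x) v"
      using S g v u J by (subst L2_inner_diff_left, simp_all, subst L2_inner_sum_left) auto
    then show "norm ((\<Sum>i\<in>J. L2_inner M (u i) v) - L2_inner M g v)
      \<le> Lp_norm M 2 (\<lambda>x. (\<Sum>i\<in>J. u i x) - g x) * Lp_norm M 2 v"
      using L2_Cauchy_Schwarz[OF _ v, of "\<lambda>x. (\<Sum>i\<in>J. u i x) - g x"] S g by (auto simp: Lp_diff)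
  qed
  moreover have "((\<lambda>J. Lp_norm M 2 (\<lambda>x. (\<Sum>i\<in>J. u i x) - g x) * Lp_norm M 2 v) \<longlongrightarrow> 0) (finite_subsets_at_top I)"
    using tendsto_mult_left_zero[OF lim] by simp
  ultimately have "((\<lambda>J. (\<Sum>i\<in>J. L2_inner M (u i) v) - L2_inner M g v) \<longlongrightarrow> 0) (finite_subsets_at_top I)"
    by (rule Lim_null_comparison)
  then show ?thesis unfolding has_sum_def by (rule LIM_zero_cancel)
qed

section \<open>Orthogonal series\<close>

lemma L2_inner_orthogonal_sum:
  assumes "finite F" "\<And>i. i \<in> F \<Longrightarrow> u i \<in> Lp M 2"
    and orth: "\<And>i j. i \<in> F \<Longrightarrow> j \<in> F \<Longrightarrow> i \<noteq> j \<Longrightarrow> L2_inner M (u i) (u j) = 0"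
  shows "L2_inner M (\<lambda>x. \<Sum>i\<in>F. c i * u i x) (\<lambda>x. \<Sum>i\<in>F. c i * u i x)
    = (\<Sum>i\<in>F. (c i)\<^sup>2 * L2_inner M (u i) (u i))"
proof -
  have cu: "(\<lambda>x. c i * u i x) \<in> Lp M 2" if "i \<in> F" for i using assms that by (intro Lp_cmult) auto
  then have S: "(\<lambda>x. \<Sum>i\<in>F. c i * u i x) \<in> Lp M 2" by (intro Lp_sum) auto
  have "L2_inner M (\<lambda>x. \<Sum>i\<in>F. c i * u i x) (\<lambda>x. \<Sum>i\<in>F. c i * u i x)
      = (\<Sum>i\<in>F. \<Sum>j\<in>F. c i * (c j * L2_inner M (u i) (u j)))"
    using cu S assms
    by (simp add: L2_inner_sum_left L2_inner_sum_right L2_inner_cmult_left L2_inner_cmult_right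
      sum_distrib_left cong: sum.cong)
  also have "\<dots> = (\<Sum>i\<in>F. \<Sum>j\<in>F. if j = i then (c i)\<^sup>2 * L2_inner M (u i) (u i) else 0)"
    using orth by (intro sum.cong refl) (auto simp: power2_eq_square)
  also have "\<dots> = (\<Sum>i\<in>F. (c i)\<^sup>2 * L2_inner M (u i) (u i))" using assms by simp
  finally show ?thesis .
qed

text \<open>The argument of Riesz and Fischer: the squared norms are summable, so finite index sets
  can be chosen whose tails decay geometrically. Their partial sums converge almost everywhere, and
  Fatou's lemma bounds the distance of every finite partial sum to the limit by its tail, which
  gives unconditional convergence.\<close>

lemma L2_orthogonal_series:
  assumes u: "\<And>i. i \<in> I \<Longrightarrow> u i \<in> Lp M 2"
    and orth: "\<And>i j. i \<in> I \<Longrightarrow> j \<in> I \<Longrightarrow> i \<noteq> j \<Longrightarrow> L2_inner M (u i) (u j) = 0"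
    and bd: "\<And>F. finite F \<Longrightarrow> F \<subseteq> I \<Longrightarrow> (\<Sum>i\<in>F. L2_inner M (u i) (u i)) \<le> C"
  shows "\<exists>g. L2_has_sum M u g I"
proof -
  define a where "a i = L2_inner M (u i) (u i)" for i
  define s where "s = infsum a I"
  define S where "S F = (\<lambda>x. \<Sum>i\<in>F. u i x)" for F
  have a0: "a i \<ge> 0" for i by (simp add: a_def L2_inner_self_nonneg)
  have "a summable_on I"
    using bd a0 unfolding a_def by (intro nonneg_bdd_above_summable_on) (auto intro!: bdd_aboveI2[of _ _ C])
  then have hs: "(a has_sum s) I" by (simp add: s_def)
  have le_s: "sum a F \<le> s" if "finite F" "F \<subseteq> I" for F
    unfolding s_def using that \<open>a summable_on I\<close> a0 by (intro finite_sum_le_infsum) auto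
  have SL: "S F \<in> Lp M 2" if "F \<subseteq> I" for F unfolding S_def using that u by (intro Lp_sum) auto
  have diff: "L2_inner M (\<lambda>x. S F x - S F' x) (\<lambda>x. S F x - S F' x) \<le> (s - sum a F) + (s - sum a F')"
    if F: "finite F" "F \<subseteq> I" and F': "finite F'" "F' \<subseteq> I" for F F'
  proof -
    define c where "c i = (of_bool (i \<in> F) - of_bool (i \<in> F') :: real)" for i
    have "(\<lambda>x. S F x - S F' x) = (\<lambda>x. \<Sum>i\<in>F \<union> F'. c i * u i x)"
    proof
      fix x
      have "S F x = (\<Sum>i\<in>F \<union> F'. of_bool (i \<in> F) * u i x)"
        unfolding S_def using F F' by (intro sum.mono_neutral_cong_left) auto
      moreover have "S F' x = (\<Sum>i\<in>F \<union> F'. of_bool (i \<in> F') * u i x)"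
        unfolding S_def using F F' by (intro sum.mono_neutral_cong_left) auto
      ultimately show "S F x - S F' x = (\<Sum>i\<in>F \<union> F'. c i * u i x)"
        by (simp only: c_def left_diff_distrib sum_subtractf)
    qed
    moreover have "L2_inner M (u i) (u j) = 0" if "i \<in> F \<union> F'" "j \<in> F \<union> F'" "i \<noteq> j" for i j
      using that F F' by (intro orth) auto
    ultimately have "L2_inner M (\<lambda>x. S F x - S F' x) (\<lambda>x. S F x - S F' x) = (\<Sum>i\<in>F \<union> F'. (c i)\<^sup>2 * a i)"
      unfolding a_def by (simp, intro L2_inner_orthogonal_sum) (use F F' u in auto)
    \<comment> \<open>The coefficient c i is 0 on the intersection and 1 or -1 on the rest of the
      union; the linear weight takes the values 0 and 1 there, and it can be summed over F and F'
      separately.\<close>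
    also have "\<dots> \<le> (\<Sum>i\<in>F \<union> F'. (2 - of_bool (i \<in> F) - of_bool (i \<in> F')) * a i)"
      using a0 by (intro sum_mono mult_right_mono) (auto simp: c_def)
    also have "\<dots> = 2 * sum a (F \<union> F') - (\<Sum>i\<in>F \<union> F'. of_bool (i \<in> F) * a i) - (\<Sum>i\<in>F \<union> F'. of_bool (i \<in> F') * a i)"
      by (simp only: left_diff_distrib sum_subtractf sum_distrib_left)
    also have "(\<Sum>i\<in>F \<union> F'. of_bool (i \<in> F) * a i) = sum a F"
      using F F' by (intro sum.mono_neutral_cong_right) auto
    also have "(\<Sum>i\<in>F \<union> F'. of_bool (i \<in> F') * a i) = sum a F'"
      using F F' by (intro sum.mono_neutral_cong_right) auto
    also have "2 * sum a (F \<union> F') - sum a F - sum a F' \<le> (s - sum a F) + (s - sum a F')"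
      using le_s[of "F \<union> F'"] F F' by simp
    finally show ?thesis .
  qed
  \<comment> \<open>The exponent p + 1 of the lemma on fast convergence, for p = 2.\<close>
  define \<epsilon> where "\<epsilon> n = (1/2::real) powr (real n * (2 + 1))" for n :: nat
  have \<epsilon>: "\<epsilon> n > 0" "\<epsilon> (Suc n) \<le> \<epsilon> n" for n by (auto simp: \<epsilon>_def intro!: powr_mono')
  have \<epsilon>0: "\<epsilon> \<longlonglongrightarrow> 0"
  proof -
    have "\<epsilon> n = (1/8) ^ n" for n
    proof -
      have "\<epsilon> n = (1/2) powr real (3 * n)" by (simp add: \<epsilon>_def mult.commute)
      also have "\<dots> = (1/2) ^ (3 * n)" by (rule powr_realpow) simp
      also have "\<dots> = (1/8) ^ n" by (simp add: power_mult power3_eq_cube)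
      finally show ?thesis .
    qed
    then have "\<epsilon> = (\<lambda>n. (1/8) ^ n)" by auto
    then show ?thesis by (simp add: LIMSEQ_power_zero)
  qed
  have "\<exists>F. finite F \<and> F \<subseteq> I \<and> s - sum a F < \<epsilon> n" for n
  proof -
    have "\<forall>\<^sub>F F in finite_subsets_at_top I. s - \<epsilon> n < sum a F"
      using hs \<epsilon>(1)[of n] unfolding has_sum_def by (intro order_tendstoD) auto
    then obtain F where "finite F" "F \<subseteq> I" "s - \<epsilon> n < sum a F"
      by (auto simp: eventually_finite_subsets_at_top)
    then show ?thesis by (intro exI[of _ F]) auto
  qed
  then obtain F where F: "\<And>n. finite (F n)" "\<And>n. F n \<subseteq> I" "\<And>n. s - sum a (F n) < \<epsilon> n" by metis
  have [measurable]: "S (F n) \<in> borel_measurable M" for n using SL[OF F(2)] by (rule Lp_measurable)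
  define g where "g x = lim (\<lambda>n. S (F n) x)" for x
  have [measurable]: "g \<in> borel_measurable M" unfolding g_def by measurable
  \<comment> \<open>By Chebyshev's inequality the identity is of weak type (2,2), so the lemma on
    fast convergence applies to the partial sums themselves.\<close>
  have "AE x in M. eventually (\<lambda>n. \<bar>id (\<lambda>x. S (F (Suc n)) x - S (F n) x) x\<bar> \<le> (1/2) ^ n) sequentially"
  proof (rule weak_type_fast_convergence[where p = 2 and C = 1 and K = 2 and V = "Lp M 2"
        and T = id and w = "\<lambda>n x. S (F (Suc n)) x - S (F n) x"])
    show "weak_type M 2 1 (Lp M 2) id" by (rule weak_type_of_strong) (auto simp: Lp_measurable)
    show d: "(\<lambda>x. S (F (Suc n)) x - S (F n) x) \<in> Lp M 2" for n using SL F by (intro Lp_diff) auto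
    show "Lp_nn M 2 (\<lambda>x. S (F (Suc n)) x - S (F n) x) \<le> ennreal (2 * (1 / 2) powr (real n * (2 + 1)))" for n
      unfolding \<epsilon>_def[symmetric] Lp_nn_2_eq[OF d]
      using diff[OF F(1,2) F(1,2), of "Suc n" n] F(3)[of n] F(3)[of "Suc n"] \<epsilon>(2)[of n]
        by (intro ennreal_leI) simp
  qed (auto simp: Lp_measurable)
  then have conv: "AE x in M. (\<lambda>n. S (F n) x) \<longlonglongrightarrow> g x"
  proof eventually_elim
    case (elim x)
    then have "convergent (\<lambda>n. S (F n) x)" by (intro half_power_le_convergent) auto
    then show ?case by (simp add: g_def convergent_LIMSEQ_iff)
  qed
  have key: "Lp_nn M 2 (\<lambda>x. S J x - g x) \<le> ennreal (s - sum a J)" if J: "finite J" "J \<subseteq> I" for J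
  proof (rule ennreal_le_epsilon)
    fix e :: real assume e: "e > 0"
    have [measurable]: "S J \<in> borel_measurable M" using SL[OF J(2)] by (rule Lp_measurable)
    have "Lp_nn M 2 (\<lambda>x. S J x - g x) \<le> ennreal (s - sum a J + e)"
    proof (rule Lp_nn_liminf)
      show "AE x in M. (\<lambda>n. S J x - S (F n) x) \<longlonglongrightarrow> S J x - g x"
        using conv by eventually_elim (intro tendsto_intros)
      have "\<forall>\<^sub>F n in sequentially. \<epsilon> n < e" using order_tendstoD(2)[OF \<epsilon>0 e] .
      then show "\<forall>\<^sub>F n in sequentially. Lp_nn M 2 (\<lambda>x. S J x - S (F n) x) \<le> ennreal (s - sum a J + e)"
      proof eventually_elim
        case (elim n)
        have "(\<lambda>x. S J x - S (F n) x) \<in> Lp M 2" using SL J F by (intro Lp_diff) auto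
        then show ?case using diff[OF J F(1,2), of n] F(3)[of n] elim
          by (simp add: Lp_nn_2_eq ennreal_leI)
      qed
    qed auto
    then show "Lp_nn M 2 (\<lambda>x. S J x - g x) \<le> ennreal (s - sum a J) + ennreal e"
      using le_s[OF J] e by (simp add: ennreal_plus)
  qed
  have dL: "(\<lambda>x. S J x - g x) \<in> Lp M 2" if J: "finite J" "J \<subseteq> I" for J
    using key[OF J] SL[OF J(2)] by (auto simp: Lp_iff intro: order_le_less_trans)
  \<comment> \<open>The empty partial sum is 0, so its distance to g is the norm of g.\<close>
  have "(\<lambda>x. S {} x - (S {} x - g x)) \<in> Lp M 2" by (rule Lp_diff) (use SL dL in auto)
  then have gL: "g \<in> Lp M 2" by simp
  have "((\<lambda>J. Lp_norm M 2 (\<lambda>x. S J x - g x)) \<longlongrightarrow> 0) (finite_subsets_at_top I)"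
  proof (rule Lim_null_comparison)
    show "\<forall>\<^sub>F J in finite_subsets_at_top I. norm (Lp_norm M 2 (\<lambda>x. S J x - g x)) \<le> sqrt (s - sum a J)"
    proof (rule eventually_finite_subsets_at_top_weakI)
      fix J assume J: "finite J" "J \<subseteq> I"
      have "L2_inner M (\<lambda>x. S J x - g x) (\<lambda>x. S J x - g x) \<le> s - sum a J"
        using key[OF J] le_s[OF J] by (simp add: Lp_nn_2_eq[OF dL[OF J]])
      then show "norm (Lp_norm M 2 (\<lambda>x. S J x - g x)) \<le> sqrt (s - sum a J)"
        by (simp add: L2_norm_eq L2_inner_self_nonneg)
    qed
    have "((\<lambda>J. sqrt (s - sum a J)) \<longlongrightarrow> sqrt (s - s)) (finite_subsets_at_top I)"
      using hs unfolding has_sum_def by (intro tendsto_intros)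
    then show "((\<lambda>J. sqrt (s - sum a J)) \<longlongrightarrow> 0) (finite_subsets_at_top I)" by simp
  qed
  then show ?thesis unfolding L2_has_sum_def using u gL by (intro exI[of _ g]) (auto simp: S_def)
qed

section \<open>Interpolation and duality\<close>

lemma nn_integral_powr_from_0:
  assumes "q > -1" "c \<ge> 0"
  shows "(\<integral>\<^sup>+t. ennreal (t powr q) * indicator {0<..<c} t \<partial>lborel) = ennreal (c powr (q + 1) / (q + 1))"
proof -
  have "(\<integral>\<^sup>+t. ennreal (t powr q) * indicator {0<..<c} t \<partial>lborel)
      = (\<integral>\<^sup>+t. ennreal (t powr q) * indicator {0..c} t \<partial>lborel)"
  proof (rule nn_integral_cong_AE)
    have "AE t in lborel. t \<noteq> (0::real)" "AE t in lborel. t \<noteq> c" by (rule AE_lborel_singleton)+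
    then show "AE t in lborel. ennreal (t powr q) * indicator {0<..<c} t
      = ennreal (t powr q) * indicator {0..c} t"
      by eventually_elim (auto simp: indicator_def)
  qed
  also have "\<dots> = ennreal (c powr (q + 1) / (q + 1))"
    by (rule nn_integral_has_integral_lebesgue') (use has_integral_powr_from_0[OF assms] in auto)
  finally show ?thesis .
qed

lemma nn_integral_powr_to_inf:
  assumes "q < -1" "c > 0"
  shows "(\<integral>\<^sup>+t. ennreal (t powr q) * indicator {c..} t \<partial>lborel) = ennreal (c powr (q + 1) / (- q - 1))"
proof -
  have "- (c powr (q + 1)) / (q + 1) = c powr (q + 1) / (- q - 1)"
    using assms by (simp add: field_simps)
  then show ?thesis
    using nn_integral_has_integral_lebesgue'[OF _ has_integral_powr_to_inf[OF assms]] by auto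
qed

text \<open>The layer cake formula with the level written as 2t, because the interpolation splits a
  function into two pieces and grants each half of the level. The substitution produces the factor
  2^p.\<close>

lemma Lp_nn_layer_cake:
  assumes sf: "sigma_finite_measure M" and p: "p > 0" and [measurable]: "u \<in> borel_measurable M"
  shows "Lp_nn M p u = ennreal (2 powr p * p) *
    (\<integral>\<^sup>+t. ennreal (t powr (p - 1)) * indicator {0<..} t * emeasure M {x \<in> space M. 2 * t < \<bar>u x\<bar>} \<partial>lborel)"
proof -
  interpret sigma_finite_measure M by fact
  interpret pair_sigma_finite M lborel by (intro pair_sigma_finite.intro sf
    lborel.sigma_finite_measure_axioms)
  have "(\<integral>\<^sup>+t. ennreal (t powr (p - 1)) * indicator {0<..} t * emeasure M {x \<in> space M. 2 * t
    < \<bar>u x\<bar>} \<partial>lborel)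
      = (\<integral>\<^sup>+t. \<integral>\<^sup>+x. ennreal (t powr (p - 1)) * indicator {0<..} t * indicator {x \<in> space M. 2 * t < \<bar>u x\<bar>}
        x \<partial>M \<partial>lborel)"
    by (intro nn_integral_cong) (simp add: nn_integral_cmult)
  also have "\<dots> = (\<integral>\<^sup>+t. \<integral>\<^sup>+x. ennreal (t powr (p - 1)) * indicator {0<..} t * (if 2 * t
    < \<bar>u x\<bar> then 1 else 0) \<partial>M \<partial>lborel)"
    by (intro nn_integral_cong) (auto simp: indicator_def)
  also have "\<dots> = (\<integral>\<^sup>+x. \<integral>\<^sup>+t. ennreal (t powr (p - 1)) * indicator {0<..} t * (if 2 * t
    < \<bar>u x\<bar> then 1 else 0) \<partial>lborel \<partial>M)"
    by (rule Fubini') measurable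
  also have "\<dots> = (\<integral>\<^sup>+x. ennreal ((\<bar>u x\<bar> / 2) powr p / p) \<partial>M)"
  proof (rule nn_integral_cong)
    fix x
    have "(\<integral>\<^sup>+t. ennreal (t powr (p - 1)) * indicator {0<..} t * (if 2 * t < \<bar>u x\<bar> then 1 else 0) \<partial>lborel)
        = (\<integral>\<^sup>+t. ennreal (t powr (p - 1)) * indicator {0<..<\<bar>u x\<bar> / 2} t \<partial>lborel)"
      by (intro nn_integral_cong) (auto simp: indicator_def)
    then show "(\<integral>\<^sup>+t. ennreal (t powr (p - 1)) * indicator {0<..} t * (if 2 * t
      < \<bar>u x\<bar> then 1 else 0) \<partial>lborel)
        = ennreal ((\<bar>u x\<bar> / 2) powr p / p)"
      using p by (simp add: nn_integral_powr_from_0)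
  qed
  finally have "ennreal (2 powr p * p) * (\<integral>\<^sup>+t. ennreal (t powr (p - 1)) * indicator {0<..} t * emeasure M {x \<in> space M. 2 * t < \<bar>u x\<bar>} \<partial>lborel)
      = (\<integral>\<^sup>+x. ennreal (2 powr p * p) * ennreal ((\<bar>u x\<bar> / 2) powr p / p) \<partial>M)"
    by (simp add: nn_integral_cmult)
  also have "\<dots> = Lp_nn M p u" unfolding Lp_nn_def
    using p by (intro nn_integral_cong) (simp add: ennreal_mult[symmetric] powr_divide)
  finally show ?thesis by simp
qed

text \<open>Split f at the height t. Above it \<bar>f\<bar> is at most f^2/t, so that piece is
  integrable; both pieces stay in L2, where T is given. Integrating the two weak type bounds over t
  leaves t^(p-2) over t < \<bar>f x\<bar> and t^(p-3) over t \<ge> \<bar>f x\<bar>, whose integrals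
  are finite because p > 1 and p < 2 respectively.\<close>

theorem Marcinkiewicz_1_2:
  assumes sf: "sigma_finite_measure M" and p: "1 < p" "p < 2" and C: "C1 \<ge> 0" "C2 \<ge> 0"
    and T: "\<And>f. f \<in> Lp M 2 \<Longrightarrow> T f \<in> borel_measurable M"
    and lin: "ae_linear_on M (Lp M 2) T"
    and w1: "weak_type M 1 C1 (Lp M 2 \<inter> Lp M 1) T"
    and w2: "weak_type M 2 C2 (Lp M 2) T"
    and f: "f \<in> Lp M 2"
  shows "Lp_nn M p (T f) \<le> ennreal (2 powr p * p * (C1 / (p - 1) + C2 / (2 - p))) * Lp_nn M p f"
proof -
  interpret sigma_finite_measure M by fact
  interpret pair_sigma_finite M lborel by (intro pair_sigma_finite.intro sf
    lborel.sigma_finite_measure_axioms)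
  have [measurable]: "f \<in> borel_measurable M" "T f \<in> borel_measurable M" using f T by (auto simp: Lp_iff)
  let ?g1 = "\<lambda>t x. ennreal (\<bar>f x\<bar>) * (if t < \<bar>f x\<bar> then 1 else 0)"
  let ?g2 = "\<lambda>t x. ennreal (\<bar>f x\<bar> powr 2) * (if \<bar>f x\<bar> \<le> t then 1 else 0)"
  have split: "emeasure M {x \<in> space M. 2 * t < \<bar>T f x\<bar>}
      \<le> ennreal (C1 / t) * (\<integral>\<^sup>+x. ?g1 t x \<partial>M) + ennreal (C2 / t powr 2) * (\<integral>\<^sup>+x. ?g2 t x \<partial>M)"
    if t: "t > 0" for t
  proof -
    define f1 f2 where "f1 = (\<lambda>x. if t < \<bar>f x\<bar> then f x else 0)" and "f2
      = (\<lambda>x. if \<bar>f x\<bar> \<le> t then f x else 0)"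
    have [measurable]: "f1 \<in> borel_measurable M" "f2 \<in> borel_measurable M" unfolding f1_def f2_def
      by measurable
    have f12: "f1 \<in> Lp M 2" "f2 \<in> Lp M 2"
      by (rule Lp_dominated[OF _ f]; auto simp: f1_def f2_def)+
    have f11: "f1 \<in> Lp M 1"
    proof -
      have "integrable M (\<lambda>x. \<bar>f1 x\<bar>)"
      proof (rule Bochner_Integration.integrable_bound)
        show "integrable M (\<lambda>x. 1 / t * (f x * f x))" using f by (auto simp: L2_iff)
        have "\<bar>f1 x\<bar> \<le> 1 / t * (f x * f x)" for x
        proof -
          have "\<bar>f x\<bar> * t \<le> \<bar>f x\<bar> * \<bar>f x\<bar>" if "t < \<bar>f x\<bar>" using that by (intro mult_left_mono) auto
          then show ?thesis using t by (auto simp: f1_def field_simps)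
        qed
        then show "AE x in M. norm \<bar>f1 x\<bar> \<le> norm (1 / t * (f x * f x))" using t by (auto intro!: AE_I2)
      qed auto
      then show ?thesis by (simp add: Lp_def)
    qed
    have ff: "(\<lambda>y. 1 * f1 y + 1 * f2 y) = f" by (auto simp: f1_def f2_def)
    have "AE x in M. T (\<lambda>y. 1 * f1 y + 1 * f2 y) x = 1 * T f1 x + 1 * T f2 x"
      using lin f12 unfolding ae_linear_on_def by blast
    then have "AE x in M. T f x = T f1 x + T f2 x" unfolding ff by simp
    then have "emeasure M {x \<in> space M. 2 * t < \<bar>T f x\<bar>}
        \<le> emeasure M ({x \<in> space M. t < \<bar>T f1 x\<bar>} \<union> {x \<in> space M. t < \<bar>T f2 x\<bar>})"
      using T[OF f12(1)] T[OF f12(2)] by (intro emeasure_mono_AE) (auto elim!: eventually_mono)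
    also have "\<dots> \<le> emeasure M {x \<in> space M. t < \<bar>T f1 x\<bar>} + emeasure M {x \<in> space M. t < \<bar>T f2 x\<bar>}"
      using T[OF f12(1)] T[OF f12(2)] by (intro emeasure_subadditive) auto
    also have "\<dots> \<le> ennreal (C1 / t powr 1) * Lp_nn M 1 f1 + ennreal (C2 / t powr 2) * Lp_nn M 2 f2"
      using w1 w2 f12 f11 t unfolding weak_type_def by (intro add_mono) auto
    also have "Lp_nn M 1 f1 = (\<integral>\<^sup>+x. ?g1 t x \<partial>M)"
      unfolding Lp_nn_def f1_def by (intro nn_integral_cong) auto
    also have "Lp_nn M 2 f2 = (\<integral>\<^sup>+x. ?g2 t x \<partial>M)"
      unfolding Lp_nn_def f2_def by (intro nn_integral_cong) auto
    finally show ?thesis using t by simp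
  qed
  have I1: "(\<integral>\<^sup>+t. ennreal (t powr (p - 2)) * indicator {0<..} t * (\<integral>\<^sup>+x. ?g1 t x \<partial>M) \<partial>lborel)
    = ennreal (1 / (p - 1)) * Lp_nn M p f"
  proof -
    have "(\<integral>\<^sup>+t. ennreal (t powr (p - 2)) * indicator {0<..} t * (\<integral>\<^sup>+x. ?g1 t x \<partial>M) \<partial>lborel)
        = (\<integral>\<^sup>+t. \<integral>\<^sup>+x. ennreal (t powr (p - 2)) * indicator {0<..} t * ?g1 t x \<partial>M \<partial>lborel)"
      by (intro nn_integral_cong) (simp add: nn_integral_cmult)
    also have "\<dots> = (\<integral>\<^sup>+x. \<integral>\<^sup>+t. ennreal (t powr (p - 2)) * indicator {0<..} t * ?g1 t x \<partial>lborel \<partial>M)"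
      by (rule Fubini') measurable
    also have "\<dots> = (\<integral>\<^sup>+x. ennreal (1 / (p - 1)) * ennreal (\<bar>f x\<bar> powr p) \<partial>M)"
    proof (rule nn_integral_cong)
      fix x
      have "(\<integral>\<^sup>+t. ennreal (t powr (p - 2)) * indicator {0<..} t * ?g1 t x \<partial>lborel)
          = (\<integral>\<^sup>+t. ennreal \<bar>f x\<bar> * (ennreal (t powr (p - 2)) * indicator {0<..<\<bar>f x\<bar>} t) \<partial>lborel)"
        by (intro nn_integral_cong) (auto simp: indicator_def mult.commute)
      also have "\<dots> = ennreal \<bar>f x\<bar> * ennreal (\<bar>f x\<bar> powr (p - 1) / (p - 1))"
        using p nn_integral_powr_from_0[of "p - 2" "\<bar>f x\<bar>"] by (simp add: nn_integral_cmult)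
      also have "\<dots> = ennreal (1 / (p - 1) * \<bar>f x\<bar> powr p)"
        using p by (cases "f x = 0") (auto simp: ennreal_mult[symmetric] powr_mult_base)
      finally show "(\<integral>\<^sup>+t. ennreal (t powr (p - 2)) * indicator {0<..} t * ?g1 t x \<partial>lborel)
        = ennreal (1 / (p - 1)) * ennreal (\<bar>f x\<bar> powr p)" using p by (subst ennreal_mult[symmetric]) auto
    qed
    also have "\<dots> = ennreal (1 / (p - 1)) * Lp_nn M p f" by (simp add: nn_integral_cmult Lp_nn_def)
    finally show ?thesis .
  qed
  have I2: "(\<integral>\<^sup>+t. ennreal (t powr (p - 3)) * indicator {0<..} t * (\<integral>\<^sup>+x. ?g2 t x \<partial>M) \<partial>lborel)
    = ennreal (1 / (2 - p)) * Lp_nn M p f"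
  proof -
    have "(\<integral>\<^sup>+t. ennreal (t powr (p - 3)) * indicator {0<..} t * (\<integral>\<^sup>+x. ?g2 t x \<partial>M) \<partial>lborel)
        = (\<integral>\<^sup>+t. \<integral>\<^sup>+x. ennreal (t powr (p - 3)) * indicator {0<..} t * ?g2 t x \<partial>M \<partial>lborel)"
      by (intro nn_integral_cong) (simp add: nn_integral_cmult)
    also have "\<dots> = (\<integral>\<^sup>+x. \<integral>\<^sup>+t. ennreal (t powr (p - 3)) * indicator {0<..} t * ?g2 t x \<partial>lborel \<partial>M)"
      by (rule Fubini') measurable
    also have "\<dots> = (\<integral>\<^sup>+x. ennreal (1 / (2 - p)) * ennreal (\<bar>f x\<bar> powr p) \<partial>M)"
    proof (rule nn_integral_cong)
      fix x
      show "(\<integral>\<^sup>+t. ennreal (t powr (p - 3)) * indicator {0<..} t * ?g2 t x \<partial>lborel)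
        = ennreal (1 / (2 - p)) * ennreal (\<bar>f x\<bar> powr p)"
      proof (cases "f x = 0")
        case False
        have "(\<integral>\<^sup>+t. ennreal (t powr (p - 3)) * indicator {0<..} t * ?g2 t x \<partial>lborel)
            = (\<integral>\<^sup>+t. ennreal (\<bar>f x\<bar> powr 2) * (ennreal (t powr (p - 3)) * indicator {\<bar>f x\<bar>..} t) \<partial>lborel)"
          using False by (intro nn_integral_cong) (auto simp: indicator_def mult.commute)
        also have "\<dots> = ennreal (\<bar>f x\<bar> powr 2) * ennreal (\<bar>f x\<bar> powr (p - 2) / (2 - p))"
          using p False nn_integral_powr_to_inf[of "p - 3" "\<bar>f x\<bar>"]
          by (subst nn_integral_cmult) auto
        also have "\<dots> = ennreal (1 / (2 - p) * \<bar>f x\<bar> powr p)"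
        proof -
          have "\<bar>f x\<bar> powr 2 * (\<bar>f x\<bar> powr (p - 2) / (2 - p)) = 1 / (2 - p) * \<bar>f x\<bar> powr p"
            by (simp only: times_divide_eq_right powr_add[symmetric]) simp
          then show ?thesis using p by (subst ennreal_mult[symmetric]) auto
        qed
        finally show ?thesis using p by (subst ennreal_mult[symmetric]) auto
      qed (use p in simp)
    qed
    also have "\<dots> = ennreal (1 / (2 - p)) * Lp_nn M p f" by (simp add: nn_integral_cmult Lp_nn_def)
    finally show ?thesis .
  qed
  have "(\<integral>\<^sup>+t. ennreal (t powr (p - 1)) * indicator {0<..} t * emeasure M {x \<in> space M. 2 * t
    < \<bar>T f x\<bar>} \<partial>lborel)
      \<le> (\<integral>\<^sup>+t. ennreal C1 * (ennreal (t powr (p - 2)) * indicator {0<..} t * (\<integral>\<^sup>+x. ?g1 t x \<partial>M))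
           + ennreal C2 * (ennreal (t powr (p - 3)) * indicator {0<..} t * (\<integral>\<^sup>+x. ?g2 t x \<partial>M)) \<partial>lborel)"
  proof (rule nn_integral_mono)
    fix t :: real
    show "ennreal (t powr (p - 1)) * indicator {0<..} t * emeasure M {x \<in> space M. 2 * t < \<bar>T f x\<bar>}
      \<le> ennreal C1 * (ennreal (t powr (p - 2)) * indicator {0<..} t * (\<integral>\<^sup>+x. ?g1 t x \<partial>M))
           + ennreal C2 * (ennreal (t powr (p - 3)) * indicator {0<..} t * (\<integral>\<^sup>+x. ?g2 t x \<partial>M))"
    proof (cases "t > 0")
      case True
      have "t powr (p - 1) * (C1 / t) = C1 * t powr (p - 2)"
        using True powr_diff[of t "p - 1" 1] by simp
      moreover have "t powr (p - 1) * (C2 / t powr 2) = C2 * t powr (p - 3)"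
        using True powr_diff[of t "p - 1" 2] by simp
      ultimately have e: "ennreal (t powr (p - 1)) * ennreal (C1 / t)
        = ennreal C1 * ennreal (t powr (p - 2))"
        "ennreal (t powr (p - 1)) * ennreal (C2 / t powr 2) = ennreal C2 * ennreal (t powr (p - 3))"
        using True C by (simp_all add: ennreal_mult[symmetric] del: powr_numeral)
      have "ennreal (t powr (p - 1)) * emeasure M {x \<in> space M. 2 * t < \<bar>T f x\<bar>}
        \<le> ennreal (t powr (p - 1)) * (ennreal (C1 / t) * (\<integral>\<^sup>+x. ?g1 t x \<partial>M) + ennreal (C2 / t powr 2) *
          (\<integral>\<^sup>+x. ?g2 t x \<partial>M))"
        by (intro mult_left_mono split True) auto
      also have "\<dots> = ennreal C1 * ennreal (t powr (p - 2)) * (\<integral>\<^sup>+x. ?g1 t x \<partial>M) + ennreal C2 * ennreal (t powr (p - 3)) * (\<integral>\<^sup>+x. ?g2 t x \<partial>M)"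
        by (simp only: e[symmetric] distrib_left mult.assoc)
      finally show ?thesis using True by (simp add: mult.assoc)
    qed auto
  qed
  also have "\<dots> = ennreal C1 * (ennreal (1 / (p - 1)) * Lp_nn M p f) + ennreal C2 * (ennreal (1 / (2 - p)) * Lp_nn M p f)"
    unfolding I1[symmetric] I2[symmetric]
    by (subst nn_integral_add) (auto simp: nn_integral_cmult)
  also have "\<dots> = ennreal (C1 / (p - 1) + C2 / (2 - p)) * Lp_nn M p f"
    using p C by (simp add: mult.assoc[symmetric] ennreal_mult[symmetric] ennreal_plus distrib_right)
  finally have "Lp_nn M p (T f) \<le> ennreal (2 powr p * p) * (ennreal (C1 / (p - 1) + C2 / (2 - p)) * Lp_nn M p f)"
    using p by (subst Lp_nn_layer_cake[OF sf]) (auto intro!: mult_left_mono)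
  then show ?thesis using p C by (simp add: mult.assoc[symmetric] ennreal_mult[symmetric] del: ennreal_plus)
qed

text \<open>
  With \<open>u = T f\<close>, the test function is \<open>sgn u \<bar>u\<bar>\<^bsup>p-1\<^esup>\<close>, truncated so that it is bounded and has a support
  of finite measure. Young's inequality with a small weight makes it possible to absorb its norm.
\<close>

theorem Lp_bound_by_duality:
  assumes sf: "sigma_finite_measure M" and p: "2 < p" and q: "q = p / (p - 1)" and C: "C \<ge> 0"
    and T: "\<And>f. f \<in> Lp M 2 \<Longrightarrow> T f \<in> Lp M 2" and T': "\<And>f. f \<in> Lp M 2 \<Longrightarrow> T' f \<in> Lp M 2"
    and adj: "\<And>f g. f \<in> Lp M 2 \<Longrightarrow> g \<in> Lp M 2 \<Longrightarrow> L2_inner M (T f) g = L2_inner M f (T' g)"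
    and bd: "\<And>g. g \<in> Lp M 2 \<inter> Lp M q \<Longrightarrow> Lp_nn M q (T' g) \<le> ennreal C * Lp_nn M q g"
  obtains K where "K \<ge> 0" "\<And>f. f \<in> Lp M 2 \<inter> Lp M p \<Longrightarrow> Lp_nn M p (T f) \<le> ennreal K * Lp_nn M p f"
proof -
  interpret sigma_finite_measure M by fact
  have q1: "q > 1" "1 / p + 1 / q = 1" "q * (p - 1) = p" unfolding q using p by (auto simp: field_simps)
  obtain A :: "nat \<Rightarrow> 'a set" where A: "range A \<subseteq> sets M" "(\<Union>i. A i) = space M"
    "\<And>i. emeasure M (A i) \<noteq> \<infinity>" "incseq A" using sigma_finite_incseq by blast
  have [measurable]: "A i \<in> sets M" for i using A by auto
  \<comment> \<open>The weight in Young's inequality, chosen so that \<eta>^q C is at most 1/2. The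
    summand 1 covers C = 0.\<close>
  define \<eta> where "\<eta> = (1 / (2 * (C + 1))) powr (1 / q)"
  have \<eta>: "\<eta> > 0" "\<eta> powr q * C \<le> 1 / 2"
    using C q1 by (auto simp: \<eta>_def powr_powr field_simps)
  define K where "K = 2 * \<eta> powr (- p)"
  have "Lp_nn M p (T f) \<le> ennreal K * Lp_nn M p f" if f: "f \<in> Lp M 2 \<inter> Lp M p" for f
  proof -
    define u where "u = T f"
    have uL: "u \<in> Lp M 2" using f T by (auto simp: u_def)
    have [measurable]: "u \<in> borel_measurable M" "f \<in> borel_measurable M" using uL f by (auto simp: Lp_iff)
    define v where "v n x = min \<bar>u x\<bar> (real n) * indicator (A n) x" for n x
    define g where "g n x = sgn (u x) * v n x powr (p - 1)" for n x
    have [measurable]: "v n \<in> borel_measurable M" "g n \<in> borel_measurable M" for n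
      unfolding v_def g_def by measurable
    have v0: "v n x \<ge> 0" "v n x \<le> real n" "v n x \<le> \<bar>u x\<bar>" "x \<notin> A n \<Longrightarrow> v n x = 0" for n x
      by (auto simp: v_def indicator_def)
    have gq: "\<bar>g n x\<bar> powr r = v n x powr (r * (p - 1))" if "r > 0" for n x r
    proof (cases "u x = 0")
      case True
      then have "v n x = 0" using v0(1,3)[of n x] by simp
      then show ?thesis by (simp add: g_def)
    qed (simp add: g_def abs_mult abs_sgn_eq powr_powr mult.commute)
    have gL: "g n \<in> Lp M r" if "r > 0" for n r
    proof -
      have "integrable M (\<lambda>x. \<bar>g n x\<bar> powr r)"
      proof (rule integrableI_bounded_set[of "A n" _ _ "real n powr (r * (p - 1))"])
        show "AE x in M. x \<in> A n \<longrightarrow> norm (\<bar>g n x\<bar> powr r) \<le> real n powr (r * (p - 1))"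
          using v0 that p by (intro AE_I2) (auto simp: gq intro!: powr_mono2)
        show "AE x in M. x \<notin> A n \<longrightarrow> \<bar>g n x\<bar> powr r = 0" using v0 that by (intro AE_I2) (auto simp: gq)
      qed (use A in \<open>auto simp: less_top\<close>)
      then show ?thesis by (simp add: Lp_def)
    qed
    have bound: "Lp_nn M p (v n) \<le> ennreal K * Lp_nn M p f" for n
    proof -
      have gn2: "g n \<in> Lp M 2" and gnq: "g n \<in> Lp M q" using gL q1 by auto
      define w where "w = T' (g n)"
      have w2: "w \<in> Lp M 2" unfolding w_def using gn2 T' by auto
      have wbd: "Lp_nn M q w \<le> ennreal C * Lp_nn M q (g n)" unfolding w_def using gn2 gnq bd by auto
      then have wq: "w \<in> Lp M q" using w2 gnq by
        (auto simp: Lp_iff ennreal_mult_less_top intro: order_le_less_trans)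
      define G where "G = (\<integral>x. \<bar>g n x\<bar> powr q \<partial>M)"
      define W where "W = (\<integral>x. \<bar>w x\<bar> powr q \<partial>M)"
      define F where "F = (\<integral>x. \<bar>f x\<bar> powr p \<partial>M)"
      have G: "Lp_nn M q (g n) = ennreal G" unfolding G_def Lp_nn_def using gnq
        by (intro nn_integral_eq_integral) (auto simp: Lp_def)
      have W: "Lp_nn M q w = ennreal W" unfolding W_def Lp_nn_def using wq
        by (intro nn_integral_eq_integral) (auto simp: Lp_def)
      have F: "Lp_nn M p f = ennreal F" unfolding F_def Lp_nn_def using f
        by (intro nn_integral_eq_integral) (auto simp: Lp_def)
      have pos: "G \<ge> 0" "W \<ge> 0" "F \<ge> 0" by (auto simp: G_def W_def F_def)
      have WG: "W \<le> C * G" using wbd pos C by (simp add: G W ennreal_mult[symmetric])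
      have "G \<le> L2_inner M u (g n)"
        unfolding G_def L2_inner_def
      proof (rule integral_mono)
        show "integrable M (\<lambda>x. \<bar>g n x\<bar> powr q)" using gnq by (auto simp: Lp_def)
        show "integrable M (\<lambda>x. u x * g n x)" using uL gn2 by (rule L2_integrable_mult)
        show "\<bar>g n x\<bar> powr q \<le> u x * g n x" for x
        proof -
          have "\<bar>g n x\<bar> powr q = v n x powr (1 + (p - 1))" using q1 by (simp add: gq)
          also have "\<dots> = v n x * v n x powr (p - 1)" by (simp only: powr_mult_base[OF v0(1)])
          also have "\<dots> \<le> \<bar>u x\<bar> * v n x powr (p - 1)" using v0 by (intro mult_right_mono) auto
          also have "\<dots> = u x * g n x" by (simp add: g_def abs_sgn mult_ac)
          finally show ?thesis .
        qed
      qed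
      also have "\<dots> = L2_inner M f w" unfolding u_def w_def using f gn2 adj by auto
      also have "\<dots> \<le> (\<integral>x. \<eta> powr (- p) * \<bar>f x\<bar> powr p + \<eta> powr q * \<bar>w x\<bar> powr q \<partial>M)"
        unfolding L2_inner_def
      proof (rule integral_mono)
        show "integrable M (\<lambda>x. f x * w x)" using f w2 by (intro L2_integrable_mult) auto
        show "integrable M (\<lambda>x. \<eta> powr (- p) * \<bar>f x\<bar> powr p + \<eta> powr q * \<bar>w x\<bar> powr q)"
          using f wq by (auto simp: Lp_def)
        show "f x * w x \<le> \<eta> powr (- p) * \<bar>f x\<bar> powr p + \<eta> powr q * \<bar>w x\<bar> powr q" for x
        proof -
          have "f x * w x \<le> \<bar>f x * w x\<bar>" by simp
          also have "\<dots> = (\<bar>f x\<bar> / \<eta>) * (\<eta> * \<bar>w x\<bar>)" using \<eta> by (simp add: abs_mult)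
          also have "\<dots> \<le> (\<bar>f x\<bar> / \<eta>) powr p / p + (\<eta> * \<bar>w x\<bar>) powr q / q"
            using p q1 \<eta> by (intro Youngs_inequality) auto
          also have "\<dots> \<le> (\<bar>f x\<bar> / \<eta>) powr p / 1 + (\<eta> * \<bar>w x\<bar>) powr q / 1"
            using p q1 by (intro add_mono divide_left_mono) auto
          also have "\<dots> = \<eta> powr (- p) * \<bar>f x\<bar> powr p + \<eta> powr q * \<bar>w x\<bar> powr q"
            using \<eta> by (simp add: powr_divide powr_mult powr_minus_divide)
          finally show ?thesis .
        qed
      qed
      also have "\<dots> = \<eta> powr (- p) * F + \<eta> powr q * W"
        unfolding F_def W_def using f wq by (subst Bochner_Integration.integral_add) (auto simp: Lp_def)
      also have "\<eta> powr q * W \<le> \<eta> powr q * (C * G)" using WG by (intro mult_left_mono) auto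
      also have "\<dots> \<le> 1 / 2 * G" using mult_right_mono[OF \<eta>(2) pos(1)] by (simp add: mult.assoc)
      \<comment> \<open>The truncation makes G finite, so that the term G/2 on the right can be
        subtracted.\<close>
      finally have "G \<le> K * F" by (simp add: K_def)
      moreover have "Lp_nn M p (v n) = Lp_nn M q (g n)"
        unfolding Lp_nn_def using q1 v0 by (simp add: gq)
      ultimately show ?thesis using pos by (simp add: F G K_def ennreal_mult[symmetric])
    qed
    have "Lp_nn M p (\<lambda>x. \<bar>u x\<bar>) \<le> ennreal K * Lp_nn M p f"
    proof (rule Lp_nn_liminf[of v])
      show "AE x in M. (\<lambda>n. v n x) \<longlonglongrightarrow> \<bar>u x\<bar>"
      proof (rule AE_I2)
        fix x assume "x \<in> space M"
        then obtain m where m: "x \<in> A m" using A(2) by blast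
        obtain k where k: "\<bar>u x\<bar> \<le> real k" using real_arch_simple by blast
        have "v n x = \<bar>u x\<bar>" if "n \<ge> max m k" for n
        proof -
          have "x \<in> A n" using m that \<open>incseq A\<close> by (auto dest: incseqD)
          moreover have "\<bar>u x\<bar> \<le> real n" using k that by simp
          ultimately show ?thesis by (simp add: v_def)
        qed
        then have "\<forall>\<^sub>F n in sequentially. v n x = \<bar>u x\<bar>"
          unfolding eventually_sequentially by blast
        then show "(\<lambda>n. v n x) \<longlonglongrightarrow> \<bar>u x\<bar>" by (rule tendsto_eventually)
      qed
    qed (use bound p in auto)
    then show ?thesis by (simp add: Lp_nn_def u_def)
  qed
  moreover have "K \<ge> 0" by (simp add: K_def)
  ultimately show ?thesis using that by blast
qed

section \<open>Dyadic cubes\<close>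

locale dyadic_space =
  fixes M :: "'a measure" and d :: "'a \<Rightarrow> 'a \<Rightarrow> real" and lam :: real and D :: "int \<Rightarrow> 'a set set"
  assumes hom: "homogeneous_type M d"
    and dyadic: "dyadic_family M d lam D"
    and quad: "\<exists>Q\<in>(\<Union>j. D j). space M = quadrant D Q"
begin

abbreviation "cubes \<equiv> (\<Union>j. D j)"
abbreviation "\<B> \<equiv> branching D"

lemma lam: "0 < lam" "lam < 1"
  using dyadic by (auto simp: dyadic_family_def)

lemma dyadic_parts:
  shows "D j \<subseteq> sets (dborel (space M) d)" "disjoint (D j)" "space M = \<Union>(D j)"
    and "\<forall>i j. \<forall>Q\<in>D j. \<forall>Q'\<in>D i. i \<le> j \<longrightarrow> Q \<subseteq> Q' \<or> Q \<inter> Q' = {}"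
    and "\<exists>a1>0. \<exists>a2>0. \<forall>j. \<forall>Q\<in>D j. \<exists>x\<in>Q.
        dball (space M) d x (a1 * lam powi j) \<subseteq> Q \<and> Q \<subseteq> dball (space M) d x (a2 * lam powi j)"
  using dyadic unfolding dyadic_family_def by simp_all

lemma D_disjoint: "Q \<in> D j \<Longrightarrow> Q' \<in> D j \<Longrightarrow> x \<in> Q \<Longrightarrow> x \<in> Q' \<Longrightarrow> Q = Q'"
  using dyadic_parts(2)[of j] unfolding disjoint_def by blast

lemma cube_sets [measurable]: "Q \<in> cubes \<Longrightarrow> Q \<in> sets M"
  using dyadic_parts(1) hom by (auto simp: homogeneous_type_def)

lemma D_sets: "Q \<in> D j \<Longrightarrow> Q \<in> sets M"
  using cube_sets by blast

lemma cube_subset: "Q \<in> cubes \<Longrightarrow> Q \<subseteq> space M"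
  using cube_sets sets.sets_into_space by blast

lemma D_cover: "x \<in> space M \<Longrightarrow> \<exists>Q\<in>D j. x \<in> Q"
  using dyadic_parts(3)[of j] by auto

lemma D_nested: "Q \<in> D j \<Longrightarrow> Q' \<in> D i \<Longrightarrow> i \<le> j \<Longrightarrow> x \<in> Q \<Longrightarrow> x \<in> Q' \<Longrightarrow> Q \<subseteq> Q'"
  using dyadic_parts(4) by blast

lemma dyadic_balls:
  obtains a1 a2 where "a1 > 0" "a2 > 0"
    "\<And>j Q. Q \<in> D j \<Longrightarrow> \<exists>x\<in>Q. dball (space M) d x (a1 * lam powi j) \<subseteq> Q
      \<and> Q \<subseteq> dball (space M) d x (a2 * lam powi j)"
  using dyadic_parts(5) by blast

lemma cube_nonempty: "Q \<in> cubes \<Longrightarrow> Q \<noteq> {}"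
proof -
  assume "Q \<in> cubes"
  then obtain j where j: "Q \<in> D j" by auto
  show ?thesis using dyadic_balls j by (metis empty_iff)
qed

lemma cubes_nested:
  assumes "Q \<in> cubes" "Q' \<in> cubes"
  shows "Q \<subseteq> Q' \<or> Q' \<subseteq> Q \<or> Q \<inter> Q' = {}"
proof -
  obtain i j where "Q \<in> D i" "Q' \<in> D j" using assms by auto
  then show ?thesis using D_nested[of Q i Q' j] D_nested[of Q' j Q i]
    by (cases "i \<le> j") auto
qed

text \<open>The cubes at a point form a descending sequence in the level, in which one set may fill
  several consecutive levels. Most questions about nesting are reduced to the monotonicity of this
  sequence.\<close>

definition cube_at :: "int \<Rightarrow> 'a \<Rightarrow> 'a set" where
  "cube_at j x = (THE Q. Q \<in> D j \<and> x \<in> Q)"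

lemma cube_at_eq: "Q \<in> D j \<Longrightarrow> x \<in> Q \<Longrightarrow> cube_at j x = Q"
  unfolding cube_at_def by (rule the_equality) (simp, metis D_disjoint)

lemma cube_at: "x \<in> space M \<Longrightarrow> cube_at j x \<in> D j" "x \<in> space M \<Longrightarrow> x \<in> cube_at j x"
  using D_cover cube_at_eq by metis+

lemma cube_at_cubes: "x \<in> space M \<Longrightarrow> cube_at j x \<in> cubes"
  using cube_at by auto

lemma cube_at_antimono: "x \<in> space M \<Longrightarrow> i \<le> j \<Longrightarrow> cube_at j x \<subseteq> cube_at i x"
  using D_nested cube_at by metis

lemma cube_at_same: "x \<in> space M \<Longrightarrow> y \<in> cube_at j x \<Longrightarrow> cube_at j y = cube_at j x"
  using cube_at_eq cube_at by metis

lemma cube_at_same_antimono: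
  "x \<in> space M \<Longrightarrow> y \<in> space M \<Longrightarrow> i \<le> j \<Longrightarrow> cube_at j x = cube_at j y \<Longrightarrow> cube_at i x = cube_at i y"
  using cube_at_antimono cube_at cube_at_same by (metis subsetD)

section \<open>Measures of balls and cubes\<close>

lemma quasi_metric:
  obtains K where "K \<ge> 1"
    "\<And>x y z. x \<in> space M \<Longrightarrow> y \<in> space M \<Longrightarrow> z \<in> space M \<Longrightarrow> d x y \<le> K * (d x z + d z y)"
    "\<And>x y. x \<in> space M \<Longrightarrow> y \<in> space M \<Longrightarrow> d x y = d y x"
    "\<And>x y. x \<in> space M \<Longrightarrow> y \<in> space M \<Longrightarrow> x \<noteq> y \<Longrightarrow> d x y > 0"
proof -
  have q: "\<And>x y. x \<in> space M \<Longrightarrow> y \<in> space M \<Longrightarrow> 0 \<le> d x y \<and> d x y = d y x \<and> (d x y = 0 \<longleftrightarrow> x = y)"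
    using hom by (auto simp: homogeneous_type_def quasi_distance_def)
  have "\<exists>K. \<forall>x\<in>space M. \<forall>y\<in>space M. \<forall>z\<in>space M. d x y \<le> K * (d x z + d z y)"
    using hom unfolding homogeneous_type_def quasi_distance_def by (elim conjE)
  then obtain K where K: "\<And>x y z. x \<in> space M \<Longrightarrow> y \<in> space M \<Longrightarrow> z \<in> space M \<Longrightarrow> d x y \<le> K * (d x z + d z y)"
    by blast
  have "d x y \<le> max K 1 * (d x z + d z y)" if "x \<in> space M" "y \<in> space M" "z \<in> space M" for x y z
    using K[OF that] q[of x z] q[of z y] that
    by (intro order_trans[OF K[OF that]] mult_right_mono) auto
  moreover have "d x y > 0" if "x \<in> space M" "y \<in> space M" "x \<noteq> y" for x y
    using q[OF that(1,2)] that(3) by auto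
  ultimately show ?thesis using that[of "max K 1"] q by auto
qed

lemma ball_sets: "x \<in> space M \<Longrightarrow> r > 0 \<Longrightarrow> dball (space M) d x r \<in> sets M"
  using hom by (auto simp: homogeneous_type_def)

lemma doubling:
  obtains A :: real where "A \<ge> 1"
    "\<And>x r. x \<in> space M \<Longrightarrow> r > 0 \<Longrightarrow> emeasure M (dball (space M) d x r) < \<infinity>"
    "\<And>x r. x \<in> space M \<Longrightarrow> r > 0 \<Longrightarrow> measure M (dball (space M) d x r) > 0"
    "\<And>x r m. x \<in> space M \<Longrightarrow> r > 0 \<Longrightarrow>
       measure M (dball (space M) d x (2 ^ m * r)) \<le> A ^ m * measure M (dball (space M) d x r)"
proof -
  let ?B = "dball (space M) d"
  have "\<exists>A::real. \<forall>x\<in>space M. \<forall>r>0.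
        0 < emeasure M (?B x (2 * r)) \<and> emeasure M (?B x (2 * r)) \<le> ennreal A * emeasure M (?B x r) \<and>
        ennreal A * emeasure M (?B x r) < \<infinity>"
    using hom unfolding homogeneous_type_def by simp
  then obtain A :: real where A: "\<And>x r. x \<in> space M \<Longrightarrow> r > 0 \<Longrightarrow>
        0 < emeasure M (?B x (2 * r)) \<and> emeasure M (?B x (2 * r)) \<le> ennreal A * emeasure M (?B x r) \<and>
        ennreal A * emeasure M (?B x r) < \<infinity>" by blast
  have pos: "emeasure M (?B x r) > 0" if "x \<in> space M" "r > 0" for x r
    using A[OF that(1), of "r / 2"] that by auto
  have fin: "emeasure M (?B x r) < \<infinity>" if "x \<in> space M" "r > 0" for x r
  proof -
    \<comment> \<open>The product with A bounds a positive number, so A is not 0 and the finiteness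
      of the product passes to the ball.\<close>
    have "ennreal A \<noteq> 0" using A[OF that] by auto
    then show ?thesis using A[OF that] by (auto simp: ennreal_mult_less_top)
  qed
  have em: "emeasure M (?B x r) = ennreal (measure M (?B x r))" if "x \<in> space M" "r > 0" for x r
    using fin[OF that] by (simp add: emeasure_eq_ennreal_measure)
  have pos': "measure M (?B x r) > 0" if "x \<in> space M" "r > 0" for x r
    using pos[OF that] em[OF that] by auto
  have dbl: "measure M (?B x (2 * r)) \<le> max A 1 * measure M (?B x r)" if "x \<in> space M" "r > 0" for x r
  proof -
    have "ennreal (measure M (?B x (2 * r))) \<le> ennreal A * ennreal (measure M (?B x r))"
      using A[OF that] em[OF that] em[of x "2 * r"] that by simp
    also have "\<dots> \<le> ennreal (max A 1) * ennreal (measure M (?B x r))"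
      by (intro mult_right_mono ennreal_leI) auto
    finally show ?thesis by (simp add: ennreal_mult[symmetric])
  qed
  have "measure M (?B x (2 ^ m * r)) \<le> max A 1 ^ m * measure M (?B x r)" if "x \<in> space M" "r > 0" for x r m
  proof (induction m)
    case (Suc m)
    have "measure M (?B x (2 * (2 ^ m * r))) \<le> max A 1 * measure M (?B x (2 ^ m * r))"
      using that by (intro dbl) auto
    also have "\<dots> \<le> max A 1 * (max A 1 ^ m * measure M (?B x r))"
      using Suc by (intro mult_left_mono) auto
    finally show ?case by (simp add: mult.assoc)
  qed simp
  then show ?thesis using that[of "max A 1"] fin pos' by auto
qed

lemma emeasure_cube_finite: "Q \<in> cubes \<Longrightarrow> emeasure M Q < \<infinity>"
proof -
  assume Q: "Q \<in> cubes"
  then obtain j where j: "Q \<in> D j" by auto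
  obtain a1 a2 :: real where a: "a2 > 0" "\<exists>x\<in>Q. Q \<subseteq> dball (space M) d x (a2 * lam powi j)"
    using dyadic_balls j by metis
  obtain x where x: "x \<in> Q" "Q \<subseteq> dball (space M) d x (a2 * lam powi j)" using a by auto
  have X: "x \<in> space M" using x cube_subset Q by auto
  have r: "a2 * lam powi j > 0" using a lam by simp
  obtain A :: real where "\<And>x r. x \<in> space M \<Longrightarrow> r > 0 \<Longrightarrow> emeasure M (dball (space M) d x r) < \<infinity>"
    using doubling by metis
  then have "emeasure M (dball (space M) d x (a2 * lam powi j)) < \<infinity>" using X r by auto
  then show ?thesis using emeasure_mono[OF x(2) ball_sets[OF X r]] by (rule order_le_less_trans[rotated])
qed

lemma emeasure_cube: "Q \<in> cubes \<Longrightarrow> emeasure M Q = ennreal (measure M Q)"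
  using emeasure_cube_finite[of Q] by (intro emeasure_eq_ennreal_measure) auto

lemma measure_cube_mono: "Q \<in> cubes \<Longrightarrow> Q' \<in> cubes \<Longrightarrow> Q \<subseteq> Q' \<Longrightarrow> measure M Q \<le> measure M Q'"
  using emeasure_cube_finite[of Q'] cube_sets[of Q] cube_sets[of Q']
    by (intro measure_mono_fmeasurable) (auto simp: fmeasurable_def)

lemma measure_cube_pos: "Q \<in> cubes \<Longrightarrow> measure M Q > 0"
proof -
  assume Q: "Q \<in> cubes"
  then obtain j where j: "Q \<in> D j" by auto
  obtain a1 a2 :: real where a: "a1 > 0" "\<exists>x\<in>Q. dball (space M) d x (a1 * lam powi j) \<subseteq> Q"
    using dyadic_balls j by metis
  obtain x where x: "x \<in> Q" "dball (space M) d x (a1 * lam powi j) \<subseteq> Q" using a by auto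
  have X: "x \<in> space M" using x cube_subset Q by auto
  have r: "a1 * lam powi j > 0" using a lam by simp
  obtain A :: real where "\<And>x r. x \<in> space M \<Longrightarrow> r > 0 \<Longrightarrow> measure M (dball (space M) d x r) > 0"
    using doubling by metis
  then have "measure M (dball (space M) d x (a1 * lam powi j)) > 0" using X r by auto
  also have "measure M (dball (space M) d x (a1 * lam powi j)) \<le> measure M Q"
    using x emeasure_cube_finite[OF Q] cube_sets[OF Q] ball_sets[OF X r]
    by (intro measure_mono_fmeasurable) (auto simp: fmeasurable_def)
  finally show ?thesis .
qed

text \<open>By the quasi-triangle inequality Q lies in a ball about the centre of R whose radius is
  a fixed multiple of the inner radius of R. A number m of doublings that depends on K, a1, a2 and
  lam, but not on the cube, covers this multiple. The cap 1/2 keeps 1 - \<kappa> positive as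
  well.\<close>

lemma child_measure_ratio:
  "\<exists>\<kappa>>0. \<kappa> \<le> 1 / 2 \<and> (\<forall>j. \<forall>Q\<in>D j. \<forall>R\<in>D (j + 1). R \<subseteq> Q \<longrightarrow> \<kappa> * measure M Q \<le> measure M R)"
proof -
  let ?B = "dball (space M) d"
  obtain a1 a2 where a: "a1 > 0" "a2 > 0"
    "\<And>j Q. Q \<in> D j \<Longrightarrow> \<exists>x\<in>Q. ?B x (a1 * lam powi j) \<subseteq> Q \<and> Q \<subseteq> ?B x (a2 * lam powi j)"
    using dyadic_balls by metis
  obtain K where K: "K \<ge> 1"
    "\<And>x y z. x \<in> space M \<Longrightarrow> y \<in> space M \<Longrightarrow> z \<in> space M \<Longrightarrow> d x y \<le> K * (d x z + d z y)"
    "\<And>x y. x \<in> space M \<Longrightarrow> y \<in> space M \<Longrightarrow> d x y = d y x"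
    by (rule quasi_metric) blast
  obtain A :: real where A: "A \<ge> 1"
    "\<And>x r. x \<in> space M \<Longrightarrow> r > 0 \<Longrightarrow> emeasure M (?B x r) < \<infinity>"
    "\<And>x r m. x \<in> space M \<Longrightarrow> r > 0 \<Longrightarrow> measure M (?B x (2 ^ m * r)) \<le> A ^ m * measure M (?B x r)"
    by (rule doubling) blast
  obtain m where m: "2 * K * a2 / (a1 * lam) < 2 ^ m"
    using real_arch_pow[of 2] by auto
  have "A ^ m * measure M R \<ge> measure M Q" if Q: "Q \<in> D j" and R: "R \<in> D (j + 1)" "R \<subseteq> Q" for j Q R
  proof -
    define r where "r = a1 * lam powi (j + 1)"
    obtain x where x: "x \<in> R" "?B x r \<subseteq> R" using a(3)[OF R(1)] by (auto simp: r_def)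
    obtain z where z: "z \<in> Q" "Q \<subseteq> ?B z (a2 * lam powi j)" using a(3)[OF Q] by auto
    have QX: "Q \<subseteq> space M" "R \<subseteq> space M" using cube_subset Q R by auto
    have r: "r > 0" using a lam by (simp add: r_def)
    have "Q \<subseteq> ?B x (2 ^ m * r)"
    proof
      fix y assume y: "y \<in> Q"
      have "d x y \<le> K * (d z x + d z y)" using K(2)[of x y z] K(3)[of x z] x y z QX R by auto
      also have "\<dots> < K * (a2 * lam powi j + a2 * lam powi j)"
        using z y x R K(1) by (intro mult_strict_left_mono add_strict_mono) (auto simp: dball_def)
      also have "\<dots> = 2 * K * a2 / (a1 * lam) * r"
      proof -
        have "r = a1 * (lam powi j * lam)" unfolding r_def using lam by (simp add: power_int_add_1)
        then show ?thesis using lam a by (simp add: field_simps)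
      qed
      also have "\<dots> \<le> 2 ^ m * r" using m r by (intro mult_right_mono) auto
      finally show "y \<in> ?B x (2 ^ m * r)" using y QX by (auto simp: dball_def)
    qed
    then have "measure M Q \<le> measure M (?B x (2 ^ m * r))"
      using A(2)[of x "2 ^ m * r"] r x QX D_sets[OF Q] ball_sets[of x "2 ^ m * r"]
      by (intro measure_mono_fmeasurable) (auto simp: fmeasurable_def)
    also have "\<dots> \<le> A ^ m * measure M (?B x r)" using A x QX r by auto
    also have "measure M (?B x r) \<le> measure M R"
      using x QX r D_sets[of R] R ball_sets[of x r] emeasure_cube_finite[of R]
      by (intro measure_mono_fmeasurable) (auto simp: fmeasurable_def)
    finally show ?thesis using A(1) by (simp add: mult_left_mono)
  qed
  then have "min (1 / 2) (1 / A ^ m) * measure M Q \<le> measure M R"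
    if Q: "Q \<in> D j" and R: "R \<in> D (j + 1)" "R \<subseteq> Q" for j Q R
  proof -
    have "min (1 / 2) (1 / A ^ m) * measure M Q \<le> 1 / A ^ m * measure M Q"
      by (intro mult_right_mono) auto
    also have "\<dots> \<le> measure M R"
      using \<open>\<And>R Q j. Q \<in> D j \<Longrightarrow> R \<in> D (j + 1) \<Longrightarrow> R \<subseteq> Q \<Longrightarrow> measure M Q \<le> A ^ m * measure M R\<close>[OF that] A(1)
      by (simp add: field_simps)
    finally show ?thesis .
  qed
  then show ?thesis using A(1) by (intro exI[of _ "min (1 / 2) (1 / A ^ m)"]) auto
qed

text \<open>All later estimates depend on the doubling constant, the quasi-metric constant and the
  constants of the dyadic family only through this number.\<close>

definition \<kappa> :: real where
  "\<kappa> = (SOME \<kappa>. \<kappa> > 0 \<and> \<kappa> \<le> 1 / 2 \<and> (\<forall>j. \<forall>Q\<in>D j. \<forall>R\<in>D (j + 1). R \<subseteq> Q \<longrightarrow> \<kappa> * measure M Q \<le> measure M R))"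

lemma \<kappa>: "\<kappa> > 0" "\<kappa> \<le> 1 / 2" "Q \<in> D j \<Longrightarrow> R \<in> D (j + 1) \<Longrightarrow> R \<subseteq> Q \<Longrightarrow> \<kappa> * measure M Q \<le> measure M R"
  using someI_ex[OF child_measure_ratio] unfolding \<kappa>_def[symmetric] by auto

text \<open>Disjoint subcubes each carry at least the fraction \<kappa> of the mass. The statement
  is about finite subfamilies because the finiteness of the whole family is deduced from it.\<close>

lemma card_subcubes_le:
  assumes Q: "Q \<in> D j" and F: "finite F" "F \<subseteq> subcubes D j Q"
  shows "real (card F) \<le> 1 / \<kappa>"
proof -
  have FD: "R \<in> D (j + 1)" "R \<subseteq> Q" if "R \<in> F" for R using that F by (auto simp: subcubes_def)
  have "real (card F) * (\<kappa> * measure M Q) \<le> (\<Sum>R\<in>F. measure M R)"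
    using FD Q \<kappa>(3) by (intro sum_bounded_below) auto
  also have "\<dots> = measure M (\<Union>R\<in>F. R)"
  proof (rule measure_finite_Union[symmetric])
    show "disjoint_family_on (\<lambda>R. R) F" unfolding disjoint_family_on_def using FD D_disjoint by fastforce
    show "\<And>R. R \<in> F \<Longrightarrow> emeasure M R \<noteq> \<infinity>" using emeasure_cube_finite FD by (auto simp: less_top)
  qed (use F FD D_sets in auto)
  also have "\<dots> \<le> measure M Q"
    using FD F D_sets Q emeasure_cube_finite[of Q]
    by (intro measure_mono_fmeasurable) (auto simp: fmeasurable_def intro!: sets.finite_Union)
  finally have "real (card F) * \<kappa> * measure M Q \<le> 1 * measure M Q" by (simp add: mult.assoc)
  then have "real (card F) * \<kappa> \<le> 1"
    using measure_cube_pos[of Q] Q by (subst (asm) mult_le_cancel_right) auto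
  then show ?thesis using \<kappa>(1) by (simp add: field_simps)
qed

lemma finite_subcubes: "Q \<in> D j \<Longrightarrow> finite (subcubes D j Q)"
proof (rule ccontr)
  assume Q: "Q \<in> D j" and inf: "infinite (subcubes D j Q)"
  obtain n where n: "1 / \<kappa> < real n" using reals_Archimedean2 by blast
  obtain F where "F \<subseteq> subcubes D j Q" "card F = n" "finite F"
    using infinite_arbitrarily_large[OF inf] by metis
  then show False using card_subcubes_le[OF Q, of F] n by auto
qed

section \<open>Branching cubes and their children\<close>

lemma subcubes_cover: "Q \<in> D j \<Longrightarrow> x \<in> Q \<Longrightarrow> cube_at (j + 1) x \<in> subcubes D j Q"
  using cube_at cube_at_antimono[of x j "j + 1"] cube_at_eq[of Q j x] cube_subset[of Q]
  by (auto simp: subcubes_def)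

lemma branching_levelI:
  assumes "Q \<in> D j" "x \<in> Q" "y \<in> Q" "cube_at (j + 1) x \<noteq> cube_at (j + 1) y"
  shows "Q \<in> branching_level D j"
proof -
  have "{cube_at (j + 1) x, cube_at (j + 1) y} \<subseteq> subcubes D j Q"
    using subcubes_cover assms by auto
  then have "card {cube_at (j + 1) x, cube_at (j + 1) y} \<le> card (subcubes D j Q)"
    by (intro card_mono finite_subcubes assms)
  then show ?thesis using assms by (simp add: branching_level_def)
qed

text \<open>A set that is its own subcube leaves no room for another one, since cubes of one level
  are disjoint and nonempty.\<close>

lemma branching_level_not_subcube:
  assumes "Q \<in> branching_level D j"
  shows "Q \<notin> subcubes D j Q"
proof
  assume QQ: "Q \<in> subcubes D j Q"
  have "R' = Q" if "R' \<in> subcubes D j Q" for R'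
  proof -
    have "R' \<in> cubes" using that by (auto simp: subcubes_def)
    then obtain x where "x \<in> R'" using cube_nonempty by blast
    then show ?thesis using that QQ D_disjoint[of R' "j + 1" Q x] by (auto simp: subcubes_def)
  qed
  then have "subcubes D j Q \<subseteq> {Q}" by auto
  then have "card (subcubes D j Q) \<le> 1" using card_mono[of "{Q}"] by fastforce
  then show False using assms by (simp add: branching_level_def)
qed

text \<open>If Q occurs at two levels, all cubes between them at a point of Q are squeezed to Q, so
  at the coarser level Q would be its own subcube. This gives the description in
  \<open>cube_level\<close> a meaning.\<close>

lemma branching_level_unique:
  assumes "Q \<in> branching_level D i" "Q \<in> branching_level D j"
  shows "i = j"
proof -
  have aux: False if "Q \<in> branching_level D i" "Q \<in> branching_level D j" "i < j" for i j
  proof -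
    have Q: "Q \<in> D i" "Q \<in> D j" using that by (auto simp: branching_level_def)
    obtain x where x: "x \<in> Q" using cube_nonempty Q by blast
    have X: "x \<in> space M" using cube_subset x Q by blast
    have "Q \<subseteq> cube_at (i + 1) x" using cube_at_antimono[OF X, of "i + 1" j] cube_at_eq[OF Q(2) x] that
      by simp
    moreover have "cube_at (i + 1) x \<in> subcubes D i Q" using subcubes_cover Q x by auto
    ultimately have "cube_at (i + 1) x = Q" by (auto simp: subcubes_def)
    with \<open>cube_at (i + 1) x \<in> subcubes D i Q\<close> show False using branching_level_not_subcube[OF that(1)]
      by simp
  qed
  show ?thesis using aux[OF assms] aux[OF assms(2,1)] by (meson linorder_neqE)
qed

lemma cube_level_eq: "Q \<in> branching_level D j \<Longrightarrow> cube_level D Q = j"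
  unfolding cube_level_def by (rule the_equality) (simp, metis branching_level_unique)

lemma children_eq: "Q \<in> branching_level D j \<Longrightarrow> children D Q = subcubes D j Q"
  by (simp add: children_def cube_level_eq)

lemma branchingE:
  assumes "Q \<in> \<B>"
  obtains j where "Q \<in> branching_level D j" "Q \<in> D j" "children D Q = subcubes D j Q"
  using assms children_eq by (auto simp: branching_def branching_level_def)

lemma branching_cube: "Q \<in> \<B> \<Longrightarrow> Q \<in> cubes"
  by (auto elim: branchingE)

lemma child_cube: "Q \<in> \<B> \<Longrightarrow> R \<in> children D Q \<Longrightarrow> R \<in> cubes"
  by (auto elim!: branchingE simp: subcubes_def)

lemma child_subset: "Q \<in> \<B> \<Longrightarrow> R \<in> children D Q \<Longrightarrow> R \<subset> Q"
  by (erule branchingE) (use branching_level_not_subcube in \<open>auto simp: subcubes_def\<close>)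

lemma card_children: "Q \<in> \<B> \<Longrightarrow> card (children D Q) > 1" "Q \<in> \<B> \<Longrightarrow> real (card (children D Q)) \<le> 1 / \<kappa>"
  using card_subcubes_le[OF _ finite_subcubes] by (auto elim!: branchingE simp: branching_level_def)

lemma child_measure: "Q \<in> \<B> \<Longrightarrow> R \<in> children D Q \<Longrightarrow> \<kappa> * measure M Q \<le> measure M R"
  using \<kappa>(3) by (auto elim!: branchingE simp: subcubes_def)

lemma children_disjoint: "Q \<in> \<B> \<Longrightarrow> R \<in> children D Q \<Longrightarrow> R' \<in> children D Q \<Longrightarrow> x \<in> R \<Longrightarrow> x \<in> R' \<Longrightarrow> R = R'"
  by (erule branchingE) (simp add: subcubes_def, metis D_disjoint)

lemma children_cover: "Q \<in> \<B> \<Longrightarrow> x \<in> Q \<Longrightarrow> \<exists>R\<in>children D Q. x \<in> R"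
  using subcubes_cover cube_at cube_subset branching_cube by (metis branchingE subsetD)

text \<open>No cube lies strictly between Q and one of its children: compare the level of W with the
  level at which Q branches. It follows later that a Haar function of Q is constant on every cube
  not containing Q.\<close>

lemma branching_trichotomy:
  assumes "Q \<in> \<B>" "W \<in> cubes"
  shows "Q \<subseteq> W \<or> Q \<inter> W = {} \<or> (\<exists>R\<in>children D Q. W \<subseteq> R)"
proof (rule ccontr)
  assume contra: "\<not> ?thesis"
  then obtain x where x: "x \<in> Q" "x \<in> W" by auto
  have X: "x \<in> space M" using x cube_subset assms by auto
  obtain j where j: "Q \<in> D j" "children D Q = subcubes D j Q" using branchingE assms by metis
  obtain k where k: "W \<in> D k" using assms by auto
  have "cube_at j x = Q" "cube_at k x = W" using x j k cube_at_eq by auto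
  moreover have "cube_at (j + 1) x \<in> children D Q" using subcubes_cover j x by simp
  ultimately show False
    using contra cube_at_antimono[OF X, of k j] cube_at_antimono[OF X, of "j + 1" k] by (cases "k \<le> j") auto
qed

text \<open>A cube of level n has quasi-diameter at most 2 K a2 lam^n, which tends to 0.\<close>

lemma points_separated:
  assumes "x \<in> space M" "y \<in> space M" "x \<noteq> y"
  shows "\<exists>j. cube_at j x \<noteq> cube_at j y"
proof (rule ccontr)
  assume "\<not> ?thesis"
  then have same: "cube_at j x = cube_at j y" for j by blast
  obtain a1 a2 where a: "a2 > 0" "\<And>j Q. Q \<in> D j \<Longrightarrow> \<exists>x\<in>Q. Q \<subseteq> dball (space M) d x (a2 * lam powi j)"
    using dyadic_balls by metis
  obtain K where K: "K \<ge> 1"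
    "\<And>x y z. x \<in> space M \<Longrightarrow> y \<in> space M \<Longrightarrow> z \<in> space M \<Longrightarrow> d x y \<le> K * (d x z + d z y)"
    "\<And>x y. x \<in> space M \<Longrightarrow> y \<in> space M \<Longrightarrow> d x y = d y x"
    "\<And>x y. x \<in> space M \<Longrightarrow> y \<in> space M \<Longrightarrow> x \<noteq> y \<Longrightarrow> d x y > 0"
    by (rule quasi_metric) blast
  have pos: "d x y / (2 * K * a2) > 0" using K(1,4) assms a by simp
  obtain n where n: "lam ^ n < d x y / (2 * K * a2)"
    using real_arch_pow_inv[OF pos lam(2)] by auto
  obtain z where z: "z \<in> cube_at (int n) x" "cube_at (int n) x \<subseteq> dball (space M) d z (a2 * lam powi int n)"
    using a(2)[of "cube_at (int n) x" "int n"] cube_at assms by auto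
  have zX: "z \<in> space M" using z(1) cube_subset[OF cube_at_cubes[OF assms(1)]] by blast
  have "x \<in> cube_at (int n) x" "y \<in> cube_at (int n) x" using cube_at(2) assms same[of "int n"] by auto
  then have lt: "d z x < a2 * lam ^ n" "d z y < a2 * lam ^ n" using z by (auto simp: dball_def)
  have "d x y \<le> K * (d z x + d z y)" using K(2)[of x y z] K(3)[of x z] assms zX by auto
  also have "\<dots> \<le> K * (a2 * lam ^ n + a2 * lam ^ n)" using lt K(1) by (intro mult_left_mono) auto
  also have "\<dots> = 2 * K * a2 * lam ^ n" by simp
  also have "\<dots> < d x y" using n K(1) a by (simp add: field_simps)
  finally show False by simp
qed

text \<open>The quadrant hypothesis enters here: any two cubes containing the fixed cube Q0 meet,
  hence are nested, and the larger one contains both points.\<close>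

lemma points_joined:
  assumes "x \<in> space M" "y \<in> space M"
  shows "\<exists>j. cube_at j x = cube_at j y"
proof -
  obtain Q0 where Q0: "Q0 \<in> cubes" "space M = \<Union>{Q' \<in> cubes. Q0 \<subseteq> Q'}"
    using quad by (auto simp: quadrant_def)
  obtain Q1 Q2 where Q: "Q1 \<in> cubes" "x \<in> Q1" "Q0 \<subseteq> Q1" "Q2 \<in> cubes" "y \<in> Q2" "Q0 \<subseteq> Q2"
    using assms unfolding Q0(2) by auto
  have "Q0 \<noteq> {}" using cube_nonempty Q0 by auto
  then have "Q1 \<subseteq> Q2 \<or> Q2 \<subseteq> Q1" using cubes_nested[OF Q(1,4)] Q by auto
  then obtain Q3 where "Q3 \<in> cubes" "x \<in> Q3" "y \<in> Q3" using Q by auto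
  then show ?thesis using cube_at_eq by (metis UN_E)
qed

text \<open>The points share a cube at some coarse level and are separated at some fine one, so
  there is a last common level. Its cube branches because the next level separates the
  points.\<close>

lemma minimal_branching_cube:
  assumes "x \<in> space M" "y \<in> space M" "x \<noteq> y"
  obtains j where "cube_at j x \<in> branching_level D j" "cube_at j x = cube_at j y"
    "cube_at (j + 1) x \<noteq> cube_at (j + 1) y"
    "\<And>Q. Q \<in> cubes \<Longrightarrow> x \<in> Q \<Longrightarrow> y \<in> Q \<Longrightarrow> cube_at j x \<subseteq> Q"
proof -
  obtain j0 where j0: "cube_at j0 x = cube_at j0 y" using points_joined[OF assms(1,2)] by blast
  obtain j1 where j1: "cube_at j1 x \<noteq> cube_at j1 y" using points_separated[OF assms] by blast
  define P where "P n \<longleftrightarrow> cube_at (j0 + int n) x \<noteq> cube_at (j0 + int n) y" for n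
  have lt: "j0 < j1" using cube_at_same_antimono[OF assms(1,2) _ j0, of j1] j1 by force
  have "P (nat (j1 - j0))" using j1 lt by (simp add: P_def)
  then obtain n where n: "P n" "\<And>m. m < n \<Longrightarrow> \<not> P m" by (metis exists_least_iff)
  have "n \<noteq> 0" using n(1) j0 by (auto simp: P_def)
  then obtain m where m: "n = Suc m" by (cases n) auto
  define j where "j = j0 + int m"
  have e: "cube_at j x = cube_at j y" using n(2)[of m] m by (simp add: P_def j_def)
  have ne: "cube_at (j + 1) x \<noteq> cube_at (j + 1) y" using n(1) m by (simp add: P_def j_def algebra_simps)
  have br: "cube_at j x \<in> branching_level D j"
    using branching_levelI[of "cube_at j x" j x y] cube_at assms e ne by metis
  have min: "cube_at j x \<subseteq> Q" if Q: "Q \<in> cubes" "x \<in> Q" "y \<in> Q" for Q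
  proof -
    obtain k where k: "Q \<in> D k" using Q by auto
    have "cube_at k x = Q" "cube_at k y = Q" using k Q cube_at_eq by auto
    moreover have "k \<le> j"
    proof (rule ccontr)
      assume "\<not> k \<le> j"
      then have "cube_at (j + 1) x = cube_at (j + 1) y"
        using cube_at_same_antimono[OF assms(1,2), of "j + 1" k] calculation by auto
      then show False using ne by simp
    qed
    ultimately show ?thesis using cube_at_antimono[OF assms(1)] by blast
  qed
  show ?thesis by (rule that[OF br e ne min])
qed

text \<open>Every cube shares some ancestor with the point x0, the ancestors of x0 are countably
  many, and each of them has finitely many descendants in every generation.\<close>

lemma countable_cubes: "countable cubes"
proof -
  obtain Q0 where "Q0 \<in> cubes" using quad by auto
  then obtain x0 where x0: "x0 \<in> space M" using cube_nonempty cube_subset by blast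
  have fin: "finite {Q \<in> D (j + int n). Q \<subseteq> P}" if "P \<in> D j" for P j n
  proof (induction n)
    case 0
    have "{Q \<in> D (j + int 0). Q \<subseteq> P} \<subseteq> {P}"
    proof
      fix Q assume "Q \<in> {Q \<in> D (j + int 0). Q \<subseteq> P}"
      then have Q: "Q \<in> D j" "Q \<subseteq> P" by auto
      then obtain x where x: "x \<in> Q" using cube_nonempty by blast
      then show "Q \<in> {P}" using D_disjoint[OF Q(1) that x] Q(2) by auto
    qed
    then show ?case using finite_subset by blast
  next
    case (Suc n)
    have "{Q \<in> D (j + int (Suc n)). Q \<subseteq> P} \<subseteq> (\<Union>Q\<in>{Q \<in> D (j + int n). Q \<subseteq> P}. subcubes D (j + int n) Q)"
    proof safe
      fix Q assume Q: "Q \<in> D (j + int (Suc n))" "Q \<subseteq> P"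
      then obtain x where x: "x \<in> Q" using cube_nonempty by blast
      have X: "x \<in> space M" using x Q cube_subset that by blast
      let ?Q = "cube_at (j + int n) x"
      have "cube_at j x = P" using cube_at_eq that x Q by auto
      then have "?Q \<subseteq> P" using cube_at_antimono[OF X, of j "j + int n"] by auto
      moreover have "Q = cube_at (j + int n + 1) x" using cube_at_eq[OF Q(1) x] by (simp add: add_ac)
      ultimately show "Q \<in> (\<Union>Q\<in>{Q \<in> D (j + int n). Q \<subseteq> P}. subcubes D (j + int n) Q)"
        using subcubes_cover[OF cube_at(1)[OF X] cube_at(2)[OF X], of "j + int n"] cube_at(1)[OF X] by blast
    qed
    moreover have "finite (\<Union>Q\<in>{Q \<in> D (j + int n). Q \<subseteq> P}. subcubes D (j + int n) Q)"
      using Suc finite_subcubes by auto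
    ultimately show ?case using finite_subset by blast
  qed
  have "cubes \<subseteq> (\<Union>i. \<Union>n. {Q \<in> D (i + int n). Q \<subseteq> cube_at i x0})"
  proof
    fix Q assume "Q \<in> cubes"
    then obtain k where k: "Q \<in> D k" by auto
    then obtain x where x: "x \<in> Q" using cube_nonempty by blast
    have X: "x \<in> space M" using x k cube_subset by blast
    obtain j where j: "cube_at j x = cube_at j x0" using points_joined[OF X x0] by blast
    define i where "i = min j k"
    have "cube_at i x = cube_at i x0" using cube_at_same_antimono[OF X x0 _ j, of i] by (simp add: i_def)
    moreover have "Q \<subseteq> cube_at i x" using cube_at_antimono[OF X, of i k] cube_at_eq[OF k x]
      by (simp add: i_def)
    moreover have "Q \<in> D (i + int (nat (k - i)))" using k by (simp add: i_def)
    ultimately show "Q \<in> (\<Union>i. \<Union>n. {Q \<in> D (i + int n). Q \<subseteq> cube_at i x0})" by blast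
  qed
  moreover have "countable (\<Union>i. \<Union>n. {Q \<in> D (i + int n). Q \<subseteq> cube_at i x0})"
    by (intro countable_UN countable_finite fin cube_at(1) x0 countableI_type)
  ultimately show ?thesis by (rule countable_subset)
qed

lemma countable_branching: "countable \<B>"
  using countable_cubes branching_cube by (meson countable_subset subsetI)

lemma sigma_finite: "sigma_finite_measure M"
proof
  have "space M = \<Union>(D 0)" using dyadic by (auto simp: dyadic_family_def)
  moreover have "countable (D 0)" by (rule countable_subset[OF _ countable_cubes]) auto
  moreover have "D 0 \<subseteq> sets M" using D_sets by auto
  moreover have "\<forall>a\<in>D 0. emeasure M a \<noteq> \<infinity>" using emeasure_cube_finite by (auto simp: less_top)
  ultimately show "\<exists>A. countable A \<and> A \<subseteq> sets M \<and> \<Union>A = space M \<and> (\<forall>a\<in>A. emeasure M a \<noteq> \<infinity>)" by metis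
qed

end

section \<open>Haar functions and parents\<close>

text \<open>Countable additivity of the measure with density f.\<close>

lemma nn_integral_disjoint_countable_Union:
  assumes "countable \<C>" "\<C> \<subseteq> sets M" "disjoint \<C>" and [measurable]: "f \<in> borel_measurable M"
  shows "(\<integral>\<^sup>+x. f x * indicator (\<Union>\<C>) x \<partial>M) = (\<integral>\<^sup>+C. (\<integral>\<^sup>+x. f x * indicator C x \<partial>M) \<partial>count_space \<C>)"
proof -
  have [measurable]: "\<Union>\<C> \<in> sets M" using assms by (intro sets.countable_Union) auto
  have "(\<integral>\<^sup>+x. f x * indicator (\<Union>\<C>) x \<partial>M) = emeasure (density M f) (\<Union>C\<in>\<C>. C)"
    by (simp add: emeasure_density)
  also have "\<dots> = (\<integral>\<^sup>+C. emeasure (density M f) C \<partial>count_space \<C>)"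
    using assms by (intro emeasure_UN_countable) (auto simp: disjoint_family_on_def disjoint_def)
  also have "\<dots> = (\<integral>\<^sup>+C. (\<integral>\<^sup>+x. f x * indicator C x \<partial>M) \<partial>count_space \<C>)"
    using assms by (intro nn_integral_cong emeasure_density) auto
  finally show ?thesis .
qed

lemma L2_set_integrable:
  assumes "f \<in> Lp M 2" "A \<in> sets M" "emeasure M A < \<infinity>"
  shows "set_integrable M A f"
proof -
  have "indicator A \<in> Lp M 2"
    using assms by (auto simp: L2_iff indicator_inter_arith[symmetric])
  from L2_integrable_mult[OF this assms(1)] show ?thesis by (simp add: set_integrable_def)
qed

text \<open>The two sides differ by (m - v)^2 times the measure of A: the mean is the best
  approximation by a constant.\<close>

lemma integral_squared_deviation_le:
  assumes g: "g \<in> Lp M 2" and A: "A \<in> sets M" "emeasure M A < \<infinity>" and m: "(\<integral>x. indicator A x * g x \<partial>M)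
    = m * measure M A"
  shows "(\<integral>\<^sup>+x. ennreal ((g x - m)\<^sup>2) * indicator A x \<partial>M) \<le> (\<integral>\<^sup>+x. ennreal ((g x - v)\<^sup>2) * indicator A x \<partial>M)"
proof -
  have [measurable]: "g \<in> borel_measurable M" using g by (rule Lp_measurable)
  have i1: "integrable M (\<lambda>x. indicator A x * g x)"
    using L2_set_integrable[OF g A] by (simp add: set_integrable_def)
  have i2: "integrable M (\<lambda>x. indicator A x * (g x * g x))"
    using integrable_mult_indicator[OF A(1), of "\<lambda>x. g x * g x"] g by (simp add: L2_iff)
  have i0: "integrable M (\<lambda>x. indicator A x :: real)" using A by auto
  have sq: "indicator A x * (g x - w)\<^sup>2 = indicator A x * (g x * g x) - 2 * w * (indicator A x * g x) + w\<^sup>2 * indicator A x" for w and x :: 'a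
    by (simp add: power2_eq_square algebra_simps)
  have int: "integrable M (\<lambda>x. indicator A x * (g x - w)\<^sup>2)" for w unfolding sq using i0 i1 i2 by simp
  have val: "(\<integral>x. indicator A x * (g x - w)\<^sup>2 \<partial>M)
    = (\<integral>x. indicator A x * (g x * g x) \<partial>M) - 2 * w * (m * measure M A) + w\<^sup>2 * measure M A" for w
    unfolding sq using i0 i1 i2 A by (simp add: m)
  have nn: "(\<integral>\<^sup>+x. ennreal ((g x - w)\<^sup>2) * indicator A x \<partial>M) = ennreal (\<integral>x. indicator A x * (g x - w)\<^sup>2 \<partial>M)"
    for w
  proof -
    have "(\<integral>\<^sup>+x. ennreal ((g x - w)\<^sup>2) * indicator A x \<partial>M) = (\<integral>\<^sup>+x. ennreal (indicator A x * (g x - w)\<^sup>2) \<partial>M)"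
      by (intro nn_integral_cong) (auto simp: indicator_def)
    also have "\<dots> = ennreal (\<integral>x. indicator A x * (g x - w)\<^sup>2 \<partial>M)"
      by (rule nn_integral_eq_integral[OF int]) auto
    finally show ?thesis .
  qed
  have "0 \<le> (m - v)\<^sup>2 * measure M A" by simp
  then have "(\<integral>x. indicator A x * (g x - m)\<^sup>2 \<partial>M) \<le> (\<integral>x. indicator A x * (g x - v)\<^sup>2 \<partial>M)"
    unfolding val by (simp add: power2_eq_square algebra_simps)
  then show ?thesis unfolding nn by (rule ennreal_leI)
qed

locale haar_space = dyadic_space M d lam D
  for M :: "'a measure" and d lam D +
  fixes H :: "('a \<Rightarrow> real) set"
  assumes haar: "haar_system M d D H"
begin

abbreviation "haar_support h \<equiv> haar_cube (space M) D h"
abbreviation "haars Q \<equiv> haar_at (space M) D H Q"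

lemma haar_parts:
  shows "h \<in> H \<Longrightarrow> simple_function (dborel (space M) d) h"
    and "L2_orthonormal_basis M H"
    and "h \<in> H \<Longrightarrow> \<exists>!j. \<exists>Q. minimal_cube (space M) D h j Q"
    and "Q \<in> \<B> \<Longrightarrow> card (haars Q) = card (children D Q) - 1"
    and "h \<in> H \<Longrightarrow> (\<integral>x. h x \<partial>M) = 0"
    and "Q \<in> \<B> \<Longrightarrow> step_space_basis M D Q (insert (\<lambda>x. measure M Q powr (- 1 / 2) * indicator Q x) (haars Q))"
  using haar unfolding haar_system_def by simp_all

lemma H_L2: "h \<in> H \<Longrightarrow> h \<in> Lp M 2"
  using haar_parts(2) by (auto simp: L2_orthonormal_basis_def)

lemma H_orthonormal: "h \<in> H \<Longrightarrow> g \<in> H \<Longrightarrow> L2_inner M h g = (if h = g then 1 else 0)"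
  using haar_parts(2) by (auto simp: L2_orthonormal_basis_def)

lemma H_dense:
  assumes "f \<in> Lp M 2" "e > 0"
  obtains g where "g \<in> lin_span H" "Lp_norm M 2 (\<lambda>x. f x - g x) < e"
  using haar_parts(2) assms unfolding L2_orthonormal_basis_def by blast

lemma H_measurable [measurable]: "h \<in> H \<Longrightarrow> h \<in> borel_measurable M"
  using H_L2 by (rule Lp_measurable)

lemma H_nonzero: "h \<in> H \<Longrightarrow> \<exists>x\<in>space M. h x \<noteq> 0"
proof (rule ccontr)
  assume h: "h \<in> H" and "\<not> (\<exists>x\<in>space M. h x \<noteq> 0)"
  then have "L2_inner M h h = (\<integral>x. 0 \<partial>M)"
    unfolding L2_inner_def by (intro Bochner_Integration.integral_cong) auto
  then show False using H_orthonormal[OF h h] by simp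
qed

text \<open>Condition (h.1) makes the level unique. The cube is then unique too, because h does not
  vanish everywhere and the cubes of one level are disjoint.\<close>

lemma minimal_cube_haar_support:
  assumes h: "h \<in> H"
  shows "\<exists>j. minimal_cube (space M) D h j (haar_support h)"
proof -
  obtain j Q where j: "minimal_cube (space M) D h j Q" using haar_parts(3)[OF h] by blast
  have "Q' = Q" if "minimal_cube (space M) D h j' Q'" for j' Q'
  proof -
    have "j' = j" using haar_parts(3)[OF h] j that by blast
    then have "Q' \<in> D j" "Q \<in> D j" "{x \<in> space M. h x \<noteq> 0} \<subseteq> Q'" "{x \<in> space M. h x \<noteq> 0} \<subseteq> Q"
      using j that by (auto simp: minimal_cube_def branching_level_def)
    moreover obtain x where "x \<in> space M" "h x \<noteq> 0" using H_nonzero h by auto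
    ultimately show ?thesis using D_disjoint[of Q' j Q x] by auto
  qed
  then show ?thesis unfolding haar_cube_def using j theI'[of "\<lambda>Q. \<exists>j. minimal_cube (space M) D h j Q"]
    by metis
qed

lemma haar_support_branching: "h \<in> H \<Longrightarrow> haar_support h \<in> \<B>"
  using minimal_cube_haar_support[of h] by (auto simp: minimal_cube_def branching_def)

lemma haar_zero_outside: "h \<in> H \<Longrightarrow> x \<in> space M \<Longrightarrow> x \<notin> haar_support h \<Longrightarrow> h x = 0"
  using minimal_cube_haar_support[of h] by (auto simp: minimal_cube_def)

lemma haarsD: "h \<in> haars Q \<Longrightarrow> h \<in> H" "h \<in> haars Q \<Longrightarrow> haar_support h = Q"
  by (auto simp: haar_at_def)

lemma haars_nonbranching: "Q \<notin> \<B> \<Longrightarrow> haars Q = {}"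
  using haar_support_branching by (auto simp: haar_at_def)

lemma card_haars_le: "real (card (haars Q)) \<le> 1 / \<kappa>"
proof (cases "Q \<in> \<B>")
  case True
  then have "card (haars Q) \<le> card (children D Q)" using haar_parts(4) by simp
  then show ?thesis using card_children(2)[OF True] by linarith
qed (use \<kappa>(1) in \<open>simp add: haars_nonbranching\<close>)

lemma haar_const_child:
  assumes "h \<in> H" "R \<in> children D (haar_support h)" "x \<in> R" "y \<in> R"
  shows "h x = h y"
proof -
  have "h \<in> haars (haar_support h)" using assms by (auto simp: haar_at_def)
  then have "h \<in> step_space D (haar_support h)"
    using haar_parts(6)[OF haar_support_branching[OF assms(1)]] by (auto simp: step_space_basis_def)
  then show ?thesis using assms by (auto simp: step_space_def constant_on_def)
qed

lemma haar_const:
  assumes "h \<in> H" "W \<in> cubes" "\<not> haar_support h \<subseteq> W" "x \<in> W" "y \<in> W"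
  shows "h x = h y"
proof -
  have X: "x \<in> space M" "y \<in> space M" using assms cube_subset by auto
  consider "haar_support h \<inter> W = {}" | R where "R \<in> children D (haar_support h)" "W \<subseteq> R"
    using branching_trichotomy[OF haar_support_branching[OF assms(1)] assms(2)] assms(3) by blast
  then show ?thesis
  proof cases
    case 1
    then have "h x = 0" "h y = 0" using haar_zero_outside[OF assms(1)] assms X by auto
    then show ?thesis by simp
  next
    case 2
    then show ?thesis using haar_const_child[OF assms(1)] assms by blast
  qed
qed

text \<open>On the child R containing x the function is constant, so h(x)^2 times the measure of R
  is at most the squared norm 1 of h; and R has at least the fraction \<kappa> of the mass.\<close>

lemma haar_bound:
  assumes h: "h \<in> H" and x: "x \<in> space M"
  shows "\<bar>h x\<bar> \<le> 1 / sqrt (\<kappa> * measure M (haar_support h))"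
proof (cases "x \<in> haar_support h")
  case True
  have B: "haar_support h \<in> \<B>" using h by (rule haar_support_branching)
  obtain R where R: "R \<in> children D (haar_support h)" "x \<in> R" using children_cover[OF B True] by auto
  have Rc: "R \<in> cubes" using child_cube B R by auto
  have [measurable]: "R \<in> sets M" using cube_sets Rc by auto
  have "(h x)\<^sup>2 * measure M R = (\<integral>y. indicator R y * (h x)\<^sup>2 \<partial>M)"
    using emeasure_cube_finite[OF Rc] by simp
  also have "\<dots> \<le> (\<integral>y. h y * h y \<partial>M)"
  proof (rule integral_mono)
    show "integrable M (\<lambda>y. indicator R y * (h x)\<^sup>2)" using emeasure_cube_finite[OF Rc] by auto
    show "integrable M (\<lambda>y. h y * h y)" using H_L2[OF h] by (simp add: L2_iff)
    show "indicator R y * (h x)\<^sup>2 \<le> h y * h y" for y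
      using haar_const_child[OF h R(1) R(2), of y] by (auto simp: indicator_def power2_eq_square)
  qed
  also have "\<dots> = 1" using H_orthonormal[OF h h] by (simp add: L2_inner_def)
  finally have "(h x)\<^sup>2 * (\<kappa> * measure M (haar_support h)) \<le> 1"
    using child_measure[OF B R(1)] mult_left_mono[of "\<kappa> * measure M (haar_support h)" "measure M R"
      "(h x)\<^sup>2"] by simp
  moreover have pos: "\<kappa> * measure M (haar_support h) > 0"
    using \<kappa>(1) measure_cube_pos branching_cube B by simp
  ultimately have "(h x)\<^sup>2 \<le> 1 / (\<kappa> * measure M (haar_support h))" by (simp add: field_simps)
  then have "sqrt ((h x)\<^sup>2) \<le> sqrt (1 / (\<kappa> * measure M (haar_support h)))" by (rule real_sqrt_le_mono)
  then show ?thesis by (simp add: real_sqrt_divide)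
next
  case False
  then show ?thesis using haar_zero_outside[OF h x] \<kappa>(1) by simp
qed

text \<open>Otherwise the constant function 1 would be square integrable and orthogonal to all Haar functions.\<close>

lemma cube_neq_space: "Q \<in> cubes \<Longrightarrow> Q \<noteq> space M"
proof
  assume Q: "Q \<in> cubes" "Q = space M"
  have fin: "emeasure M (space M) < \<infinity>" and pos: "measure M (space M) > 0"
    using emeasure_cube_finite[of Q] measure_cube_pos[of Q] Q by auto
  have one: "(\<lambda>x. 1) \<in> Lp M 2"
    using fin by (auto simp: L2_iff less_top intro!: finite_measure.integrable_const finite_measureI)
  obtain g where g: "g \<in> lin_span H" "Lp_norm M 2 (\<lambda>x. 1 - g x) < sqrt (measure M (space M))"
    using H_dense[OF one, of "sqrt (measure M (space M))"] pos by auto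
  obtain F c where F: "finite F" "F \<subseteq> H" "g = (\<lambda>x. \<Sum>b\<in>F. c b * b x)" using g by (auto simp: lin_span_def)
  have L: "(\<lambda>x. c b * b x) \<in> Lp M 2" if "b \<in> F" for b using F that H_L2 by (intro Lp_cmult) auto
  have gL: "g \<in> Lp M 2" unfolding F(3) by (intro Lp_sum) (auto intro: L)
  have "L2_inner M (\<lambda>x. 1) g = (\<Sum>b\<in>F. c b * L2_inner M (\<lambda>x. 1) b)"
    unfolding F(3) using L one by (simp add: L2_inner_sum_right L2_inner_cmult_right cong: sum.cong)
  also have "\<dots> = 0" using F haar_parts(5) by (intro sum.neutral) (auto simp: L2_inner_def)
  finally have orth: "L2_inner M (\<lambda>x. 1) g = 0" .
  have d: "(\<lambda>x. 1 - g x) \<in> Lp M 2" by (rule Lp_diff[OF _ one gL]) simp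
  have "L2_inner M (\<lambda>x. 1 - g x) (\<lambda>x. 1 - g x) = measure M (space M) + L2_inner M g g"
    using one gL d orth L2_inner_commute[of M g "\<lambda>x. 1"]
    by (simp add: L2_inner_diff_left L2_inner_diff_right) (simp add: L2_inner_def)
  then have "sqrt (measure M (space M)) \<le> Lp_norm M 2 (\<lambda>x. 1 - g x)"
    unfolding L2_norm_eq using L2_inner_self_nonneg[of M g] by simp
  then show False using g by simp
qed

text \<open>W may be a cube of several levels. Going to coarser levels, the first cube at x that
  differs from W branches and has W as a child. There is such a level, because some point outside W
  shares a cube with x.\<close>

lemma parent_exists:
  assumes W: "W \<in> cubes"
  shows "\<exists>Q\<in>\<B>. W \<in> children D Q"
proof -
  obtain k where k: "W \<in> D k" using W by auto
  obtain x where x: "x \<in> W" using cube_nonempty W by auto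
  have X: "x \<in> space M" using x W cube_subset by auto
  obtain y where y: "y \<in> space M" "y \<notin> W" using cube_neq_space[OF W] cube_subset[OF W] by auto
  obtain j0 where j0: "cube_at j0 x = cube_at j0 y" using points_joined[OF X y(1)] by blast
  define P where "P n \<longleftrightarrow> cube_at (k - int n) x \<noteq> W" for n
  have Wk: "cube_at k x = W" using cube_at_eq k x by auto
  have "j0 < k"
  proof (rule ccontr)
    assume "\<not> j0 < k"
    then have "cube_at k x = cube_at k y" using cube_at_same_antimono[OF X y(1) _ j0, of k] by auto
    then show False using Wk cube_at(2)[OF y(1), of k] y by auto
  qed
  then have "P (nat (k - j0))" using j0 cube_at(2)[OF y(1), of j0] y(2) by (auto simp: P_def)
  then obtain n where n: "P n" "\<And>m. m < n \<Longrightarrow> \<not> P m" by (metis exists_least_iff)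
  have "n \<noteq> 0" using n(1) Wk by (auto simp: P_def)
  define j where "j = k - int n"
  have j1: "cube_at (j + 1) x = W"
  proof -
    have "\<not> P (n - 1)" using n(2) \<open>n \<noteq> 0\<close> by auto
    moreover have "k - int (n - 1) = j + 1" using \<open>n \<noteq> 0\<close> by (simp add: j_def of_nat_diff)
    ultimately show ?thesis by (simp add: P_def)
  qed
  have j: "cube_at j x \<noteq> W" using n(1) by (simp add: P_def j_def)
  have "W \<subseteq> cube_at j x" using cube_at_antimono[OF X, of j "j + 1"] j1 by simp
  then obtain z where z: "z \<in> cube_at j x" "z \<notin> W" using j by auto
  have Z: "z \<in> space M" using z cube_subset[OF cube_at_cubes[OF X]] by blast
  have "cube_at (j + 1) x \<noteq> cube_at (j + 1) z" using j1 z cube_at(2)[OF Z, of "j + 1"] by auto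
  then have br: "cube_at j x \<in> branching_level D j"
    using branching_levelI[OF cube_at(1)[OF X] cube_at(2)[OF X] z(1)] by auto
  moreover have "W \<in> children D (cube_at j x)"
    unfolding children_eq[OF br] using subcubes_cover[OF cube_at(1)[OF X] cube_at(2)[OF X], of j] j1 by simp
  ultimately show ?thesis by (auto simp: branching_def)
qed

section \<open>Parents and the growth of measure\<close>

definition parent :: "'a set \<Rightarrow> 'a set" where
  "parent W = (SOME Q. Q \<in> \<B> \<and> W \<in> children D Q)"

lemma parent: "W \<in> cubes \<Longrightarrow> parent W \<in> \<B>" "W \<in> cubes \<Longrightarrow> W \<in> children D (parent W)"
  using someI_ex[of "\<lambda>Q. Q \<in> \<B> \<and> W \<in> children D Q"] parent_exists unfolding parent_def by blast+

lemma parent_cube: "W \<in> cubes \<Longrightarrow> parent W \<in> cubes"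
  using parent branching_cube by blast

lemma parent_psubset: "W \<in> cubes \<Longrightarrow> W \<subset> parent W"
  using parent child_subset by blast

text \<open>Trichotomy for \<open>parent W\<close>: otherwise W' would lie in one of its children,
  and as W' contains W that child could only be W.\<close>

lemma parent_least:
  assumes "W \<in> cubes" "W' \<in> cubes" "W \<subset> W'"
  shows "parent W \<subseteq> W'"
proof -
  obtain x where x: "x \<in> W" using cube_nonempty assms by auto
  have "W' \<subseteq> W" if "R \<in> children D (parent W)" "W' \<subseteq> R" for R
    using children_disjoint[OF parent(1)[OF assms(1)] that(1) parent(2)[OF assms(1)], of x] that x assms
      by auto
  moreover have "x \<in> parent W \<inter> W'" using x assms parent_psubset by blast
  ultimately show ?thesis
    using branching_trichotomy[OF parent(1)[OF assms(1)] assms(2)] assms(3) by blast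
qed

lemma parent_unique:
  assumes "Q \<in> \<B>" "W \<in> children D Q"
  shows "parent W = Q"
proof -
  have W: "W \<in> cubes" using child_cube assms by auto
  have Q: "Q \<in> cubes" using branching_cube assms by auto
  have sub: "parent W \<subseteq> Q" using parent_least[OF W Q] child_subset assms by auto
  obtain x where x: "x \<in> W" using cube_nonempty W by auto
  have xp: "x \<in> parent W" "x \<in> Q" using x parent_psubset[OF W] sub by auto
  have "\<not> parent W \<subseteq> R" if "R \<in> children D Q" for R
    using children_disjoint[OF assms(1) that assms(2), of x] x xp parent_psubset[OF W] by auto
  then show ?thesis using branching_trichotomy[OF assms(1) parent_cube[OF W]] sub xp by blast
qed

lemma parent_measure_le: "W \<in> cubes \<Longrightarrow> measure M (parent W) \<le> measure M W / \<kappa>"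
  using child_measure[of "parent W" W] parent[of W] \<kappa>(1) by (simp add: field_simps)

text \<open>A sibling of W takes at least the fraction \<kappa> of the mass of the parent.\<close>

lemma measure_le_parent:
  assumes W: "W \<in> cubes"
  shows "measure M W \<le> (1 - \<kappa>) * measure M (parent W)"
proof -
  let ?Q = "parent W"
  have B: "?Q \<in> \<B>" "W \<in> children D ?Q" using parent W by auto
  obtain x where x: "x \<in> ?Q" "x \<notin> W" using parent_psubset[OF W] by auto
  obtain R where R: "R \<in> children D ?Q" "x \<in> R" using children_cover[OF B(1) x(1)] by auto
  have Rc: "R \<in> cubes" using child_cube B R by auto
  have disj: "W \<inter> R = {}" using children_disjoint[OF B(1) B(2) R(1)] x R by auto
  have "measure M W + measure M R = measure M (W \<union> R)"
    using disj cube_sets[OF W] cube_sets[OF Rc] emeasure_cube_finite[OF W] emeasure_cube_finite[OF Rc]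
    by (intro measure_Union[symmetric]) auto
  also have "\<dots> \<le> measure M ?Q"
    using cube_sets[OF W] cube_sets[OF Rc] cube_sets[OF parent_cube[OF W]] emeasure_cube_finite[OF
      parent_cube[OF W]]
      child_subset B R by (intro measure_mono_fmeasurable) (auto simp: fmeasurable_def)
  finally show ?thesis using child_measure[OF B(1) R(1)] by (simp add: algebra_simps)
qed

lemma measure_psubset_le:
  assumes "W \<in> cubes" "W' \<in> cubes" "W \<subset> W'"
  shows "measure M W \<le> (1 - \<kappa>) * measure M W'"
proof -
  have "measure M (parent W) \<le> measure M W'"
    using parent_least[OF assms] parent_cube assms by (intro measure_cube_mono) auto
  then have "(1 - \<kappa>) * measure M (parent W) \<le> (1 - \<kappa>) * measure M W'" using \<kappa>(2)
    by (intro mult_left_mono) auto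
  then show ?thesis using measure_le_parent[OF assms(1)] by simp
qed

lemma measure_psubset_less:
  assumes "W \<in> cubes" "W' \<in> cubes" "W \<subset> W'"
  shows "measure M W < measure M W'"
proof -
  have "(1 - \<kappa>) * measure M W' < 1 * measure M W'"
    using measure_cube_pos[OF assms(2)] \<kappa>(1) by (intro mult_strict_right_mono) auto
  then show ?thesis using measure_psubset_le[OF assms] by simp
qed

text \<open>The cubes containing Q0 form a chain along which the inverse measures decrease at least
  by the factor 1 - \<kappa>, so the sum is dominated by a geometric series. The induction splits
  off the smallest cube and bounds the rest from its parent; the constant closes up because 1 + (1 -
  \<kappa>)/\<kappa> = 1/\<kappa>.\<close>

lemma sum_inverse_measure_chain:
  assumes "finite F" "F \<subseteq> cubes" "Q0 \<in> cubes" "\<And>Q. Q \<in> F \<Longrightarrow> Q0 \<subseteq> Q"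
  shows "(\<Sum>Q\<in>F. 1 / measure M Q) \<le> 1 / (\<kappa> * measure M Q0)"
  using assms
proof (induction "card F" arbitrary: F Q0)
  case 0
  then show ?case using \<kappa>(1) by simp
next
  case (Suc n)
  then have "F \<noteq> {}" by auto
  then obtain Q1 where Q1: "Q1 \<in> F" "\<And>Q. Q \<in> F \<Longrightarrow> measure M Q1 \<le> measure M Q"
    using Suc.prems(1) arg_min_if_finite[of F "measure M"] by (metis not_le)
  have c: "Q1 \<in> cubes" using Q1 Suc by auto
  have "parent Q1 \<subseteq> Q" if Q: "Q \<in> F - {Q1}" for Q
  proof -
    have Qc: "Q \<in> cubes" using Q Suc by auto
    have "Q \<subseteq> Q1 \<or> Q1 \<subseteq> Q" using cubes_nested[OF Qc c] Suc.prems(4)[of Q] Suc.prems(4)[of Q1] Q Q1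
      cube_nonempty[OF Suc.prems(3)] by blast
    moreover have "\<not> Q \<subset> Q1" using measure_psubset_less[OF Qc c] Q1(2)[of Q] Q by auto
    ultimately show ?thesis using parent_least[OF c Qc] Q by auto
  qed
  then have "(\<Sum>Q\<in>F - {Q1}. 1 / measure M Q) \<le> 1 / (\<kappa> * measure M (parent Q1))"
    using Suc.prems Suc.hyps Q1 c by (intro Suc.hyps(1) parent_cube) auto
  also have "\<dots> \<le> (1 - \<kappa>) / (\<kappa> * measure M Q1)"
    using measure_le_parent[OF c] \<kappa>(1) measure_cube_pos[OF c] measure_cube_pos[OF parent_cube[OF c]]
    by (simp add: field_simps)
  finally have "(\<Sum>Q\<in>F. 1 / measure M Q) \<le> 1 / measure M Q1 + (1 - \<kappa>) / (\<kappa> * measure M Q1)"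
    using Q1 Suc.prems(1) by (subst sum.remove[of F Q1]) auto
  also have "\<dots> = 1 / (\<kappa> * measure M Q1)" using \<kappa>(1) measure_cube_pos[OF c] by (simp add: field_simps)
  also have "\<dots> \<le> 1 / (\<kappa> * measure M Q0)"
    using measure_cube_mono[OF Suc.prems(3) c Suc.prems(4)[OF Q1(1)]] \<kappa>(1) measure_cube_pos[OF Suc.prems(3)]
    by (intro divide_left_mono mult_left_mono) auto
  finally show ?case .
qed

text \<open>
  This replaces the Lebesgue differentiation theorem: a function \<open>s\<close> of the Haar span that is close to
  \<open>g\<close> is constant on the cubes of a fine level, and on each of them the mean of \<open>g\<close> approximates \<open>g\<close>
  at least as well as \<open>s\<close> does.
\<close>

lemma AE_bounded_of_averages:
  assumes g: "g \<in> Lp M 2" and avg: "\<And>W. W \<in> cubes \<Longrightarrow> \<bar>\<integral>x. indicator W x * g x \<partial>M\<bar> \<le> c * measure M W"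
  shows "AE x in M. \<bar>g x\<bar> \<le> c"
proof -
  have [measurable]: "g \<in> borel_measurable M" using g by (rule Lp_measurable)
  \<comment> \<open>This vanishes exactly where \<bar>g x\<bar> \<le> c, and it is at most (g x -
    m)^2 for every m with \<bar>m\<bar> \<le> c, in particular for the mean of g over a
    cube.\<close>
  let ?E = "\<lambda>x. ennreal ((max 0 (\<bar>g x\<bar> - c))\<^sup>2)"
  have small: "(\<integral>\<^sup>+x. ?E x \<partial>M) \<le> 0 + ennreal e" if e: "e > 0" for e :: real
  proof -
    obtain s where s: "s \<in> lin_span H" "Lp_norm M 2 (\<lambda>x. g x - s x) < sqrt e"
      using H_dense[OF g, of "sqrt e"] e by auto
    obtain F b where F: "finite F" "F \<subseteq> H" "s = (\<lambda>x. \<Sum>h\<in>F. b h * h x)" using s by (auto simp: lin_span_def)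
    have [measurable]: "s \<in> borel_measurable M" unfolding F(3) using F H_measurable
      by (intro borel_measurable_sum) auto
    have "bdd_above ((\<lambda>h. cube_level D (haar_support h)) ` F)" using F(1) by (intro bdd_above_finite) auto
    then obtain J0 where J0: "\<And>h. h \<in> F \<Longrightarrow> cube_level D (haar_support h) \<le> J0" by (auto simp: bdd_above_def)
    \<comment> \<open>The children of the cube of each h in F have level at most J, so h is constant
      on every cube of level J.\<close>
    define J where "J = J0 + 1"
    have sconst: "s x = s y" if R: "R \<in> D J" and x: "x \<in> R" and y: "y \<in> R" for R x y
    proof -
      have "h x = h y" if h: "h \<in> F" for h
      proof (rule haar_const)
        show hH: "h \<in> H" using F h by auto
        obtain j where j: "haar_support h \<in> branching_level D j" "haar_support h \<in> D j"
          "children D (haar_support h) = subcubes D j (haar_support h)"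
          using haar_support_branching[OF hH] by (elim branchingE)
        have "j < J" unfolding J_def using J0[OF h] cube_level_eq[OF j(1)] by simp
        show "\<not> haar_support h \<subseteq> R"
        proof
          assume sub: "haar_support h \<subseteq> R"
          obtain z where z: "z \<in> haar_support h" using cube_nonempty j(2) by blast
          have Z: "z \<in> space M" using z j(2) cube_subset by blast
          have "R = cube_at J z" using cube_at_eq[OF R] z sub by auto
          also have "\<dots> \<subseteq> cube_at (j + 1) z" using \<open>j < J\<close> cube_at_antimono[OF Z, of "j + 1" J] by auto
          finally have "haar_support h \<subseteq> cube_at (j + 1) z" using sub by auto
          moreover have "cube_at (j + 1) z \<in> children D (haar_support h)" using subcubes_cover j z by auto
          ultimately show False using child_subset[OF haar_support_branching[OF hH]] by blast
        qed
      qed (use R x y in auto)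
      then show ?thesis unfolding F(3) by (intro sum.cong) auto
    qed
    have loc: "(\<integral>\<^sup>+x. ?E x * indicator R x \<partial>M) \<le> (\<integral>\<^sup>+x. ennreal ((g x - s x)\<^sup>2) * indicator R x \<partial>M)"
      if R: "R \<in> D J" for R
    proof -
      have Rc: "R \<in> cubes" using R by auto
      obtain z where z: "z \<in> R" using cube_nonempty Rc by auto
      define m where "m = (\<integral>x. indicator R x * g x \<partial>M) / measure M R"
      have m: "(\<integral>x. indicator R x * g x \<partial>M) = m * measure M R" using measure_cube_pos[OF Rc]
        by (simp add: m_def)
      have "\<bar>m\<bar> * measure M R \<le> c * measure M R" using avg[OF Rc] by (simp add: m abs_mult)
      then have mc: "\<bar>m\<bar> \<le> c" using measure_cube_pos[OF Rc] by simp
      have "(\<integral>\<^sup>+x. ?E x * indicator R x \<partial>M) \<le> (\<integral>\<^sup>+x. ennreal ((g x - m)\<^sup>2) * indicator R x \<partial>M)"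
        using mc by (intro nn_integral_mono mult_right_mono ennreal_leI)
          (auto simp: abs_le_square_iff[symmetric])
      also have "\<dots> \<le> (\<integral>\<^sup>+x. ennreal ((g x - s z)\<^sup>2) * indicator R x \<partial>M)"
        by (rule integral_squared_deviation_le[OF g cube_sets[OF Rc] emeasure_cube_finite[OF Rc] m])
      also have "\<dots> = (\<integral>\<^sup>+x. ennreal ((g x - s x)\<^sup>2) * indicator R x \<partial>M)"
        using sconst[OF R z] by (intro nn_integral_cong) (auto simp: indicator_def)
      finally show ?thesis .
    qed
    have P: "countable (D J)" "D J \<subseteq> sets M" "disjoint (D J)"
      using countable_subset[OF _ countable_cubes] D_sets dyadic_parts(2) by auto
    have E: "(\<integral>\<^sup>+x. f x \<partial>M) = (\<integral>\<^sup>+C. (\<integral>\<^sup>+x. f x * indicator C x \<partial>M) \<partial>count_space (D J))"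
      if "f \<in> borel_measurable M" for f :: "'a \<Rightarrow> ennreal"
    proof -
      have "(\<integral>\<^sup>+x. f x \<partial>M) = (\<integral>\<^sup>+x. f x * indicator (\<Union>(D J)) x \<partial>M)"
        using dyadic_parts(3)[of J] by (intro nn_integral_cong) (auto simp: indicator_def)
      then show ?thesis using nn_integral_disjoint_countable_Union[OF P that] by simp
    qed
    have "(\<integral>\<^sup>+x. ?E x \<partial>M) \<le> (\<integral>\<^sup>+x. ennreal ((g x - s x)\<^sup>2) \<partial>M)"
    proof -
      have "(\<integral>\<^sup>+x. ?E x \<partial>M) = (\<integral>\<^sup>+C. (\<integral>\<^sup>+x. ?E x * indicator C x \<partial>M) \<partial>count_space (D J))"
        by (rule E) measurable
      also have "\<dots> \<le> (\<integral>\<^sup>+C. (\<integral>\<^sup>+x. ennreal ((g x - s x)\<^sup>2) * indicator C x \<partial>M) \<partial>count_space (D J))"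
        by (intro nn_integral_mono loc) simp
      also have "\<dots> = (\<integral>\<^sup>+x. ennreal ((g x - s x)\<^sup>2) \<partial>M)"
        by (rule E[symmetric]) measurable
      finally show ?thesis .
    qed
    also have "\<dots> = Lp_nn M 2 (\<lambda>x. g x - s x)" by (simp add: Lp_nn_def)
    also have "\<dots> = ennreal (L2_inner M (\<lambda>x. g x - s x) (\<lambda>x. g x - s x))"
    proof (rule Lp_nn_2_eq, rule Lp_diff[OF _ g])
      show "s \<in> Lp M 2" unfolding F(3) using F H_L2 by (intro Lp_sum Lp_cmult) auto
    qed simp
    also have "\<dots> \<le> ennreal e" using s(2) by (intro ennreal_leI) (simp add: L2_norm_eq)
    finally show ?thesis by simp
  qed
  have "(\<integral>\<^sup>+x. ?E x \<partial>M) \<le> 0" by (rule ennreal_le_epsilon) (rule small)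
  then have "(\<integral>\<^sup>+x. ?E x \<partial>M) = 0" by simp
  then have "AE x in M. ?E x = 0" by (subst (asm) nn_integral_0_iff_AE) auto
  then show ?thesis by eventually_elim (auto simp: max_def split: if_splits)
qed

end

section \<open>Operators given by two localized families\<close>

lemma enn2real_eq_imp_eq: "x < top \<Longrightarrow> y < top \<Longrightarrow> enn2real x = enn2real y \<Longrightarrow> x = y"
  by (metis ennreal_enn2real)

text \<open>On each piece the positive and the negative part of F have equal integrals, and for
  nonnegative functions the integrals over countably many pieces simply add up.\<close>

lemma integral_zero_of_pieces:
  fixes F :: "'a \<Rightarrow> real"
  assumes F: "integrable M F" and C: "countable \<C>" "\<C> \<subseteq> sets M" "disjoint \<C>"
    and zero: "\<And>C. C \<in> \<C> \<Longrightarrow> (\<integral>x. indicator C x * F x \<partial>M) = 0"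
    and out: "\<And>x. x \<in> space M \<Longrightarrow> x \<notin> \<Union>\<C> \<Longrightarrow> F x = 0"
  shows "(\<integral>x. F x \<partial>M) = 0"
proof -
  have [measurable]: "F \<in> borel_measurable M" using F by auto
  have E: "(\<integral>\<^sup>+x. ennreal (G x) \<partial>M) = (\<integral>\<^sup>+C. (\<integral>\<^sup>+x. ennreal (G x) * indicator C x \<partial>M) \<partial>count_space \<C>)"
    if [measurable]: "G \<in> borel_measurable M" and "\<And>x. x \<in> space M \<Longrightarrow> x \<notin> \<Union>\<C> \<Longrightarrow> G x = 0" for G
  proof -
    have "(\<integral>\<^sup>+x. ennreal (G x) \<partial>M) = (\<integral>\<^sup>+x. ennreal (G x) * indicator (\<Union>\<C>) x \<partial>M)"
      using that(2) by (intro nn_integral_cong) (auto simp: indicator_def)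
    also have "\<dots> = (\<integral>\<^sup>+C. (\<integral>\<^sup>+x. ennreal (G x) * indicator C x \<partial>M) \<partial>count_space \<C>)"
      by (rule nn_integral_disjoint_countable_Union[OF C]) measurable
    finally show ?thesis .
  qed
  have piece: "(\<integral>\<^sup>+x. ennreal (F x) * indicator C x \<partial>M) = (\<integral>\<^sup>+x. ennreal (- F x) * indicator C x \<partial>M)"
    if CC: "C \<in> \<C>" for C
  proof -
    have [measurable]: "C \<in> sets M" using CC C by auto
    have int: "integrable M (\<lambda>x. indicator C x * F x)" using integrable_mult_indicator[OF _ F, of C] by simp
    have e: "(\<integral>\<^sup>+x. ennreal (G x) * indicator C x \<partial>M) = (\<integral>\<^sup>+x. ennreal (indicator C x * G x) \<partial>M)"
      for G :: "'a \<Rightarrow> real"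
      by (intro nn_integral_cong) (auto simp: indicator_def)
    have fin: "(\<integral>\<^sup>+x. ennreal (indicator C x * F x) \<partial>M) \<noteq> \<infinity>"
      "(\<integral>\<^sup>+x. ennreal (- (indicator C x * F x)) \<partial>M) \<noteq> \<infinity>"
      using int by (auto simp: real_integrable_def)
    have "enn2real (\<integral>\<^sup>+x. ennreal (indicator C x * F x) \<partial>M)
      = enn2real (\<integral>\<^sup>+x. ennreal (- (indicator C x * F x)) \<partial>M)"
      using zero[OF CC] real_lebesgue_integral_def[OF int] by simp
    then have "(\<integral>\<^sup>+x. ennreal (indicator C x * F x) \<partial>M) = (\<integral>\<^sup>+x. ennreal (- (indicator C x * F x)) \<partial>M)"
      using fin by (intro enn2real_eq_imp_eq) (auto simp: less_top)
    then show ?thesis unfolding e by simp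
  qed
  have "(\<integral>\<^sup>+x. ennreal (F x) \<partial>M) = (\<integral>\<^sup>+C. (\<integral>\<^sup>+x. ennreal (F x) * indicator C x \<partial>M) \<partial>count_space \<C>)"
    by (rule E) (use out in auto)
  also have "\<dots> = (\<integral>\<^sup>+C. (\<integral>\<^sup>+x. ennreal (- F x) * indicator C x \<partial>M) \<partial>count_space \<C>)"
    by (intro nn_integral_cong piece) simp
  also have "\<dots> = (\<integral>\<^sup>+x. ennreal (- F x) \<partial>M)"
    by (rule E[symmetric]) (use out in auto)
  finally have "(\<integral>\<^sup>+x. ennreal (F x) \<partial>M) = (\<integral>\<^sup>+x. ennreal (- F x) \<partial>M)" .
  then show ?thesis unfolding real_lebesgue_integral_def[OF F] by simp
qed

context haar_space
begin

text \<open>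
  The condition on cubes \<open>W\<close> involves \<open>parent W\<close> because the second family of the operator is not
  constant on the children of its cube, only on the grandchildren.
\<close>

definition localized_family :: "real \<Rightarrow> ('a set \<Rightarrow> 'a \<Rightarrow> real) \<Rightarrow> bool" where
  "localized_family c U \<longleftrightarrow> c > 0 \<and>
     (\<forall>Q\<in>\<B>. U Q \<in> borel_measurable M) \<and>
     (\<forall>Q\<in>\<B>. \<forall>x\<in>space M. x \<notin> Q \<longrightarrow> U Q x = 0) \<and>
     (\<forall>Q\<in>\<B>. \<forall>x\<in>space M. \<bar>U Q x\<bar> \<le> c / sqrt (measure M Q)) \<and>
     (\<forall>Q\<in>\<B>. \<forall>W\<in>cubes. \<not> Q \<subseteq> parent W \<longrightarrow> (\<forall>x\<in>W. \<forall>y\<in>W. U Q x = U Q y)) \<and>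
     (\<forall>Q\<in>\<B>. \<forall>Q'\<in>\<B>. Q \<noteq> Q' \<longrightarrow> L2_inner M (U Q) (U Q') = 0)"

lemma localized_familyD:
  assumes "localized_family c U"
  shows "c > 0"
    and "Q \<in> \<B> \<Longrightarrow> U Q \<in> borel_measurable M"
    and "Q \<in> \<B> \<Longrightarrow> x \<in> space M \<Longrightarrow> x \<notin> Q \<Longrightarrow> U Q x = 0"
    and "Q \<in> \<B> \<Longrightarrow> x \<in> space M \<Longrightarrow> \<bar>U Q x\<bar> \<le> c / sqrt (measure M Q)"
    and "Q \<in> \<B> \<Longrightarrow> W \<in> cubes \<Longrightarrow> \<not> Q \<subseteq> parent W \<Longrightarrow> x \<in> W \<Longrightarrow> y \<in> W \<Longrightarrow> U Q x = U Q y"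
    and "Q \<in> \<B> \<Longrightarrow> Q' \<in> \<B> \<Longrightarrow> Q \<noteq> Q' \<Longrightarrow> L2_inner M (U Q) (U Q') = 0"
proof -
  note g = assms[unfolded localized_family_def]
  show "c > 0" using g by simp
  show "Q \<in> \<B> \<Longrightarrow> U Q \<in> borel_measurable M" using g by simp
  show "Q \<in> \<B> \<Longrightarrow> x \<in> space M \<Longrightarrow> x \<notin> Q \<Longrightarrow> U Q x = 0" using g by simp
  show "Q \<in> \<B> \<Longrightarrow> x \<in> space M \<Longrightarrow> \<bar>U Q x\<bar> \<le> c / sqrt (measure M Q)" using g by simp
  show "Q \<in> \<B> \<Longrightarrow> W \<in> cubes \<Longrightarrow> \<not> Q \<subseteq> parent W \<Longrightarrow> x \<in> W \<Longrightarrow> y \<in> W \<Longrightarrow> U Q x = U Q y"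
    using g[THEN conjunct2, THEN conjunct2, THEN conjunct2, THEN conjunct2, THEN conjunct1] by blast
  show "Q \<in> \<B> \<Longrightarrow> Q' \<in> \<B> \<Longrightarrow> Q \<noteq> Q' \<Longrightarrow> L2_inner M (U Q) (U Q') = 0" using g by simp
qed

lemma localized_family_L2:
  assumes U: "localized_family c U" and Q: "Q \<in> \<B>"
  shows "U Q \<in> Lp M 2" and "L2_inner M (U Q) (U Q) \<le> c\<^sup>2"
proof -
  have Qc: "Q \<in> cubes" using Q by (rule branching_cube)
  have [measurable]: "Q \<in> sets M" using cube_sets Qc by auto
  have pos: "measure M Q > 0" using measure_cube_pos Qc by auto
  have le: "U Q x * U Q x \<le> indicator Q x * (c\<^sup>2 / measure M Q)" if x: "x \<in> space M" for x
  proof (cases "x \<in> Q")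
    case True
    have "\<bar>U Q x\<bar>\<^sup>2 \<le> (c / sqrt (measure M Q))\<^sup>2" using localized_familyD(4)[OF U Q x]
      by (intro power_mono) auto
    then show ?thesis using True pos by (simp add: power_divide power2_eq_square)
  qed (simp add: localized_familyD(3)[OF U Q x])
  have int: "integrable M (\<lambda>x. indicator Q x * (c\<^sup>2 / measure M Q))" using emeasure_cube_finite[OF Qc]
    by auto
  have int': "integrable M (\<lambda>x. U Q x * U Q x)"
    using localized_familyD(2)[OF U Q] le by (intro Bochner_Integration.integrable_bound[OF int])
      (auto intro!: AE_I2)
  then show "U Q \<in> Lp M 2" using localized_familyD(2)[OF U Q] by (simp add: L2_iff)
  have "L2_inner M (U Q) (U Q) \<le> (\<integral>x. indicator Q x * (c\<^sup>2 / measure M Q) \<partial>M)"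
    unfolding L2_inner_def by (rule integral_mono[OF int' int le])
  also have "\<dots> = c\<^sup>2" using pos by simp
  finally show "L2_inner M (U Q) (U Q) \<le> c\<^sup>2" .
qed

text \<open>Bessel's inequality without normalization: only an upper bound c for the norms is known,
  and some U Q may vanish. Hence the coefficients of the comparison sum are divided by c^2 instead
  of the squared norms.\<close>

lemma localized_family_Bessel:
  assumes U: "localized_family c U" and F: "finite F" "F \<subseteq> \<B>" and f: "f \<in> Lp M 2"
  shows "(\<Sum>Q\<in>F. (L2_inner M f (U Q))\<^sup>2) \<le> c\<^sup>2 * L2_inner M f f"
proof -
  define a where "a Q = L2_inner M f (U Q)" for Q
  define s where "s = (\<lambda>x. \<Sum>Q\<in>F. a Q / c\<^sup>2 * U Q x)"
  have c: "c > 0" using localized_familyD(1)[OF U] .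
  have UL: "U Q \<in> Lp M 2" if "Q \<in> F" for Q using localized_family_L2(1)[OF U] F that by auto
  have UL': "(\<lambda>x. a Q / c\<^sup>2 * U Q x) \<in> Lp M 2" if "Q \<in> F" for Q using UL[OF that] by (intro Lp_cmult) auto
  have sL: "s \<in> Lp M 2" unfolding s_def by (intro Lp_sum UL') auto
  have dL: "(\<lambda>x. f x - s x) \<in> Lp M 2" using f sL by (intro Lp_diff) auto
  have fs: "L2_inner M f s = (\<Sum>Q\<in>F. (a Q)\<^sup>2) / c\<^sup>2"
  proof -
    have "L2_inner M f s = (\<Sum>Q\<in>F. L2_inner M f (\<lambda>x. a Q / c\<^sup>2 * U Q x))"
      unfolding s_def using UL' f by (rule L2_inner_sum_right)
    also have "\<dots> = (\<Sum>Q\<in>F. a Q / c\<^sup>2 * a Q)" by (simp only: L2_inner_cmult_right a_def)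
    also have "\<dots> = (\<Sum>Q\<in>F. (a Q)\<^sup>2) / c\<^sup>2" by (simp add: sum_divide_distrib power2_eq_square)
    finally show ?thesis .
  qed
  have "L2_inner M s s = (\<Sum>Q\<in>F. (a Q / c\<^sup>2)\<^sup>2 * L2_inner M (U Q) (U Q))"
    unfolding s_def
  proof (rule L2_inner_orthogonal_sum)
    show "L2_inner M (U Q) (U Q') = 0" if "Q \<in> F" "Q' \<in> F" "Q \<noteq> Q'" for Q Q'
      using localized_familyD(6)[OF U _ _ that(3)] that F by blast
  qed (use F UL in auto)
  also have "\<dots> \<le> (\<Sum>Q\<in>F. (a Q / c\<^sup>2)\<^sup>2 * c\<^sup>2)"
    using F localized_family_L2(2)[OF U] by (intro sum_mono mult_left_mono) auto
  also have "\<dots> = (\<Sum>Q\<in>F. (a Q)\<^sup>2) / c\<^sup>2"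
    using c by (simp add: power_divide sum_divide_distrib power2_eq_square)
  finally have ss: "L2_inner M s s \<le> (\<Sum>Q\<in>F. (a Q)\<^sup>2) / c\<^sup>2" .
  have "0 \<le> L2_inner M (\<lambda>x. f x - s x) (\<lambda>x. f x - s x)" by (rule L2_inner_self_nonneg)
  also have "\<dots> = L2_inner M f f - 2 * L2_inner M f s + L2_inner M s s"
    using f sL dL by (simp add: L2_inner_diff_left L2_inner_diff_right L2_inner_commute[of M s f])
  finally have "(\<Sum>Q\<in>F. (a Q)\<^sup>2) / c\<^sup>2 \<le> L2_inner M f f" using fs ss by simp
  then show ?thesis using c by (simp add: a_def field_simps)
qed

lemma localized_family_series:
  assumes U: "localized_family c U" and V: "localized_family c' V" and f: "f \<in> Lp M 2"
  shows "\<exists>g. L2_has_sum M (\<lambda>Q x. L2_inner M f (U Q) * V Q x) g \<B>"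
proof (rule L2_orthogonal_series)
  show "(\<lambda>x. L2_inner M f (U Q) * V Q x) \<in> Lp M 2" if "Q \<in> \<B>" for Q
    using localized_family_L2(1)[OF V that] by (intro Lp_cmult) auto
  show "L2_inner M (\<lambda>x. L2_inner M f (U Q) * V Q x) (\<lambda>x. L2_inner M f (U Q') * V Q' x) = 0"
    if "Q \<in> \<B>" "Q' \<in> \<B>" "Q \<noteq> Q'" for Q Q'
    using localized_familyD(6)[OF V that] by (simp add: L2_inner_cmult_left L2_inner_cmult_right)
  show "(\<Sum>Q\<in>F. L2_inner M (\<lambda>x. L2_inner M f (U Q) * V Q x) (\<lambda>x. L2_inner M f (U Q) * V Q x))
    \<le> c'\<^sup>2 * (c\<^sup>2 * L2_inner M f f)"
    if F: "finite F" "F \<subseteq> \<B>" for F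
  proof -
    have "(\<Sum>Q\<in>F. L2_inner M (\<lambda>x. L2_inner M f (U Q) * V Q x) (\<lambda>x. L2_inner M f (U Q) * V Q x))
        = (\<Sum>Q\<in>F. L2_inner M (V Q) (V Q) * (L2_inner M f (U Q))\<^sup>2)"
      by (simp only: L2_inner_cmult_left L2_inner_cmult_right) (simp add: power2_eq_square mult_ac)
    also have "\<dots> \<le> (\<Sum>Q\<in>F. c'\<^sup>2 * (L2_inner M f (U Q))\<^sup>2)"
      using F localized_family_L2(2)[OF V] by (intro sum_mono mult_right_mono) auto
    also have "\<dots> \<le> c'\<^sup>2 * (c\<^sup>2 * L2_inner M f f)"
      unfolding sum_distrib_left[symmetric] by (intro mult_left_mono localized_family_Bessel U F f) auto
    finally show ?thesis .
  qed
qed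

text \<open>A weak form of the series: the pairings determine T f up to null sets, and exchanging U
  and V corresponds to passing to the adjoint.\<close>

definition represents :: "('a set \<Rightarrow> 'a \<Rightarrow> real) \<Rightarrow> ('a set \<Rightarrow> 'a \<Rightarrow> real) \<Rightarrow> (('a \<Rightarrow> real) \<Rightarrow> 'a \<Rightarrow> real) \<Rightarrow> bool"
  where
  "represents U V T \<longleftrightarrow> (\<forall>f\<in>Lp M 2. T f \<in> Lp M 2 \<and>
     (\<forall>g\<in>Lp M 2. ((\<lambda>Q. L2_inner M f (U Q) * L2_inner M (V Q) g) has_sum L2_inner M (T f) g) \<B>))"

lemma representsI:
  assumes "\<And>f. f \<in> Lp M 2 \<Longrightarrow> L2_has_sum M (\<lambda>Q x. L2_inner M f (U Q) * V Q x) (T f) \<B>"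
  shows "represents U V T"
  unfolding represents_def using L2_has_sum_inner[OF assms] assms
  by (auto simp: L2_inner_cmult_left L2_has_sum_def)

text \<open>With the two families exchanged, this provides the adjoint operator in the duality
  argument.\<close>

lemma represents_exists:
  assumes "localized_family c U" "localized_family c' V"
  obtains T where "represents U V T"
proof
  show "represents U V (\<lambda>f. SOME g. L2_has_sum M (\<lambda>Q x. L2_inner M f (U Q) * V Q x) g \<B>)"
  proof (rule representsI)
    fix f :: "'a \<Rightarrow> real" assume "f \<in> Lp M 2"
    from localized_family_series[OF assms this]
    show "L2_has_sum M (\<lambda>Q x. L2_inner M f (U Q) * V Q x)
        (SOME g. L2_has_sum M (\<lambda>Q x. L2_inner M f (U Q) * V Q x) g \<B>) \<B>"
      by (rule someI_ex)
  qed
qed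

lemma representsD:
  assumes "represents U V T" "f \<in> Lp M 2"
  shows "T f \<in> Lp M 2"
    and "g \<in> Lp M 2 \<Longrightarrow> ((\<lambda>Q. L2_inner M f (U Q) * L2_inner M (V Q) g) has_sum L2_inner M (T f) g) \<B>"
  using assms unfolding represents_def by auto

lemma represents_adjoint:
  assumes "represents U V T" "represents V U T'" "f \<in> Lp M 2" "g \<in> Lp M 2"
  shows "L2_inner M (T f) g = L2_inner M f (T' g)"
proof -
  have "((\<lambda>Q. L2_inner M f (U Q) * L2_inner M (V Q) g) has_sum L2_inner M (T f) g) \<B>"
    using assms representsD by auto
  moreover have "((\<lambda>Q. L2_inner M g (V Q) * L2_inner M (U Q) f) has_sum L2_inner M (T' g) f) \<B>"
    using assms representsD by auto
  moreover have "(\<lambda>Q. L2_inner M g (V Q) * L2_inner M (U Q) f)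
    = (\<lambda>Q. L2_inner M f (U Q) * L2_inner M (V Q) g)"
    by (simp add: L2_inner_commute[of M g] L2_inner_commute[of M f] mult.commute)
  ultimately have "L2_inner M (T f) g = L2_inner M (T' g) f" by (metis has_sum_unique)
  then show ?thesis by (simp add: L2_inner_commute[of M f])
qed

text \<open>Pair T f with itself and apply 2ab \<le> a^2 + b^2, weighted by c', to every term.
  Bessel's inequality for V then returns half the squared norm of T f, which is absorbed on the
  left.\<close>

lemma represents_bounded:
  assumes U: "localized_family c U" and V: "localized_family c' V" and T: "represents U V T" and f:
    "f \<in> Lp M 2"
  shows "Lp_nn M 2 (T f) \<le> ennreal ((c * c')\<^sup>2) * Lp_nn M 2 f"
proof -
  have Tf: "T f \<in> Lp M 2" using representsD T f by auto
  have pos: "c' > 0" using localized_familyD(1)[OF V] .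
  have hs: "((\<lambda>Q. L2_inner M f (U Q) * L2_inner M (V Q) (T f)) has_sum L2_inner M (T f) (T f)) \<B>"
    using representsD T f Tf by auto
  have "L2_inner M (T f) (T f) = (\<Sum>\<^sub>\<infinity>Q\<in>\<B>. L2_inner M f (U Q) * L2_inner M (V Q) (T f))"
    using infsumI[OF hs] by simp
  also have "\<dots> \<le> (c'\<^sup>2 * (c\<^sup>2 * L2_inner M f f) + L2_inner M (T f) (T f)) / 2"
  proof (rule infsum_le_finite_sums)
    show "(\<lambda>Q. L2_inner M f (U Q) * L2_inner M (V Q) (T f)) summable_on \<B>" using hs
      by (rule has_sum_imp_summable)
    fix F assume F: "finite F" "F \<subseteq> \<B>"
    have "(\<Sum>Q\<in>F. L2_inner M f (U Q) * L2_inner M (V Q) (T f))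
        \<le> (\<Sum>Q\<in>F. (c'\<^sup>2 * (L2_inner M f (U Q))\<^sup>2 + (L2_inner M (T f) (V Q))\<^sup>2 / c'\<^sup>2) / 2)"
    proof (rule sum_mono)
      fix Q
      have "0 \<le> (c' * L2_inner M f (U Q) - L2_inner M (T f) (V Q) / c')\<^sup>2" by simp
      then show "L2_inner M f (U Q) * L2_inner M (V Q) (T f)
        \<le> (c'\<^sup>2 * (L2_inner M f (U Q))\<^sup>2 + (L2_inner M (T f) (V Q))\<^sup>2 / c'\<^sup>2) / 2"
        using pos by (simp add: L2_inner_commute[of M "V Q"] power2_diff power_mult_distrib power_divide)
    qed
    also have "\<dots> = (c'\<^sup>2 * (\<Sum>Q\<in>F. (L2_inner M f (U Q))\<^sup>2) + (\<Sum>Q\<in>F. (L2_inner M (T f) (V Q))\<^sup>2) / c'\<^sup>2) / 2"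
      by (simp add: sum_divide_distrib[symmetric] sum.distrib sum_distrib_left)
    also have "\<dots> \<le> (c'\<^sup>2 * (c\<^sup>2 * L2_inner M f f) + (c'\<^sup>2 * L2_inner M (T f) (T f)) / c'\<^sup>2) / 2"
      using localized_family_Bessel[OF U F f] localized_family_Bessel[OF V F Tf]
      by (intro divide_right_mono add_mono mult_left_mono) auto
    finally show "(\<Sum>Q\<in>F. L2_inner M f (U Q) * L2_inner M (V Q) (T f))
      \<le> (c'\<^sup>2 * (c\<^sup>2 * L2_inner M f f) + L2_inner M (T f) (T f)) / 2"
      using pos by simp
  qed
  finally have "L2_inner M (T f) (T f) \<le> (c * c')\<^sup>2 * L2_inner M f f"
    by (simp add: power_mult_distrib mult_ac)
  then show ?thesis unfolding Lp_nn_2_eq[OF Tf] Lp_nn_2_eq[OF f]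
    using L2_inner_self_nonneg[of M f] by (simp add: ennreal_mult[symmetric] ennreal_leI)
qed

text \<open>Only pairings of T are known, so the defect w of linearity is paired with
  itself.\<close>

lemma represents_linear:
  assumes U: "localized_family c U" and T: "represents U V T"
  shows "ae_linear_on M (Lp M 2) T"
  unfolding ae_linear_on_def
proof safe
  fix f g :: "'a \<Rightarrow> real" and a b :: real
  assume f: "f \<in> Lp M 2" and g: "g \<in> Lp M 2"
  define h where "h = (\<lambda>y. a * f y + b * g y)"
  have h: "h \<in> Lp M 2" unfolding h_def using f g by (intro Lp_lincomb) auto
  define k where "k = (\<lambda>x. a * T f x + b * T g x)"
  have k: "k \<in> Lp M 2" unfolding k_def using representsD(1)[OF T] f g by (intro Lp_lincomb) auto
  define w where "w = (\<lambda>x. T h x - k x)"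
  have w: "w \<in> Lp M 2" unfolding w_def using representsD(1)[OF T h] k by (intro Lp_diff) auto
  have aT: "(\<lambda>x. a * T f x) \<in> Lp M 2" "(\<lambda>x. b * T g x) \<in> Lp M 2"
    using Lp_cmult[OF _ representsD(1)[OF T f]] Lp_cmult[OF _ representsD(1)[OF T g]] by simp_all
  have kw: "L2_inner M k w = a * L2_inner M (T f) w + b * L2_inner M (T g) w"
    unfolding k_def using aT w by (simp add: L2_inner_add_left L2_inner_cmult_left)
  have "((\<lambda>Q. a * (L2_inner M f (U Q) * L2_inner M (V Q) w) + b * (L2_inner M g (U Q) * L2_inner M (V Q) w))
      has_sum a * L2_inner M (T f) w + b * L2_inner M (T g) w) \<B>"
    by (intro has_sum_add has_sum_cmult_right representsD(2)[OF T] f g w)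
  moreover have hs: "((\<lambda>Q. L2_inner M h (U Q) * L2_inner M (V Q) w) has_sum L2_inner M (T h) w) \<B>"
    by (intro representsD(2)[OF T] h w)
  have eq: "L2_inner M h (U Q) * L2_inner M (V Q) w
    = a * (L2_inner M f (U Q) * L2_inner M (V Q) w) + b * (L2_inner M g (U Q) * L2_inner M (V Q) w)"
    if "Q \<in> \<B>" for Q
  proof -
    have "L2_inner M h (U Q) = L2_inner M (\<lambda>y. a * f y) (U Q) + L2_inner M (\<lambda>y. b * g y) (U Q)"
      unfolding h_def by (rule L2_inner_add_left)
        (simp_all add: f g localized_family_L2(1)[OF U that] Lp_cmult)
    then show ?thesis by (simp add: L2_inner_cmult_left algebra_simps)
  qed
  have "((\<lambda>Q. a * (L2_inner M f (U Q) * L2_inner M (V Q) w) + b * (L2_inner M g (U Q) * L2_inner M (V Q) w))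
      has_sum L2_inner M (T h) w) \<B>"
    using hs by (rule has_sum_cong[THEN iffD1, rotated]) (rule eq)
  ultimately have "L2_inner M (T h) w = L2_inner M k w"
    unfolding kw using has_sum_unique by blast
  then have "L2_inner M w w = 0"
    using representsD(1)[OF T h] k w by (subst (1) w_def) (simp add: L2_inner_diff_left)
  then have "AE x in M. w x = 0" using w by (intro L2_inner_self_eq_0)
  then show "AE x in M. T (\<lambda>y. a * f y + b * g y) x = a * T f x + b * T g x"
    unfolding w_def k_def h_def by eventually_elim simp
qed

text \<open>Pair T f with its own restriction to the complement of \<Omega>. Every term of the
  series vanishes, by \<open>loc\<close> or because V Q is 0 off Q.\<close>

lemma represents_local:
  assumes V: "localized_family c V" and T: "represents U V T" and f: "f \<in> Lp M 2" and \<Omega>: "\<Omega> \<in> sets M"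
    and loc: "\<And>Q. Q \<in> \<B> \<Longrightarrow> L2_inner M f (U Q) = 0 \<or> Q \<subseteq> \<Omega>"
  shows "AE x in M. x \<notin> \<Omega> \<longrightarrow> T f x = 0"
proof -
  have Tf: "T f \<in> Lp M 2" using representsD T f by auto
  have [measurable]: "T f \<in> borel_measurable M" "\<Omega> \<in> sets M" using Tf \<Omega> by (auto intro: Lp_measurable)
  define g where "g = (\<lambda>x. T f x * indicator (space M - \<Omega>) x)"
  have g: "g \<in> Lp M 2"
    by (rule Lp_dominated[OF _ Tf]) (auto simp: g_def indicator_def)
  have "((\<lambda>Q. L2_inner M f (U Q) * L2_inner M (V Q) g) has_sum L2_inner M (T f) g) \<B>"
    by (intro representsD(2)[OF T] f g)
  moreover have "L2_inner M f (U Q) * L2_inner M (V Q) g = 0" if Q: "Q \<in> \<B>" for Q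
  proof (cases "Q \<subseteq> \<Omega>")
    case True
    then have "V Q x * g x = 0" if "x \<in> space M" for x
      using localized_familyD(3)[OF V Q that] by (auto simp: g_def indicator_def)
    then have "L2_inner M (V Q) g = (\<integral>x. 0 \<partial>M)" unfolding L2_inner_def
      by (intro Bochner_Integration.integral_cong) auto
    then show ?thesis by simp
  qed (use loc[OF Q] in auto)
  then have "((\<lambda>Q. L2_inner M f (U Q) * L2_inner M (V Q) g) has_sum 0) \<B>" by (rule has_sum_0)
  ultimately have "L2_inner M (T f) g = 0" by (rule has_sum_unique)
  moreover have "L2_inner M (T f) g = L2_inner M g g"
    unfolding L2_inner_def g_def by (intro Bochner_Integration.integral_cong) (auto simp: indicator_def)
  ultimately have "AE x in M. g x = 0" using g by (intro L2_inner_self_eq_0) auto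
  then show ?thesis using AE_space by eventually_elim (auto simp: g_def)
qed

end

section \<open>The Calderon-Zygmund decomposition\<close>

lemma L2_mono_of_bound:
  assumes [measurable]: "g \<in> borel_measurable M" and K: "K \<ge> 0" and b: "AE x in M. \<bar>g x\<bar> \<le> K"
  shows "Lp_nn M 2 g \<le> ennreal K * Lp_nn M 1 g"
proof -
  have "Lp_nn M 2 g \<le> (\<integral>\<^sup>+x. ennreal K * ennreal (\<bar>g x\<bar> powr 1) \<partial>M)"
    unfolding Lp_nn_def
  proof (rule nn_integral_mono_AE, use b in eventually_elim)
    fix x assume "\<bar>g x\<bar> \<le> K"
    then have "\<bar>g x\<bar> * \<bar>g x\<bar> \<le> K * \<bar>g x\<bar>" by (intro mult_right_mono) auto
    then show "ennreal (\<bar>g x\<bar> powr 2) \<le> ennreal K * ennreal (\<bar>g x\<bar> powr 1)"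
      using K by (subst ennreal_mult[symmetric]) (auto intro!: ennreal_leI simp: power2_eq_square)
  qed
  then show ?thesis by (simp add: nn_integral_cmult Lp_nn_def)
qed

context haar_space
begin

text \<open>Subadditivity for the parents, which may overlap, and additivity for the disjoint cubes
  themselves.\<close>

lemma emeasure_Union_parents_le:
  assumes \<W>: "\<W> \<subseteq> cubes" "disjoint \<W>"
  shows "emeasure M (\<Union>W\<in>\<W>. parent W) \<le> ennreal (1 / \<kappa>) * emeasure M (\<Union>\<W>)"
proof -
  have cW: "countable \<W>" using \<W> countable_cubes by (rule_tac countable_subset) auto
  \<comment> \<open>Indices outside the range of the enumeration receive the empty set, so finite
    and infinite families are treated alike.\<close>
  define A where "A n = (if n \<in> to_nat_on \<W> ` \<W> then from_nat_into \<W> n else {})" for n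
  define B where "B n = (if n \<in> to_nat_on \<W> ` \<W> then parent (from_nat_into \<W> n) else {})" for n
  have e: "from_nat_into \<W> n \<in> \<W>" if "n \<in> to_nat_on \<W> ` \<W>" for n
    using that cW by auto
  have inj: "n = m" if "n \<in> to_nat_on \<W> ` \<W>" "m \<in> to_nat_on \<W> ` \<W>" "from_nat_into \<W> n = from_nat_into \<W> m"
    for n m
    using that cW by auto
  have AU: "(\<Union>n. A n) = \<Union>\<W>"
  proof
    show "(\<Union>n. A n) \<subseteq> \<Union>\<W>" using e by (auto simp: A_def split: if_splits)
    show "\<Union>\<W> \<subseteq> (\<Union>n. A n)"
    proof
      fix x assume "x \<in> \<Union>\<W>"
      then obtain W where "W \<in> \<W>" "x \<in> W" by auto
      then have "x \<in> A (to_nat_on \<W> W)" using cW by (auto simp: A_def)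
      then show "x \<in> (\<Union>n. A n)" by blast
    qed
  qed
  have BU: "(\<Union>W\<in>\<W>. parent W) \<subseteq> (\<Union>n. B n)"
  proof
    fix x assume "x \<in> (\<Union>W\<in>\<W>. parent W)"
    then obtain W where "W \<in> \<W>" "x \<in> parent W" by auto
    then have "x \<in> B (to_nat_on \<W> W)" using cW by (auto simp: B_def)
    then show "x \<in> (\<Union>n. B n)" by blast
  qed
  have Am: "A n \<in> sets M" and Bm: "B n \<in> sets M" for n
  proof -
    have "from_nat_into \<W> n \<in> cubes" if "n \<in> to_nat_on \<W> ` \<W>" using e[OF that] \<W>(1) by blast
    then show "A n \<in> sets M" "B n \<in> sets M"
      unfolding A_def B_def using cube_sets parent_cube by (simp_all del: UN_iff)
  qed
  have AB: "emeasure M (B n) \<le> ennreal (1 / \<kappa>) * emeasure M (A n)" for n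
  proof (cases "n \<in> to_nat_on \<W> ` \<W>")
    case True
    have c: "from_nat_into \<W> n \<in> cubes" using e[OF True] \<W>(1) by auto
    show ?thesis using True parent_measure_le[OF c] \<kappa>(1)
      by (simp add: A_def B_def emeasure_cube[OF c] emeasure_cube[OF parent_cube[OF c]]
        ennreal_mult[symmetric] ennreal_leI)
  qed (simp add: B_def)
  have disj: "disjoint_family A"
    unfolding disjoint_family_on_def
  proof (intro ballI impI)
    fix m n assume "m \<noteq> (n::nat)"
    show "A m \<inter> A n = {}"
    proof (cases "m \<in> to_nat_on \<W> ` \<W> \<and> n \<in> to_nat_on \<W> ` \<W>")
      case True
      then have "from_nat_into \<W> m \<noteq> from_nat_into \<W> n" using inj[of m n] \<open>m \<noteq> n\<close> by blast
      then show ?thesis using \<W>(2) e[of m] e[of n] True unfolding disjoint_def A_def by auto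
    qed (auto simp: A_def)
  qed
  have "emeasure M (\<Union>W\<in>\<W>. parent W) \<le> emeasure M (\<Union>n. B n)"
    using BU Bm by (intro emeasure_mono) auto
  also have "\<dots> \<le> (\<Sum>n. emeasure M (B n))" using Bm by (intro emeasure_subadditive_countably) auto
  also have "\<dots> \<le> (\<Sum>n. ennreal (1 / \<kappa>) * emeasure M (A n))" by (intro suminf_le AB) auto
  also have "\<dots> = ennreal (1 / \<kappa>) * (\<Sum>n. emeasure M (A n))" by simp
  also have "(\<Sum>n. emeasure M (A n)) = emeasure M (\<Union>n. A n)"
    using Am disj by (intro suminf_emeasure) auto
  finally show ?thesis unfolding AU .
qed

text \<open>The family consists of the maximal cubes on which the mean of \<bar>f\<bar> exceeds t.
  The parent of such a cube fails the condition and is at most 1/\<kappa> times as large, whence the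
  upper bound on the mean. Maximal cubes exist because the measure of a cube with large mean is
  bounded by the integral of \<bar>f\<bar> divided by t.\<close>

lemma stopping_cubes:
  assumes f: "integrable M f" and t: "t > 0"
  obtains \<W> where "\<W> \<subseteq> cubes" "disjoint \<W>"
    "\<And>W. W \<in> \<W> \<Longrightarrow> t * measure M W < (\<integral>x. indicator W x * \<bar>f x\<bar> \<partial>M)"
    "\<And>W. W \<in> \<W> \<Longrightarrow> (\<integral>x. indicator W x * \<bar>f x\<bar> \<partial>M) \<le> t / \<kappa> * measure M W"
    "\<And>W. W \<in> cubes \<Longrightarrow> t * measure M W < (\<integral>x. indicator W x * \<bar>f x\<bar> \<partial>M) \<Longrightarrow> \<exists>W'\<in>\<W>. W \<subseteq> W'"
proof -
  define a where "a W = (\<integral>x. indicator W x * \<bar>f x\<bar> \<partial>M)" for W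
  have int: "integrable M (\<lambda>x. indicator W x * \<bar>f x\<bar>)" if "W \<in> cubes" for W
    using integrable_mult_indicator[OF cube_sets[OF that] integrable_abs[OF f]] by simp
  define bad where "bad = {W \<in> cubes. t * measure M W < a W}"
  define \<W> where "\<W> = {W \<in> bad. \<forall>W'\<in>bad. W \<subseteq> W' \<longrightarrow> W' = W}"
  have a_le: "a W \<le> (\<integral>x. \<bar>f x\<bar> \<partial>M)" if "W \<in> cubes" for W
    unfolding a_def using int[OF that] f by (intro integral_mono) (auto simp: indicator_def)
  have a_mono: "a W \<le> a W'" if "W \<in> cubes" "W' \<in> cubes" "W \<subseteq> W'" for W W'
    unfolding a_def using int that by (intro integral_mono) (auto simp: indicator_def)
  have "disjoint \<W>"
    unfolding disjoint_def
  proof (intro ballI impI)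
    fix W W' assume "W \<in> \<W>" "W' \<in> \<W>" "W \<noteq> W'"
    then show "W \<inter> W' = {}" using cubes_nested[of W W'] unfolding \<W>_def bad_def by blast
  qed
  moreover have sub: "\<W> \<subseteq> cubes" by (auto simp: \<W>_def bad_def)
  moreover have "t * measure M W < a W" if "W \<in> \<W>" for W using that by (auto simp: \<W>_def bad_def)
  moreover have "a W \<le> t / \<kappa> * measure M W" if W: "W \<in> \<W>" for W
  proof -
    have c: "W \<in> cubes" using W sub by auto
    have "parent W \<notin> bad" using W parent_psubset[OF c] unfolding \<W>_def by blast
    then have "a (parent W) \<le> t * measure M (parent W)" using parent_cube[OF c] by (auto simp: bad_def)
    then have "a W \<le> t * measure M (parent W)" using a_mono[OF c parent_cube[OF c]] parent_psubset[OF c]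
      by auto
    also have "\<dots> \<le> t * (measure M W / \<kappa>)" using t parent_measure_le[OF c] by (intro mult_left_mono) auto
    finally show ?thesis by simp
  qed
  moreover have "\<exists>W'\<in>\<W>. W \<subseteq> W'" if W: "W \<in> bad" for W
  proof -
    define S where "S = measure M ` {W' \<in> bad. W \<subseteq> W'}"
    have bdd: "bdd_above S"
    proof (rule bdd_aboveI)
      fix m assume "m \<in> S"
      then obtain W' where W': "W' \<in> cubes" "m = measure M W'" "t * m < a W'" by (auto simp: S_def bad_def)
      show "m \<le> (\<integral>x. \<bar>f x\<bar> \<partial>M) / t" using W' a_le[OF W'(1)] t by (simp add: field_simps)
    qed
    have WS: "measure M W \<in> S" using W by (auto simp: S_def)
    have pos: "measure M W > 0" using W measure_cube_pos by (auto simp: bad_def)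
    have le: "measure M W \<le> Sup S" using WS bdd by (rule cSup_upper)
    then have "(1 - \<kappa>) * Sup S < Sup S" using pos \<kappa>(1) by (simp add: algebra_simps)
    \<comment> \<open>A cube within the factor 1 - \<kappa> of the supremum is maximal: a strictly
      larger one would have measure beyond the supremum.\<close>
    obtain W' where W': "W' \<in> bad" "W \<subseteq> W'" "(1 - \<kappa>) * Sup S < measure M W'"
    proof -
      obtain m where "m \<in> S" "(1 - \<kappa>) * Sup S < m"
        using less_cSup_iff[OF _ bdd, of "(1 - \<kappa>) * Sup S"] WS \<open>(1 - \<kappa>) * Sup S < Sup S\<close> by blast
      then show ?thesis using that by (auto simp: S_def)
    qed
    have "W'' = W'" if W'': "W'' \<in> bad" "W' \<subseteq> W''" for W''
    proof (rule ccontr)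
      assume "W'' \<noteq> W'"
      then have "measure M W' \<le> (1 - \<kappa>) * measure M W''"
        using W' W'' by (intro measure_psubset_le) (auto simp: bad_def)
      also have "\<dots> \<le> (1 - \<kappa>) * Sup S"
        using W'' W' \<kappa>(2) by (intro mult_left_mono cSup_upper[OF _ bdd]) (auto simp: S_def)
      finally show False using W'(3) by simp
    qed
    then have "W' \<in> \<W>" using W'(1) by (auto simp: \<W>_def)
    then show ?thesis using W' by auto
  qed
  ultimately show ?thesis using that[of \<W>] unfolding a_def bad_def by blast
qed

text \<open>g is f with its values on each stopping cube replaced by their mean; the bad part is
  kept as the single function f - g. The bound on the L2 norm combines \<bar>g\<bar> \<le>
  t/\<kappa> almost everywhere with the fact that averaging does not increase the L1 norm.\<close>

lemma Calderon_Zygmund_decomposition: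
  assumes f2: "f \<in> Lp M 2" and f1: "f \<in> Lp M 1" and t: "t > 0"
  obtains g \<W> where "g \<in> Lp M 2" "Lp_nn M 2 g \<le> ennreal (t / \<kappa>) * Lp_nn M 1 f"
    "\<W> \<subseteq> cubes" "disjoint \<W>" "emeasure M (\<Union>\<W>) \<le> ennreal (1 / t) * Lp_nn M 1 f"
    "\<And>x. x \<in> space M \<Longrightarrow> x \<notin> \<Union>\<W> \<Longrightarrow> g x = f x"
    "\<And>W. W \<in> \<W> \<Longrightarrow> (\<integral>x. indicator W x * (f x - g x) \<partial>M) = 0"
proof -
  have [measurable]: "f \<in> borel_measurable M" using f2 by (rule Lp_measurable)
  have fi: "integrable M f" using f1 by (auto simp: Lp_def integrable_abs_iff)
  obtain \<W> where \<W>: "\<W> \<subseteq> cubes" "disjoint \<W>"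
    "\<And>W. W \<in> \<W> \<Longrightarrow> t * measure M W < (\<integral>x. indicator W x * \<bar>f x\<bar> \<partial>M)"
    "\<And>W. W \<in> \<W> \<Longrightarrow> (\<integral>x. indicator W x * \<bar>f x\<bar> \<partial>M) \<le> t / \<kappa> * measure M W"
    "\<And>W. W \<in> cubes \<Longrightarrow> t * measure M W < (\<integral>x. indicator W x * \<bar>f x\<bar> \<partial>M) \<Longrightarrow> \<exists>W'\<in>\<W>. W \<subseteq> W'"
    using stopping_cubes[OF fi t] by blast
  have cW: "countable \<W>" using \<W>(1) countable_cubes by (rule countable_subset)
  have sW: "\<W> \<subseteq> sets M" using \<W>(1) cube_sets by blast
  define \<Omega> where "\<Omega> = \<Union>\<W>"
  have [measurable]: "\<Omega> \<in> sets M" unfolding \<Omega>_def using cW sW by (intro sets.countable_Union) auto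
  have int: "integrable M (\<lambda>x. indicator W x * F x)" if "W \<in> cubes" "integrable M F"
    for W and F :: "'a \<Rightarrow> real"
    using integrable_mult_indicator[OF cube_sets[OF that(1)] that(2)] by simp
  define m where "m W = (\<integral>x. indicator W x * f x \<partial>M) / measure M W" for W
  have mle: "\<bar>m W\<bar> * measure M W \<le> (\<integral>x. indicator W x * \<bar>f x\<bar> \<partial>M)" if W: "W \<in> \<W>" for W
  proof -
    have c: "W \<in> cubes" using W \<W> by auto
    have "\<bar>m W\<bar> * measure M W = \<bar>\<integral>x. indicator W x * f x \<partial>M\<bar>"
      using measure_cube_pos[OF c] by (simp add: m_def)
    also have "\<dots> \<le> (\<integral>x. \<bar>indicator W x * f x\<bar> \<partial>M)" by (rule integral_abs_bound)
    also have "\<dots> = (\<integral>x. indicator W x * \<bar>f x\<bar> \<partial>M)" by (simp add: abs_mult)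
    finally show ?thesis .
  qed
  have mb: "\<bar>m W\<bar> \<le> t / \<kappa>" if W: "W \<in> \<W>" for W
  proof -
    have "\<bar>m W\<bar> * measure M W \<le> t / \<kappa> * measure M W" using mle[OF W] \<W>(4)[OF W] by simp
    then show ?thesis using measure_cube_pos[of W] W \<W>(1) by (subst (asm) mult_le_cancel_right) auto
  qed
  define g where "g x = (if x \<in> \<Omega> then m (THE W. W \<in> \<W> \<and> x \<in> W) else f x)" for x
  have gW: "g x = m W" if "W \<in> \<W>" "x \<in> W" for W x
  proof -
    have "(THE W. W \<in> \<W> \<and> x \<in> W) = W"
      using that \<W>(2) by (intro the_equality) (auto simp: disjoint_def)
    then show ?thesis using that by (auto simp: g_def \<Omega>_def)
  qed
  have gout: "g x = f x" if "x \<notin> \<Omega>" for x using that by (simp add: g_def)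
  have gm[measurable]: "g \<in> borel_measurable M"
  proof (rule measurable_piecewise_restrict[where C = "insert (space M - \<Omega>) \<W>"])
    show "countable (insert (space M - \<Omega>) \<W>)" using cW by simp
    show "space M \<subseteq> \<Union>(insert (space M - \<Omega>) \<W>)" by (auto simp: \<Omega>_def)
    fix A assume A: "A \<in> insert (space M - \<Omega>) \<W>"
    then show "A \<inter> space M \<in> sets M" using sW by auto
    show "g \<in> measurable (restrict_space M A) borel"
    proof (cases "A \<in> \<W>")
      case True
      then have "g \<in> measurable (restrict_space M A) borel
        \<longleftrightarrow> (\<lambda>x. m A) \<in> measurable (restrict_space M A) borel"
        by (intro measurable_cong) (auto simp: space_restrict_space gW)
      then show ?thesis by simp
    next
      case False
      then have "g \<in> measurable (restrict_space M A) borel \<longleftrightarrow> f \<in> measurable (restrict_space M A) borel"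
        using A by (intro measurable_cong) (auto simp: space_restrict_space gout)
      then show ?thesis by (simp add: measurable_restrict_space1)
    qed
  qed
  \<comment> \<open>Every average of the restricted function is at most t in absolute value: it is 0
    on cubes inside \<Omega>, and on the others the mean of \<bar>f\<bar> is already at most
    t.\<close>
  have f0: "AE x in M. \<bar>f x * indicator (space M - \<Omega>) x\<bar> \<le> t"
  proof (rule AE_bounded_of_averages)
    show "(\<lambda>x. f x * indicator (space M - \<Omega>) x) \<in> Lp M 2"
      by (rule Lp_dominated[OF _ f2]) (auto simp: indicator_def)
    fix W assume W: "W \<in> cubes"
    show "\<bar>\<integral>x. indicator W x * (f x * indicator (space M - \<Omega>) x) \<partial>M\<bar> \<le> t * measure M W"
    proof (cases "t * measure M W < (\<integral>x. indicator W x * \<bar>f x\<bar> \<partial>M)")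
      case True
      then have "W \<subseteq> \<Omega>" using \<W>(5)[OF W] by (auto simp: \<Omega>_def)
      then have "(\<integral>x. indicator W x * (f x * indicator (space M - \<Omega>) x) \<partial>M) = (\<integral>x. 0 \<partial>M)"
        by (intro Bochner_Integration.integral_cong) (auto simp: indicator_def)
      then show ?thesis using t by simp
    next
      case False
      have "\<bar>\<integral>x. indicator W x * (f x * indicator (space M - \<Omega>) x) \<partial>M\<bar>
        \<le> (\<integral>x. \<bar>indicator W x * (f x * indicator (space M - \<Omega>) x)\<bar> \<partial>M)"
        by (rule integral_abs_bound)
      also have "\<dots> \<le> (\<integral>x. indicator W x * \<bar>f x\<bar> \<partial>M)"
      proof (rule integral_mono)
        have "integrable M (\<lambda>x. indicator (space M - \<Omega>) x * f x)"
          using integrable_mult_indicator[OF _ fi, of "space M - \<Omega>"] by simp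
        then show "integrable M (\<lambda>x. \<bar>indicator W x * (f x * indicator (space M - \<Omega>) x)\<bar>)"
          using int[OF W] by (simp add: mult.commute[of "f _"])
        show "integrable M (\<lambda>x. indicator W x * \<bar>f x\<bar>)" by (rule int[OF W integrable_abs[OF fi]])
      qed (auto simp: indicator_def)
      finally show ?thesis using False by simp
    qed
  qed
  have tk: "t \<le> t / \<kappa>" "0 \<le> t / \<kappa>" using t \<kappa>(1,2) by (auto simp: field_simps)
  have gb: "AE x in M. \<bar>g x\<bar> \<le> t / \<kappa>"
    using f0 AE_space
  proof eventually_elim
    case (elim x)
    show ?case
    proof (cases "x \<in> \<Omega>")
      case True
      then show ?thesis using gW mb by (auto simp: \<Omega>_def)
    next
      case False
      then show ?thesis using elim tk by (simp add: gout)
    qed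
  qed
  have E: "(\<integral>\<^sup>+x. ennreal (G x) \<partial>M) = (\<integral>\<^sup>+C. (\<integral>\<^sup>+x. ennreal (G x) * indicator C x \<partial>M) \<partial>count_space \<W>)
      + (\<integral>\<^sup>+x. ennreal (G x) * indicator (space M - \<Omega>) x \<partial>M)" if [measurable]: "G \<in> borel_measurable M" for G
  proof -
    have "(\<integral>\<^sup>+x. ennreal (G x) \<partial>M) = (\<integral>\<^sup>+x. ennreal (G x) * indicator \<Omega> x + ennreal (G x) * indicator (space M - \<Omega>) x \<partial>M)"
      by (intro nn_integral_cong) (auto simp: indicator_def)
    also have "\<dots> = (\<integral>\<^sup>+x. ennreal (G x) * indicator \<Omega> x \<partial>M) + (\<integral>\<^sup>+x. ennreal (G x) * indicator (space M - \<Omega>) x \<partial>M)"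
      by (intro nn_integral_add) auto
    finally show ?thesis unfolding \<Omega>_def
      using nn_integral_disjoint_countable_Union[OF cW sW \<W>(2), of "\<lambda>x. ennreal (G x)"] by simp
  qed
  have fW: "(\<integral>\<^sup>+x. ennreal \<bar>f x\<bar> * indicator W x \<partial>M) = ennreal (\<integral>x. indicator W x * \<bar>f x\<bar> \<partial>M)"
    if W: "W \<in> \<W>" for W
  proof -
    have "(\<integral>\<^sup>+x. ennreal \<bar>f x\<bar> * indicator W x \<partial>M) = (\<integral>\<^sup>+x. ennreal (indicator W x * \<bar>f x\<bar>) \<partial>M)"
      by (intro nn_integral_cong) (auto simp: indicator_def)
    also have "\<dots> = ennreal (\<integral>x. indicator W x * \<bar>f x\<bar> \<partial>M)"
      using W \<W>(1) by (intro nn_integral_eq_integral int integrable_abs fi) auto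
    finally show ?thesis .
  qed
  have norm_le: "Lp_nn M 1 g \<le> Lp_nn M 1 f"
  proof -
    have le: "(\<integral>\<^sup>+x. ennreal \<bar>g x\<bar> * indicator W x \<partial>M) \<le> (\<integral>\<^sup>+x. ennreal \<bar>f x\<bar> * indicator W x \<partial>M)"
      if W: "W \<in> \<W>" for W
    proof -
      have c: "W \<in> cubes" using W \<W>(1) by auto
      have "(\<integral>\<^sup>+x. ennreal \<bar>g x\<bar> * indicator W x \<partial>M) = (\<integral>\<^sup>+x. ennreal \<bar>m W\<bar> * indicator W x \<partial>M)"
        using gW[OF W] by (intro nn_integral_cong) (auto simp: indicator_def)
      also have "\<dots> = ennreal (\<bar>m W\<bar> * measure M W)"
        using cube_sets[OF c] by (simp add: nn_integral_cmult emeasure_cube[OF c] ennreal_mult)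
      finally show ?thesis using mle[OF W] by (simp add: fW[OF W] ennreal_leI)
    qed
    have eq: "(\<integral>\<^sup>+x. ennreal \<bar>g x\<bar> * indicator (space M - \<Omega>) x \<partial>M)
      = (\<integral>\<^sup>+x. ennreal \<bar>f x\<bar> * indicator (space M - \<Omega>) x \<partial>M)"
      by (intro nn_integral_cong) (auto simp: indicator_def gout)
    have "(\<integral>\<^sup>+C. (\<integral>\<^sup>+x. ennreal \<bar>g x\<bar> * indicator C x \<partial>M) \<partial>count_space \<W>)
        \<le> (\<integral>\<^sup>+C. (\<integral>\<^sup>+x. ennreal \<bar>f x\<bar> * indicator C x \<partial>M) \<partial>count_space \<W>)"
      by (rule nn_integral_mono) (simp add: le)
    then have "(\<integral>\<^sup>+x. ennreal \<bar>g x\<bar> \<partial>M) \<le> (\<integral>\<^sup>+x. ennreal \<bar>f x\<bar> \<partial>M)"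
      using E[of "\<lambda>x. \<bar>g x\<bar>"] E[of "\<lambda>x. \<bar>f x\<bar>"] eq by (simp add: add_right_mono)
    then show ?thesis by (simp add: Lp_nn_def)
  qed
  have "Lp_nn M 2 g \<le> ennreal (t / \<kappa>) * Lp_nn M 1 g" by (rule L2_mono_of_bound) (use tk gb in auto)
  also have "\<dots> \<le> ennreal (t / \<kappa>) * Lp_nn M 1 f" by (intro mult_left_mono norm_le) auto
  finally have g2: "Lp_nn M 2 g \<le> ennreal (t / \<kappa>) * Lp_nn M 1 f" .
  also have "\<dots> < \<infinity>" using f1 by (simp add: Lp_iff ennreal_mult_less_top)
  finally have gL: "g \<in> Lp M 2" by (simp add: Lp_iff)
  have \<Omega>b: "emeasure M (\<Union>\<W>) \<le> ennreal (1 / t) * Lp_nn M 1 f"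
  proof -
    have "emeasure M (\<Union>\<W>) = (\<integral>\<^sup>+C. (\<integral>\<^sup>+x. ennreal 1 * indicator C x \<partial>M) \<partial>count_space \<W>)"
      using nn_integral_disjoint_countable_Union[OF cW sW \<W>(2), of "\<lambda>x. ennreal 1"]
        by (simp add: \<Omega>_def[symmetric])
    also have "\<dots> \<le> (\<integral>\<^sup>+C. ennreal (1 / t) * (\<integral>\<^sup>+x. ennreal \<bar>f x\<bar> * indicator C x \<partial>M) \<partial>count_space \<W>)"
    proof (rule nn_integral_mono)
      fix W assume "W \<in> space (count_space \<W>)"
      then have W: "W \<in> \<W>" by simp
      have c: "W \<in> cubes" using W \<W>(1) by auto
      have "measure M W \<le> 1 / t * (\<integral>x. indicator W x * \<bar>f x\<bar> \<partial>M)" using \<W>(3)[OF W] t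
        by (simp add: field_simps)
      then have "ennreal (measure M W) \<le> ennreal (1 / t) * ennreal (\<integral>x. indicator W x * \<bar>f x\<bar> \<partial>M)"
        using t by (subst ennreal_mult[symmetric]) (auto intro: ennreal_leI)
      then show "(\<integral>\<^sup>+x. ennreal 1 * indicator W x \<partial>M)
        \<le> ennreal (1 / t) * (\<integral>\<^sup>+x. ennreal \<bar>f x\<bar> * indicator W x \<partial>M)"
        unfolding fW[OF W] using cube_sets[OF c] by (simp add: emeasure_cube[OF c])
    qed
    also have "\<dots> = ennreal (1 / t) * (\<integral>\<^sup>+C. (\<integral>\<^sup>+x. ennreal \<bar>f x\<bar> * indicator C x \<partial>M) \<partial>count_space \<W>)"
      by (intro nn_integral_cmult) auto
    also have "\<dots> \<le> ennreal (1 / t) * (\<integral>\<^sup>+x. ennreal \<bar>f x\<bar> \<partial>M)"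
      by (intro mult_left_mono) (auto simp: E[of "\<lambda>x. \<bar>f x\<bar>"])
    finally show ?thesis by (simp add: Lp_nn_def)
  qed
  have zero: "(\<integral>x. indicator W x * (f x - g x) \<partial>M) = 0" if W: "W \<in> \<W>" for W
  proof -
    have c: "W \<in> cubes" using W \<W>(1) by auto
    have "(\<integral>x. indicator W x * (f x - g x) \<partial>M) = (\<integral>x. indicator W x * f x - m W * indicator W x \<partial>M)"
      using gW[OF W] by (intro Bochner_Integration.integral_cong) (auto simp: indicator_def)
    also have "\<dots> = (\<integral>x. indicator W x * f x \<partial>M) - m W * measure M W"
      using int[OF c fi] cube_sets[OF c] emeasure_cube_finite[OF c] by simp
    also have "\<dots> = 0" using measure_cube_pos[OF c] by (simp add: m_def)
    finally show ?thesis .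
  qed
  show ?thesis using that[OF gL g2 \<W>(1,2) \<Omega>b _ zero] gout unfolding \<Omega>_def by blast
qed

text \<open>The summand with the square comes from Chebyshev's inequality and the L2 bound for the
  good part, the summand 1 from the measure of the parents.\<close>

theorem represents_weak_type_1_1:
  assumes U: "localized_family c U" and V: "localized_family c' V" and T: "represents U V T"
  shows "weak_type M 1 (((c * c')\<^sup>2 + 1) / \<kappa>) (Lp M 2 \<inter> Lp M 1) T"
  unfolding weak_type_def
proof safe
  fix f and t :: real assume f2: "f \<in> Lp M 2" and f1: "f \<in> Lp M 1" and t: "t > 0"
  obtain g \<W> where g: "g \<in> Lp M 2" "Lp_nn M 2 g \<le> ennreal (t / \<kappa>) * Lp_nn M 1 f"
    and \<W>: "\<W> \<subseteq> cubes" "disjoint \<W>" "emeasure M (\<Union>\<W>) \<le> ennreal (1 / t) * Lp_nn M 1 f"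
    and out: "\<And>x. x \<in> space M \<Longrightarrow> x \<notin> \<Union>\<W> \<Longrightarrow> g x = f x"
    and zero: "\<And>W. W \<in> \<W> \<Longrightarrow> (\<integral>x. indicator W x * (f x - g x) \<partial>M) = 0"
    using Calderon_Zygmund_decomposition[OF f2 f1 t] by blast
  have cW: "countable \<W>" using \<W>(1) countable_cubes by (rule countable_subset)
  have sW: "\<W> \<subseteq> sets M" using \<W>(1) cube_sets by blast
  define \<Omega> where "\<Omega> = (\<Union>W\<in>\<W>. parent W)"
  have [measurable]: "\<Omega> \<in> sets M"
    unfolding \<Omega>_def using cW \<W>(1) by (intro sets.countable_UN'' cube_sets parent_cube) auto
  define b where "b = (\<lambda>x. f x - g x)"
  have b: "b \<in> Lp M 2" unfolding b_def using f2 g(1) by (intro Lp_diff) auto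
  have Tb: "AE x in M. x \<notin> \<Omega> \<longrightarrow> T b x = 0"
  proof (rule represents_local[OF V T b])
    show "\<Omega> \<in> sets M" by measurable
    fix Q assume Q: "Q \<in> \<B>"
    show "L2_inner M b (U Q) = 0 \<or> Q \<subseteq> \<Omega>"
    proof (cases "\<exists>W\<in>\<W>. Q \<subseteq> parent W")
      case True
      then show ?thesis by (auto simp: \<Omega>_def)
    next
      case False
      \<comment> \<open>U Q is constant on each stopping cube, where b has mean zero, and b vanishes
        elsewhere.\<close>
      have "L2_inner M b (U Q) = 0"
        unfolding L2_inner_def
      proof (rule integral_zero_of_pieces[OF _ cW sW \<W>(2)])
        show "integrable M (\<lambda>x. b x * U Q x)" by
          (rule L2_integrable_mult[OF b localized_family_L2(1)[OF U Q]])
        show "b x * U Q x = 0" if "x \<in> space M" "x \<notin> \<Union>\<W>" for x using out[OF that] by (simp add: b_def)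
        fix W assume W: "W \<in> \<W>"
        have "W \<in> cubes" using W \<W>(1) by blast
        then obtain z where z: "z \<in> W" using cube_nonempty[of W] by auto
        have "(\<integral>x. indicator W x * (b x * U Q x) \<partial>M) = (\<integral>x. U Q z * (indicator W x * (f x - g x)) \<partial>M)"
        proof (intro Bochner_Integration.integral_cong refl)
          fix x
          show "indicator W x * (b x * U Q x) = U Q z * (indicator W x * (f x - g x))"
          proof (cases "x \<in> W")
            case True
            have "U Q x = U Q z" using localized_familyD(5)[OF U Q _ _ True z] W \<W>(1) False by auto
            then show ?thesis by (simp add: b_def)
          qed simp
        qed
        also have "\<dots> = 0" using zero[OF W] by simp
        finally show "(\<integral>x. indicator W x * (b x * U Q x) \<partial>M) = 0" .
      qed
      then show ?thesis by simp
    qed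
  qed
  have Tm: "T f \<in> borel_measurable M" "T g \<in> borel_measurable M" "T b \<in> borel_measurable M"
    using representsD(1)[OF T] f2 g(1) b by (auto intro: Lp_measurable)
  note [measurable] = Tm
  have "AE x in M. T (\<lambda>y. 1 * g y + 1 * b y) x = 1 * T g x + 1 * T b x"
    using represents_linear[OF U T] g(1) b unfolding ae_linear_on_def by blast
  then have lin: "AE x in M. T f x = T g x + T b x" by (simp add: b_def)
  \<comment> \<open>Off \<Omega> the functions T f and T g agree, so the good part keeps the full
    level t.\<close>
  have "emeasure M {x \<in> space M. t < \<bar>T f x\<bar>} \<le> emeasure M ({x \<in> space M. t < \<bar>T g x\<bar>} \<union> \<Omega>)"
  proof (rule emeasure_mono_AE)
    show "AE x in M. x \<in> {x \<in> space M. t < \<bar>T f x\<bar>} \<longrightarrow> x \<in> {x \<in> space M. t < \<bar>T g x\<bar>} \<union> \<Omega>"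
      using lin Tb by eventually_elim auto
  qed measurable
  also have "\<dots> \<le> emeasure M {x \<in> space M. t < \<bar>T g x\<bar>} + emeasure M \<Omega>"
    by (intro emeasure_subadditive) measurable
  also have "\<dots> \<le> ennreal ((c * c')\<^sup>2 / \<kappa> / t) * Lp_nn M 1 f + ennreal (1 / \<kappa> / t) * Lp_nn M 1 f"
  proof (rule add_mono)
    have "emeasure M {x \<in> space M. t < \<bar>T g x\<bar>} \<le> ennreal (1 / t powr 2) * Lp_nn M 2 (T g)"
      using t by (intro Lp_nn_Chebyshev) auto
    also have "\<dots> \<le> ennreal (1 / t powr 2) * (ennreal ((c * c')\<^sup>2) * (ennreal (t / \<kappa>) * Lp_nn M 1 f))"
      by (intro mult_left_mono order_trans[OF represents_bounded[OF U V T g(1)]] g(2)) auto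
    also have "\<dots> = ennreal (1 / t powr 2 * ((c * c')\<^sup>2 * (t / \<kappa>))) * Lp_nn M 1 f"
      using t \<kappa>(1) by (simp add: mult.assoc[symmetric] ennreal_mult[symmetric])
    also have "1 / t powr 2 * ((c * c')\<^sup>2 * (t / \<kappa>)) = (c * c')\<^sup>2 / \<kappa> / t"
      using t by (simp add: power2_eq_square)
    finally show "emeasure M {x \<in> space M. t < \<bar>T g x\<bar>} \<le> ennreal ((c * c')\<^sup>2 / \<kappa> / t) * Lp_nn M 1 f" .
    have "emeasure M \<Omega> \<le> ennreal (1 / \<kappa>) * emeasure M (\<Union>\<W>)"
      unfolding \<Omega>_def by (rule emeasure_Union_parents_le[OF \<W>(1,2)])
    also have "\<dots> \<le> ennreal (1 / \<kappa>) * (ennreal (1 / t) * Lp_nn M 1 f)" by (intro mult_left_mono \<W>(3)) auto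
    also have "\<dots> = ennreal (1 / \<kappa> / t) * Lp_nn M 1 f"
      using t \<kappa>(1) by (simp add: mult.assoc[symmetric] ennreal_mult[symmetric])
    finally show "emeasure M \<Omega> \<le> ennreal (1 / \<kappa> / t) * Lp_nn M 1 f" .
  qed
  also have "\<dots> = ennreal ((c * c')\<^sup>2 / \<kappa> / t + 1 / \<kappa> / t) * Lp_nn M 1 f"
    using t \<kappa>(1) by (simp add: distrib_right ennreal_plus)
  also have "(c * c')\<^sup>2 / \<kappa> / t + 1 / \<kappa> / t = ((c * c')\<^sup>2 + 1) / \<kappa> / t powr 1"
    using t \<kappa>(1) by (simp add: add_divide_distrib)
  finally show "emeasure M {x \<in> space M. t < \<bar>T f x\<bar>}
    \<le> ennreal (((c * c')\<^sup>2 + 1) / \<kappa> / t powr 1) * Lp_nn M 1 f" .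
qed

theorem represents_Lp_bounded_L2:
  assumes U: "localized_family c U" and V: "localized_family c' V" and T: "represents U V T" and p: "p > 1"
  obtains K where "K \<ge> 0" "\<And>f. f \<in> Lp M 2 \<inter> Lp M p \<Longrightarrow> Lp_nn M p (T f) \<le> ennreal K * Lp_nn M p f"
proof -
  \<comment> \<open>Stated for arbitrary families, because for p > 2 it is applied to the adjoint,
    where U and V have changed places and the conjugate exponent lies between 1 and 2.\<close>
  have low: "\<exists>K\<ge>0. \<forall>f\<in>Lp M 2. Lp_nn M q (T f) \<le> ennreal K * Lp_nn M q f"
    if "localized_family c U" "localized_family c' V" "represents U V T" "1 < q" "q < 2" for c c' U V T q
  proof -
    let ?K = "2 powr q * q * (((c * c')\<^sup>2 + 1) / \<kappa> / (q - 1) + (c * c')\<^sup>2 / (2 - q))"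
    have "Lp_nn M q (T f) \<le> ennreal ?K * Lp_nn M q f" if f: "f \<in> Lp M 2" for f
    proof (rule Marcinkiewicz_1_2[OF sigma_finite \<open>1 < q\<close> \<open>q < 2\<close> _ _ _ _ _ _ f])
      show "ae_linear_on M (Lp M 2) T" by (rule represents_linear) fact+
      show "weak_type M 1 (((c * c')\<^sup>2 + 1) / \<kappa>) (Lp M 2 \<inter> Lp M 1) T"
        by (rule represents_weak_type_1_1) fact+
      show Tm: "T f \<in> borel_measurable M" if "f \<in> Lp M 2" for f
        using representsD(1)[OF \<open>represents U V T\<close> that] by (rule Lp_measurable)
      show "weak_type M 2 ((c * c')\<^sup>2) (Lp M 2) T"
        by (rule weak_type_of_strong) (auto intro: Tm represents_bounded[OF \<open>localized_family c
          U\<close> \<open>localized_family c' V\<close> \<open>represents U V T\<close>])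
    qed (use \<kappa>(1) in auto)
    moreover have "?K \<ge> 0" using \<kappa>(1) that by (intro mult_nonneg_nonneg add_nonneg_nonneg
      divide_nonneg_nonneg) auto
    ultimately show ?thesis by blast
  qed
  consider "p < 2" | "p = 2" | "p > 2" by linarith
  then show ?thesis
  proof cases
    case 1
    then show ?thesis using low[OF U V T p] that by blast
  next
    case 2
    then show ?thesis using that[of "(c * c')\<^sup>2"] represents_bounded[OF U V T] by auto
  next
    case 3
    obtain T' where T': "represents V U T'" using represents_exists[OF V U] by blast
    define q where "q = p / (p - 1)"
    have q: "1 < q" "q < 2" using 3 by (auto simp: q_def field_simps)
    obtain C where C: "C \<ge> 0" "\<And>f. f \<in> Lp M 2 \<Longrightarrow> Lp_nn M q (T' f) \<le> ennreal C * Lp_nn M q f"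
      using low[OF V U T' q] by blast
    obtain K where "K \<ge> 0" "\<And>f. f \<in> Lp M 2 \<inter> Lp M p \<Longrightarrow> Lp_nn M p (T f) \<le> ennreal K * Lp_nn M p f"
    proof (rule Lp_bound_by_duality[OF sigma_finite 3 q_def C(1), of T T'])
      show "L2_inner M (T f) g = L2_inner M f (T' g)" if "f \<in> Lp M 2" "g \<in> Lp M 2" for f g
        by (rule represents_adjoint[OF T T' that])
    qed (use representsD(1)[OF T] representsD(1)[OF T'] C(2) in auto)
    then show ?thesis using that by blast
  qed
qed

theorem represents_extends_bounded_Lp:
  assumes U: "localized_family c U" and V: "localized_family c' V" and T: "represents U V T" and p: "p > 1"
  shows "extends_bounded_Lp M p T"
proof -
  obtain K where K: "K \<ge> 0" "\<And>f. f \<in> Lp M 2 \<inter> Lp M p \<Longrightarrow> Lp_nn M p (T f) \<le> ennreal K * Lp_nn M p f"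
    using represents_Lp_bounded_L2[OF U V T p] by blast
  have Tm: "T f \<in> borel_measurable M" if "f \<in> Lp M 2" for f
    using representsD(1)[OF T that] by (rule Lp_measurable)
  have p0: "p > 0" using p by simp
  have wt: "weak_type M p K (Lp M 2 \<inter> Lp M p) T" by (rule weak_type_of_strong) (use p K Tm in auto)
  obtain S where S: "\<forall>f\<in>Lp M p. S f \<in> borel_measurable M" "ae_linear_on M (Lp M p) S"
    "\<forall>f\<in>Lp M 2 \<inter> Lp M p. AE x in M. S f x = T f x" "weak_type M p K (Lp M p) S"
    "\<forall>K. (\<forall>f\<in>Lp M 2 \<inter> Lp M p. Lp_nn M p (T f) \<le> ennreal K * Lp_nn M p f)
      \<longrightarrow> (\<forall>f\<in>Lp M p. Lp_nn M p (S f) \<le> ennreal K * Lp_nn M p f)"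
    by (rule Lp_extension[OF sigma_finite p0 K(1) Tm represents_linear[OF U T] wt])
  have b: "Lp_nn M p (S f) \<le> ennreal K * Lp_nn M p f" if "f \<in> Lp M p" for f using S(5) K(2) that by blast
  have SL: "S f \<in> Lp M p" if f: "f \<in> Lp M p" for f
  proof -
    have "ennreal K * Lp_nn M p f < \<infinity>" using f by (simp add: Lp_iff ennreal_mult_less_top)
    then show ?thesis using S(1) f b[OF f] by (simp add: Lp_iff order_le_less_trans)
  qed
  have "Lp_norm M p (S f) \<le> K powr (1 / p) * Lp_norm M p f" if "f \<in> Lp M p" for f
    using Lp_norm_le_of_nn[OF that SL[OF that] _ K(1) b[OF that]] p by simp
  then show ?thesis unfolding extends_bounded_Lp_def Lp_bounded_linear_def using SL S(2,3) by blast
qed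

theorem represents_extends_weak_type_1_1:
  assumes U: "localized_family c U" and V: "localized_family c' V" and T: "represents U V T"
  shows "extends_weak_type_1_1 M T"
proof -
  let ?C = "((c * c')\<^sup>2 + 1) / \<kappa>"
  have C: "?C \<ge> 0" using \<kappa>(1) by simp
  have Tm: "T f \<in> borel_measurable M" if "f \<in> Lp M 2" for f
    using representsD(1)[OF T that] by (rule Lp_measurable)
  obtain S where S: "\<forall>f\<in>Lp M 1. S f \<in> borel_measurable M" "ae_linear_on M (Lp M 1) S"
    "\<forall>f\<in>Lp M 2 \<inter> Lp M 1. AE x in M. S f x = T f x" "weak_type M 1 ?C (Lp M 1) S"
    by (rule Lp_extension[OF sigma_finite zero_less_one C Tm represents_linear[OF U T]
      represents_weak_type_1_1[OF U V T]])
  have "emeasure M {x \<in> space M. t < \<bar>S f x\<bar>} \<le> ennreal (?C * Lp_norm M 1 f / t)"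
    if f: "f \<in> Lp M 1" and t: "t > 0" for f and t :: real
  proof -
    have "emeasure M {x \<in> space M. t < \<bar>S f x\<bar>} \<le> ennreal (?C / t powr 1) * Lp_nn M 1 f"
      using S(4) f t unfolding weak_type_def by blast
    also have "\<dots> = ennreal (?C * Lp_norm M 1 f / t)"
    proof -
      have "Lp_nn M 1 f = ennreal (Lp_norm M 1 f)" using f by (simp add: Lp_nn_norm Lp_norm_def)
      moreover have "ennreal (?C / t) * ennreal (Lp_norm M 1 f) = ennreal (?C / t * Lp_norm M 1 f)"
        using C t \<kappa>(1) by (intro ennreal_mult[symmetric] divide_nonneg_pos) (auto simp: Lp_norm_def)
      ultimately show ?thesis using t by simp
    qed
    finally show ?thesis .
  qed
  then show ?thesis unfolding extends_weak_type_1_1_def using S(1-3) by blast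
qed

theorem represents_Lp_bounded_linear_2:
  assumes U: "localized_family c U" and V: "localized_family c' V" and T: "represents U V T"
  shows "Lp_bounded_linear M 2 T"
proof -
  have "Lp_norm M 2 (T f) \<le> (c * c')\<^sup>2 powr (1 / 2) * Lp_norm M 2 f" if f: "f \<in> Lp M 2" for f
    by (rule Lp_norm_le_of_nn) (use f representsD(1)[OF T f] represents_bounded[OF U V T f] in auto)
  then show ?thesis unfolding Lp_bounded_linear_def
    using representsD(1)[OF T] represents_linear[OF U T] by blast
qed

end

section \<open>The kernel\<close>

lemma integral_tensor_product:
  fixes a b :: "'a \<Rightarrow> real"
  assumes sf: "sigma_finite_measure M" and a: "integrable M a" and b: "integrable M b"
  shows "integrable (M \<Otimes>\<^sub>M M) (\<lambda>(x, y). a x * b y)"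
    and "(\<integral>(x, y). a x * b y \<partial>(M \<Otimes>\<^sub>M M)) = (\<integral>x. a x \<partial>M) * (\<integral>y. b y \<partial>M)"
proof -
  interpret pair_sigma_finite M M by (intro pair_sigma_finite.intro sf)
  have [measurable]: "a \<in> borel_measurable M" "b \<in> borel_measurable M" using a b by auto
  show int: "integrable (M \<Otimes>\<^sub>M M) (\<lambda>(x, y). a x * b y)"
  proof (rule Fubini_integrable)
    show "integrable M (\<lambda>x. \<integral>y. norm (case (x, y) of (x, y) \<Rightarrow> a x * b y) \<partial>M)"
      using a by (simp add: abs_mult)
    show "AE x in M. integrable M (\<lambda>y. case (x, y) of (x, y) \<Rightarrow> a x * b y)" using b by simp
  qed measurable
  show "(\<integral>(x, y). a x * b y \<partial>(M \<Otimes>\<^sub>M M)) = (\<integral>x. a x \<partial>M) * (\<integral>y. b y \<partial>M)"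
    using integral_fst'[OF int] by simp
qed

context haar_space
begin

abbreviation "\<delta> \<equiv> dyadic_dist M D"

definition join :: "'a \<Rightarrow> 'a \<Rightarrow> 'a set" where
  "join x y = (SOME Q. Q \<in> \<B> \<and> x \<in> Q \<and> y \<in> Q \<and> (\<forall>Q'\<in>cubes. x \<in> Q' \<longrightarrow> y \<in> Q' \<longrightarrow> Q \<subseteq> Q'))"

lemma join:
  assumes "x \<in> space M" "y \<in> space M" "x \<noteq> y"
  shows "join x y \<in> \<B>" "x \<in> join x y" "y \<in> join x y"
    and "Q \<in> cubes \<Longrightarrow> x \<in> Q \<Longrightarrow> y \<in> Q \<Longrightarrow> join x y \<subseteq> Q"
proof -
  have "\<exists>Q. Q \<in> \<B> \<and> x \<in> Q \<and> y \<in> Q \<and> (\<forall>Q'\<in>cubes. x \<in> Q' \<longrightarrow> y \<in> Q' \<longrightarrow> Q \<subseteq> Q')"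
  proof (rule minimal_branching_cube[OF assms])
    fix j assume j: "cube_at j x \<in> branching_level D j" "cube_at j x = cube_at j y"
      "\<And>Q. Q \<in> cubes \<Longrightarrow> x \<in> Q \<Longrightarrow> y \<in> Q \<Longrightarrow> cube_at j x \<subseteq> Q"
    then show ?thesis using cube_at(2)[OF assms(1), of j] cube_at(2)[OF assms(2), of j]
      by (intro exI[of _ "cube_at j x"]) (auto simp: branching_def)
  qed
  from someI_ex[OF this, folded join_def]
  show "join x y \<in> \<B>" "x \<in> join x y" "y \<in> join x y" "Q \<in> cubes \<Longrightarrow> x \<in> Q \<Longrightarrow> y \<in> Q \<Longrightarrow> join x y \<subseteq> Q"
    by blast+
qed

lemma join_cube: "x \<in> space M \<Longrightarrow> y \<in> space M \<Longrightarrow> x \<noteq> y \<Longrightarrow> join x y \<in> cubes"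
  using join(1) branching_cube by blast

lemma dyadic_dist_join:
  assumes "x \<in> space M" "y \<in> space M" "x \<noteq> y"
  shows "\<delta> x y = measure M (join x y)"
proof -
  have "(LEAST r. \<exists>Q\<in>\<B>. x \<in> Q \<and> y \<in> Q \<and> r = measure M Q) = measure M (join x y)"
  proof (rule Least_equality)
    show "\<exists>Q\<in>\<B>. x \<in> Q \<and> y \<in> Q \<and> measure M (join x y) = measure M Q" using join[OF assms] by blast
    fix r assume "\<exists>Q\<in>\<B>. x \<in> Q \<and> y \<in> Q \<and> r = measure M Q"
    then obtain Q where Q: "Q \<in> \<B>" "x \<in> Q" "y \<in> Q" "r = measure M Q" by blast
    then show "measure M (join x y) \<le> r"
      using join(4)[OF assms branching_cube[OF Q(1)] Q(2,3)] measure_cube_mono[OF join_cube[OF assms]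
        branching_cube[OF Q(1)]] by simp
  qed
  then show ?thesis using assms(3) by (simp add: dyadic_dist_def)
qed

lemma dyadic_dist_self [simp]: "\<delta> x x = 0"
  by (simp add: dyadic_dist_def)

lemma dyadic_dist_commute: "\<delta> x y = \<delta> y x"
  unfolding dyadic_dist_def by (simp add: conj_commute conj_left_commute)

lemma dyadic_dist_pos: "x \<in> space M \<Longrightarrow> y \<in> space M \<Longrightarrow> x \<noteq> y \<Longrightarrow> \<delta> x y > 0"
  using measure_cube_pos[OF join_cube] by (simp add: dyadic_dist_join)

lemma join_not_in_child:
  assumes "x \<in> space M" "y \<in> space M" "x \<noteq> y" "R \<in> children D (join x y)" "x \<in> R"
  shows "y \<notin> R"
  using join(4)[OF assms(1-3) child_cube[OF join(1)[OF assms(1-3)] assms(4)] assms(5)]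
    child_subset[OF join(1)[OF assms(1-3)] assms(4)] by blast

lemma join_subset_of_children:
  assumes Q: "Q \<in> \<B>" and R: "R \<in> children D Q" "R' \<in> children D Q" "R \<noteq> R'" "x \<in> R" "y \<in> R'"
  shows "Q \<subseteq> join x y"
proof -
  have X: "x \<in> space M" "y \<in> space M" using R cube_subset child_cube[OF Q] by blast+
  have ne: "x \<noteq> y" using R children_disjoint[OF Q R(1,2)] by blast
  have "x \<in> Q" using R child_subset[OF Q] by blast
  moreover have "\<not> (\<exists>R0\<in>children D Q. join x y \<subseteq> R0)"
  proof
    assume "\<exists>R0\<in>children D Q. join x y \<subseteq> R0"
    then obtain R0 where R0: "R0 \<in> children D Q" "join x y \<subseteq> R0" by blast
    then have "x \<in> R0" "y \<in> R0" using join(2,3)[OF X ne] by auto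
    then have "R0 = R" "R0 = R'" using children_disjoint[OF Q R0(1)] R by blast+
    then show False using R by simp
  qed
  ultimately show ?thesis
    using branching_trichotomy[OF Q join_cube[OF X ne]] join(2)[OF X ne] by blast
qed

text \<open>For z in another child, or outside \<open>join x y\<close>, the cube
  \<open>join x z\<close> contains \<open>join x y\<close>. Thus balls of \<delta> are cubes, which
  supplies the neighbourhoods for local integrability.\<close>

lemma dball_dyadic_dist:
  assumes X: "x \<in> space M" "y \<in> space M" "x \<noteq> y" and R: "R \<in> children D (join x y)" "x \<in> R"
  shows "dball (space M) \<delta> x (\<delta> x y) = R"
proof -
  have B: "join x y \<in> \<B>" and Rc: "R \<in> cubes" using join(1)[OF X] child_cube R by blast+
  have "\<delta> x z < \<delta> x y \<longleftrightarrow> z \<in> R" if z: "z \<in> space M" for z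
  proof (cases "z = x")
    case True
    then show ?thesis using dyadic_dist_pos[OF X] R by simp
  next
    case False
    then have ne: "x \<noteq> z" by simp
    show ?thesis
    proof
      assume "z \<in> R"
      then have "join x z \<subseteq> R" using join(4)[OF X(1) z ne Rc R(2)] by simp
      then have "join x z \<subset> join x y" using child_subset[OF B R(1)] by blast
      then show "\<delta> x z < \<delta> x y"
        using measure_psubset_less[OF join_cube[OF X(1) z ne] join_cube[OF X]]
          by (simp add: dyadic_dist_join X z ne)
    next
      assume lt: "\<delta> x z < \<delta> x y"
      show "z \<in> R"
      proof (cases "z \<in> join x y")
        case True
        then obtain R' where R': "R' \<in> children D (join x y)" "z \<in> R'" using children_cover[OF B] by blast
        have "R = R'"
        proof (rule ccontr)
          assume "R \<noteq> R'"
          then have "join x y \<subseteq> join x z" using join_subset_of_children[OF B R(1) R'(1) _ R(2) R'(2)]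
            by simp
          then show False using lt measure_cube_mono[OF join_cube[OF X] join_cube[OF X(1) z ne]]
            by (simp add: dyadic_dist_join X z ne)
        qed
        then show ?thesis using R' by simp
      next
        case False
        have "join x y \<subseteq> join x z"
          using cubes_nested[OF join_cube[OF X] join_cube[OF X(1) z ne]] False join(2,3)[OF X(1) z ne]
            join(2)[OF X] by blast
        then show ?thesis using lt measure_cube_mono[OF join_cube[OF X] join_cube[OF X(1) z ne]]
            by (simp add: dyadic_dist_join X z ne)
      qed
    qed
  qed
  then show ?thesis using cube_subset[OF Rc] by (auto simp: dball_def)
qed

text \<open>A finite family would have a member of largest measure, but its parent is larger. Hence
  the branching cubes can be enumerated by the natural numbers without repetition.\<close>

lemma infinite_branching: "infinite \<B>"
proof
  assume fin: "finite \<B>"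
  obtain Q0 where "Q0 \<in> cubes" using quad by auto
  then have "\<B> \<noteq> {}" using parent(1) by blast
  then have "Max (measure M ` \<B>) \<in> measure M ` \<B>" using fin by (intro Max_in) auto
  then obtain Q where "Q \<in> \<B>" "measure M Q = Max (measure M ` \<B>)" by auto
  then have Q: "Q \<in> \<B>" "\<And>Q'. Q' \<in> \<B> \<Longrightarrow> measure M Q' \<le> measure M Q" using fin by auto
  have c: "Q \<in> cubes" using Q branching_cube by blast
  show False using Q(2)[OF parent(1)[OF c]] measure_psubset_less[OF c parent_cube[OF c] parent_psubset[OF
    c]] by simp
qed

section \<open>The kernel series and its estimates\<close>

definition branching_seq :: "nat \<Rightarrow> 'a set" where
  "branching_seq = from_nat_into \<B>"

lemma branching_seq_bij: "bij_betw branching_seq UNIV \<B>"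
  unfolding branching_seq_def by (rule bij_betw_from_nat_into[OF countable_branching infinite_branching])

lemma branching_seq: "branching_seq n \<in> \<B>"
  using branching_seq_bij by (auto simp: bij_betw_def)

text \<open>Written as a series over an enumeration, the kernel is jointly measurable as a limit of
  finite sums of products. Off the diagonal the convergence is absolute, so the order of the cubes
  does not affect the value.\<close>

definition kernel :: "('a set \<Rightarrow> 'a \<Rightarrow> real) \<Rightarrow> ('a set \<Rightarrow> 'a \<Rightarrow> real) \<Rightarrow> 'a \<Rightarrow> 'a \<Rightarrow> real" where
  "kernel U V x y = (\<Sum>n. U (branching_seq n) x * V (branching_seq n) y)"

lemma kernel_commute: "kernel U V x y = kernel V U y x"
  by (simp add: kernel_def mult.commute)

lemma kernel_term_zero:
  assumes U: "localized_family c U" and V: "localized_family c' V" and X: "x \<in> space M" "y \<in> space M"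
    "x \<noteq> y"
    and Q: "Q \<in> \<B>" "\<not> join x y \<subseteq> Q"
  shows "U Q x * V Q y = 0"
proof -
  have "x \<notin> Q \<or> y \<notin> Q" using join(4)[OF X branching_cube[OF Q(1)]] Q(2) by blast
  then show ?thesis using localized_familyD(3)[OF U Q(1) X(1)] localized_familyD(3)[OF V Q(1) X(2)] by auto
qed

lemma kernel_finite_sum_le:
  assumes U: "localized_family c U" and V: "localized_family c' V" and X: "x \<in> space M" "y \<in> space M"
    "x \<noteq> y"
    and F: "finite F"
  shows "(\<Sum>n\<in>F. \<bar>U (branching_seq n) x * V (branching_seq n) y\<bar>) \<le> c * c' / \<kappa> / \<delta> x y"
proof -
  let ?e = branching_seq
  have cc: "c > 0" "c' > 0" using localized_familyD(1) U V by blast+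
  define G where "G = {Q \<in> ?e ` F. join x y \<subseteq> Q}"
  have GB: "G \<subseteq> \<B>" using branching_seq by (auto simp: G_def)
  have "(\<Sum>n\<in>F. \<bar>U (?e n) x * V (?e n) y\<bar>) = (\<Sum>Q\<in>?e ` F. \<bar>U Q x * V Q y\<bar>)"
    using branching_seq_bij by (subst sum.reindex) (auto simp: bij_betw_def intro: inj_on_subset)
  also have "\<dots> = (\<Sum>Q\<in>G. \<bar>U Q x * V Q y\<bar>)"
    using F kernel_term_zero[OF U V X] branching_seq by (intro sum.mono_neutral_right) (auto simp: G_def)
  also have "\<dots> \<le> (\<Sum>Q\<in>G. c * c' * (1 / measure M Q))"
  proof (rule sum_mono)
    fix Q assume "Q \<in> G"
    then have Q: "Q \<in> \<B>" using GB by auto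
    have pos: "measure M Q > 0" using measure_cube_pos branching_cube[OF Q] by auto
    have "\<bar>U Q x * V Q y\<bar> \<le> (c / sqrt (measure M Q)) * (c' / sqrt (measure M Q))"
      unfolding abs_mult using localized_familyD(4)[OF U Q X(1)] localized_familyD(4)[OF V Q X(2)] cc
        by (intro mult_mono) auto
    then show "\<bar>U Q x * V Q y\<bar> \<le> c * c' * (1 / measure M Q)" using pos by simp
  qed
  also have "\<dots> = c * c' * (\<Sum>Q\<in>G. 1 / measure M Q)" by (simp add: sum_distrib_left)
  also have "\<dots> \<le> c * c' * (1 / (\<kappa> * measure M (join x y)))"
    using cc F GB branching_cube by (intro mult_left_mono sum_inverse_measure_chain join_cube X)
      (auto simp: G_def)
  also have "\<dots> = c * c' / \<kappa> / \<delta> x y" by (simp add: dyadic_dist_join X)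
  finally show ?thesis .
qed

lemma kernel_summable:
  assumes U: "localized_family c U" and V: "localized_family c' V" and X: "x \<in> space M" "y \<in> space M"
    "x \<noteq> y"
  shows "summable (\<lambda>n. \<bar>U (branching_seq n) x * V (branching_seq n) y\<bar>)"
proof (rule summableI_nonneg_bounded)
  show "(\<Sum>n<N. \<bar>U (branching_seq n) x * V (branching_seq n) y\<bar>) \<le> c * c' / \<kappa> / \<delta> x y" for N
    by (rule kernel_finite_sum_le[OF U V X]) simp
qed simp

lemma kernel_bound:
  assumes U: "localized_family c U" and V: "localized_family c' V" and X: "x \<in> space M" "y \<in> space M"
    "x \<noteq> y"
  shows "\<bar>kernel U V x y\<bar> \<le> c * c' / \<kappa> / \<delta> x y"
proof -
  have "\<bar>kernel U V x y\<bar> \<le> (\<Sum>n. \<bar>U (branching_seq n) x * V (branching_seq n) y\<bar>)"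
    unfolding kernel_def by (rule summable_rabs[OF kernel_summable[OF U V X]])
  also have "\<dots> \<le> c * c' / \<kappa> / \<delta> x y"
    by (rule suminf_le_const[OF kernel_summable[OF U V X]]) (rule kernel_finite_sum_le[OF U V X], simp)
  finally show ?thesis .
qed

text \<open>By its smaller measure \<open>join x' x\<close> cannot contain \<open>join x y\<close>,
  so nesting puts it inside. It does not contain y either, and therefore x and x' have the same
  smallest common cube with y.\<close>

lemma dyadic_dist_ultrametric:
  assumes X: "x \<in> space M" "x' \<in> space M" "y \<in> space M" "x \<noteq> y" "x' \<noteq> x" and lt: "\<delta> x' x < \<delta> x y"
  shows "x' \<noteq> y" "join x' x \<subseteq> join x y" "join x' y = join x y"
proof -
  show ne: "x' \<noteq> y" using lt dyadic_dist_commute[of x y] by auto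
  have W: "join x' x \<in> cubes" "x' \<in> join x' x" "x \<in> join x' x" using join_cube join X by blast+
  have J: "join x y \<in> cubes" "x \<in> join x y" "y \<in> join x y" using join_cube join X by blast+
  have notsub: "\<not> join x y \<subseteq> join x' x"
    using lt measure_cube_mono[OF J(1) W(1)] by (auto simp: dyadic_dist_join X)
  then show sub: "join x' x \<subseteq> join x y" using cubes_nested[OF W(1) J(1)] W J by blast
  have "join x' y \<subseteq> join x y" using join(4)[OF X(2,3) ne J(1)] W sub J by blast
  moreover have "join x y \<subseteq> join x' y"
  proof -
    have P: "join x' y \<in> cubes" "x' \<in> join x' y" "y \<in> join x' y" using join_cube join X ne by blast+
    have "\<not> join x' y \<subseteq> join x' x" using join(4)[OF X(1,3,4) W(1,3)] P notsub by blast
    then have "join x' x \<subseteq> join x' y" using cubes_nested[OF W(1) P(1)] W P by blast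
    then show ?thesis using join(4)[OF X(1,3,4) P(1)] W P by blast
  qed
  ultimately show "join x' y = join x y" by simp
qed

text \<open>
  A term of the kernel can only change if its cube lies between \<open>join x y\<close> and the parent of \<open>join x' x\<close>.
  Thus either the two kernels agree or \<open>\<delta> x' x\<close> and \<open>\<delta> x y\<close> are comparable.
\<close>

lemma kernel_smooth:
  assumes U: "localized_family c U" and V: "localized_family c' V"
    and X: "x \<in> space M" "x' \<in> space M" "y \<in> space M" "x \<noteq> y" and lt: "2 * \<delta> x' x \<le> \<delta> x y"
  shows "\<bar>kernel U V x' y - kernel U V x y\<bar> \<le> 2 * c * c' / \<kappa>\<^sup>2 * \<delta> x' x powr 1 / \<delta> x y powr (1 + 1)"
proof (cases "x' = x")
  case False
  have pos: "\<delta> x y > 0" "\<delta> x' x > 0" using dyadic_dist_pos X False by auto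
  then have lt': "\<delta> x' x < \<delta> x y" using lt by simp
  note u = dyadic_dist_ultrametric[OF X False lt']
  have d: "\<delta> x' y = \<delta> x y" using u X by (simp add: dyadic_dist_join)
  have cc: "c > 0" "c' > 0" using localized_familyD(1) U V by blast+
  have W: "join x' x \<in> cubes" "x' \<in> join x' x" "x \<in> join x' x" using join_cube join X False by blast+
  show ?thesis
  proof (cases "\<delta> x y \<le> \<delta> x' x / \<kappa>")
    case True
    have "\<bar>kernel U V x' y - kernel U V x y\<bar> \<le> \<bar>kernel U V x' y\<bar> + \<bar>kernel U V x y\<bar>" by simp
    also have "\<dots> \<le> c * c' / \<kappa> / \<delta> x y + c * c' / \<kappa> / \<delta> x y"
      using kernel_bound[OF U V X(2,3) u(1)] kernel_bound[OF U V X(1,3,4)] d by (intro add_mono) auto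
    \<comment> \<open>One factor \<delta> x y is exchanged for \<delta> x' x / \<kappa>, which turns
      the size bound into a smoothness bound and brings in the second \<kappa>.\<close>
    also have "\<dots> = 2 * c * c' / \<kappa> / (\<delta> x y)\<^sup>2 * \<delta> x y" using pos by (simp add: power2_eq_square)
    also have "\<dots> \<le> 2 * c * c' / \<kappa> / (\<delta> x y)\<^sup>2 * (\<delta> x' x / \<kappa>)"
      using True cc \<kappa>(1) by (intro mult_left_mono) auto
    also have "\<dots> = 2 * c * c' / \<kappa>\<^sup>2 * \<delta> x' x powr 1 / \<delta> x y powr (1 + 1)"
      using pos by (simp add: power2_eq_square)
    finally show ?thesis .
  next
    case nle: False
    have eq: "U Q x' * V Q y = U Q x * V Q y" if Q: "Q \<in> \<B>" for Q
    proof (cases "join x y \<subseteq> Q")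
      case True
      have "\<not> Q \<subseteq> parent (join x' x)"
      proof
        assume "Q \<subseteq> parent (join x' x)"
        then have "measure M (join x y) \<le> measure M (parent (join x' x))"
          using True join_cube[OF X(1,3,4)] parent_cube[OF W(1)] by (intro measure_cube_mono) auto
        also have "\<dots> \<le> measure M (join x' x) / \<kappa>" by (rule parent_measure_le[OF W(1)])
        finally show False using nle X False by (simp add: dyadic_dist_join)
      qed
      then show ?thesis using localized_familyD(5)[OF U Q W(1) _ W(2,3)] by simp
    next
      case False
      have "U Q x * V Q y = 0" by (rule kernel_term_zero[OF U V X(1,3,4) Q False])
      moreover have "U Q x' * V Q y = 0"
        by (rule kernel_term_zero[OF U V X(2,3) u(1) Q]) (simp add: u(3) False)
      ultimately show ?thesis by (simp only:)
    qed
    have "kernel U V x' y = kernel U V x y" unfolding kernel_def by (simp only: eq[OF branching_seq])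
    then show ?thesis using cc by simp
  qed
qed simp

text \<open>Distinct points are separated by the cubes of some level, which makes the set a
  countable union of rectangles.\<close>

lemma off_diag_measurable: "off_diag (space M) \<in> sets (M \<Otimes>\<^sub>M M)"
proof -
  have "off_diag (space M) = (\<Union>j. \<Union>R\<in>D j. \<Union>R'\<in>D j - {R}. R \<times> R')"
  proof (rule set_eqI)
    fix p :: "'a \<times> 'a"
    obtain x y where p: "p = (x, y)" by (cases p)
    show "p \<in> off_diag (space M) \<longleftrightarrow> p \<in> (\<Union>j. \<Union>R\<in>D j. \<Union>R'\<in>D j - {R}. R \<times> R')"
    proof
      assume "p \<in> off_diag (space M)"
      then have X: "x \<in> space M" "y \<in> space M" "x \<noteq> y" by (auto simp: off_diag_def p)
      then obtain j where j: "cube_at j x \<noteq> cube_at j y" using points_separated by blast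
      then have "(x, y) \<in> cube_at j x \<times> cube_at j y" "cube_at j x \<in> D j" "cube_at j y \<in> D j - {cube_at j x}"
        using cube_at[OF X(1), of j] cube_at[OF X(2), of j] by auto
      then show "p \<in> (\<Union>j. \<Union>R\<in>D j. \<Union>R'\<in>D j - {R}. R \<times> R')" unfolding p by blast
    next
      assume "p \<in> (\<Union>j. \<Union>R\<in>D j. \<Union>R'\<in>D j - {R}. R \<times> R')"
      then obtain j R R' where h: "R \<in> D j" "R' \<in> D j" "R \<noteq> R'" "x \<in> R" "y \<in> R'" by (auto simp: p)
      then have "x \<noteq> y" using D_disjoint[OF h(1,2)] by blast
      moreover have "R \<subseteq> space M" "R' \<subseteq> space M" using cube_subset h(1,2) by auto
      ultimately show "p \<in> off_diag (space M)" using h by (auto simp: off_diag_def p)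
    qed
  qed
  moreover have "countable (D j)" for j by (rule countable_subset[OF _ countable_cubes]) auto
  ultimately show ?thesis using D_sets
    by (auto intro!: sets.countable_UN' sets.countable_UN'' pair_measureI)
qed

lemma kernel_measurable:
  assumes "localized_family c U" "localized_family c' V"
  shows "(\<lambda>(x, y). kernel U V x y) \<in> borel_measurable (M \<Otimes>\<^sub>M M)"
proof -
  have [measurable]: "U (branching_seq n) \<in> borel_measurable M" "V (branching_seq n) \<in> borel_measurable M"
    for n
    using localized_familyD(2) assms branching_seq by blast+
  show ?thesis unfolding kernel_def by measurable
qed

text \<open>Points in two different children of \<open>join x y\<close> are at distance at least
  \<delta> x y. The kernel is therefore bounded on the product of the children containing x and y, a
  set of finite measure.\<close>

lemma kernel_L1_loc:
  assumes U: "localized_family c U" and V: "localized_family c' V"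
  shows "L1_loc_off_diag M \<delta> (kernel U V)"
  unfolding L1_loc_off_diag_def
proof (intro conjI ballI)
  note [measurable] = kernel_measurable[OF U V] off_diag_measurable
  show "set_borel_measurable (M \<Otimes>\<^sub>M M) (off_diag (space M)) (\<lambda>(x, y). kernel U V x y)"
    unfolding set_borel_measurable_def by measurable
  interpret sigma_finite_measure M by (rule sigma_finite)
  fix p assume "p \<in> off_diag (space M)"
  then obtain x y where p: "p = (x, y)" and X: "x \<in> space M" "y \<in> space M" "x \<noteq> y"
    by (auto simp: off_diag_def)
  define J where "J = join x y"
  have J: "J \<in> \<B>" unfolding J_def by (rule join(1)[OF X])
  obtain R where R: "R \<in> children D J" "x \<in> R" using children_cover[OF J] join(2)[OF X]
    by (auto simp: J_def)
  obtain R' where R': "R' \<in> children D J" "y \<in> R'" using children_cover[OF J] join(3)[OF X]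
    by (auto simp: J_def)
  have ne: "R \<noteq> R'" using join_not_in_child[OF X] R R' by (auto simp: J_def)
  have Jyx: "join y x = J" unfolding J_def
    using join(4)[OF X(2,1) X(3)[symmetric] join_cube[OF X]] join(4)[OF X join_cube[OF X(2,1)
      X(3)[symmetric]]]
      join(2,3)[OF X] join(2,3)[OF X(2,1) X(3)[symmetric]] by blast
  have b1: "dball (space M) \<delta> x (\<delta> x y) = R" using dball_dyadic_dist[OF X] R by (simp add: J_def)
  have b2: "dball (space M) \<delta> y (\<delta> x y) = R'"
    using dball_dyadic_dist[OF X(2,1) X(3)[symmetric], of R'] R'
      by (simp add: Jyx dyadic_dist_commute[of y x])
  have c: "R \<in> cubes" "R' \<in> cubes" using child_cube J R R' by blast+
  have sub: "R \<times> R' \<subseteq> off_diag (space M)"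
    using cube_subset[OF c(1)] cube_subset[OF c(2)] children_disjoint[OF J R(1) R'(1)] ne
      by (auto simp: off_diag_def)
  have [measurable]: "R \<in> sets M" "R' \<in> sets M" using cube_sets c by blast+
  have "set_integrable (M \<Otimes>\<^sub>M M) (R \<times> R') (\<lambda>(x, y). kernel U V x y)"
    unfolding set_integrable_def
  proof (rule integrableI_bounded_set_indicator[where B = "c * c' / \<kappa> / \<delta> x y"])
    show "emeasure (M \<Otimes>\<^sub>M M) (R \<times> R') < \<infinity>"
      using emeasure_cube_finite[OF c(1)] emeasure_cube_finite[OF c(2)]
      by (simp add: emeasure_pair_measure_Times ennreal_mult_less_top)
    have "\<bar>kernel U V a b\<bar> \<le> c * c' / \<kappa> / \<delta> x y" if ab: "a \<in> R" "b \<in> R'" for a b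
    proof -
      have AB: "a \<in> space M" "b \<in> space M" "a \<noteq> b" using sub ab by (auto simp: off_diag_def)
      have "\<delta> x y \<le> \<delta> a b"
        using join_subset_of_children[OF J R(1) R'(1) ne ab] measure_cube_mono[OF branching_cube[OF J]
          join_cube[OF AB]]
        by (simp add: dyadic_dist_join X AB J_def[symmetric])
      have "c > 0" "c' > 0" using localized_familyD(1) U V by blast+
      have "\<bar>kernel U V a b\<bar> \<le> c * c' / \<kappa> / \<delta> a b" by (rule kernel_bound[OF U V AB])
      also have "\<dots> \<le> c * c' / \<kappa> / \<delta> x y"
        using \<open>\<delta> x y \<le> \<delta> a b\<close> \<open>c > 0\<close> \<open>c' > 0\<close> \<kappa>(1) dyadic_dist_pos[OF X]
          by (intro divide_left_mono mult_pos_pos) auto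
      finally show ?thesis .
    qed
    then show "AE z in M \<Otimes>\<^sub>M M. z \<in> R \<times> R' \<longrightarrow> norm (case z of (x, y) \<Rightarrow> kernel U V x y) \<le> c * c' / \<kappa> / \<delta> x y"
      by (intro AE_I2) auto
  qed measurable
  then have "\<exists>r>0. dball (space M) \<delta> x r \<times> dball (space M) \<delta> y r \<subseteq> off_diag (space M) \<and>
        set_integrable (M \<Otimes>\<^sub>M M) (dball (space M) \<delta> x r \<times> dball (space M) \<delta> y r) (\<lambda>(x, y). kernel U V x y)"
    using sub dyadic_dist_pos[OF X] by (intro exI[of _ "\<delta> x y"]) (simp add: b1 b2)
  then show "case p of (x, y) \<Rightarrow> \<exists>r>0. dball (space M) \<delta> x r \<times> dball (space M) \<delta> y r \<subseteq> off_diag (space M) \<and>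
        set_integrable (M \<Otimes>\<^sub>M M) (dball (space M) \<delta> x r \<times> dball (space M) \<delta> y r) (\<lambda>(x, y). kernel U V x y)"
    by (simp add: p)
qed

lemma kernel_CZ:
  assumes U: "localized_family c U" and V: "localized_family c' V"
  shows "CZ_kernel M \<delta> (kernel U V)"
  unfolding CZ_kernel_def
proof (intro conjI)
  have cc: "c > 0" "c' > 0" using localized_familyD(1) U V by blast+
  show "L1_loc_off_diag M \<delta> (kernel U V)" by (rule kernel_L1_loc[OF U V])
  show "\<exists>C>0. \<forall>x\<in>space M. \<forall>y\<in>space M. x \<noteq> y \<longrightarrow> \<bar>kernel U V x y\<bar> \<le> C / \<delta> x y"
    using kernel_bound[OF U V] cc \<kappa>(1) by (intro exI[of _ "c * c' / \<kappa>"]) auto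
  \<comment> \<open>Smoothness in the second variable is smoothness in the first for the exchanged
    families.\<close>
  have "\<bar>kernel U V x y' - kernel U V x y\<bar> \<le> 2 * c * c' / \<kappa>\<^sup>2 * \<delta> y y' powr 1 / \<delta> x y powr (1 + 1)"
    if "x \<in> space M" "y \<in> space M" "y' \<in> space M" "x \<noteq> y" "2 * \<delta> y' y \<le> \<delta> x y" for x y y'
    using kernel_smooth[OF V U that(2,3,1) that(4)[symmetric]] that(5)
    by (simp add: kernel_commute[of U V] dyadic_dist_commute[of y x] dyadic_dist_commute[of y' y] mult_ac)
  then show "\<exists>C>0. \<exists>\<gamma>>0. \<forall>x\<in>space M. \<forall>y\<in>space M. x \<noteq> y \<longrightarrow>
        (\<forall>x'\<in>space M. 2 * \<delta> x' x \<le> \<delta> x y \<longrightarrow>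
           \<bar>kernel U V x' y - kernel U V x y\<bar> \<le> C * \<delta> x' x powr \<gamma> / \<delta> x y powr (1 + \<gamma>)) \<and>
        (\<forall>y'\<in>space M. 2 * \<delta> y' y \<le> \<delta> x y \<longrightarrow>
           \<bar>kernel U V x y' - kernel U V x y\<bar> \<le> C * \<delta> y y' powr \<gamma> / \<delta> x y powr (1 + \<gamma>))"
    using kernel_smooth[OF U V] cc \<kappa>(1)
    by (intro exI[of _ "2 * c * c' / \<kappa>\<^sup>2"] conjI exI[of _ "1::real"]) auto
qed

section \<open>Integral representation on the Haar span\<close>

lemma lin_span_H_facts:
  assumes "\<phi> \<in> lin_span H"
  shows "\<phi> \<in> Lp M 2" "integrable M \<phi>"
    and "\<exists>F. finite F \<and> F \<subseteq> H \<and> (\<forall>x y. (\<forall>h\<in>F. h x = h y) \<longrightarrow> \<phi> x = \<phi> y)"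
proof -
  obtain F b where F: "finite F" "F \<subseteq> H" "\<phi> = (\<lambda>x. \<Sum>h\<in>F. b h * h x)" using assms
    by (auto simp: lin_span_def)
  have hi: "integrable M h" if "h \<in> H" for h
  proof -
    have B: "haar_support h \<in> cubes" using haar_support_branching[OF that] branching_cube by blast
    have "integrable M (\<lambda>x. indicator (haar_support h) x * h x)"
      using L2_set_integrable[OF H_L2[OF that] cube_sets[OF B] emeasure_cube_finite[OF B]]
        by (simp add: set_integrable_def)
    moreover have "integrable M (\<lambda>x. indicator (haar_support h) x * h x) \<longleftrightarrow> integrable M h"
      using haar_zero_outside[OF that] by (intro Bochner_Integration.integrable_cong)
        (auto simp: indicator_def)
    ultimately show ?thesis by simp
  qed
  show "\<phi> \<in> Lp M 2" unfolding F(3) using F H_L2 by (intro Lp_sum Lp_cmult) auto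
  show "integrable M \<phi>" unfolding F(3) using F hi by (intro Bochner_Integration.integrable_sum) auto
  show "\<exists>F. finite F \<and> F \<subseteq> H \<and> (\<forall>x y. (\<forall>h\<in>F. h x = h y) \<longrightarrow> \<phi> x = \<phi> y)"
    using F by (intro exI[of _ F]) (auto intro!: sum.cong)
qed

text \<open>Disjointness gives \<psi> x = 0 where \<psi> y is not 0, so some Haar function involved
  takes different values at x and y, and its cube is contained in \<open>join x y\<close>. The
  smallest measure of finitely many such cubes bounds the distance from below, hence the kernel from
  above wherever it is integrated.\<close>

lemma lin_span_supports_separated:
  assumes \<phi>: "\<phi> \<in> lin_span H" and \<psi>: "\<psi> \<in> lin_span H"
    and disj: "{x \<in> space M. \<phi> x \<noteq> 0} \<inter> {x \<in> space M. \<psi> x \<noteq> 0} = {}"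
  obtains m where "m > 0" "\<And>x y. x \<in> space M \<Longrightarrow> y \<in> space M \<Longrightarrow> \<phi> x \<noteq> 0 \<Longrightarrow> \<psi> y \<noteq> 0 \<Longrightarrow> x \<noteq> y \<and> m \<le> \<delta> x y"
proof -
  obtain F where F: "finite F" "F \<subseteq> H" "\<And>x y. (\<forall>h\<in>F. h x = h y) \<Longrightarrow> \<phi> x = \<phi> y"
    using lin_span_H_facts(3)[OF \<phi>] by blast
  obtain G where G: "finite G" "G \<subseteq> H" "\<And>x y. (\<forall>h\<in>G. h x = h y) \<Longrightarrow> \<psi> x = \<psi> y"
    using lin_span_H_facts(3)[OF \<psi>] by blast
  \<comment> \<open>The element 1 keeps the set nonempty.\<close>
  define m where "m = Min (insert 1 ((\<lambda>h. measure M (haar_support h)) ` (F \<union> G)))"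
  have hc: "haar_support h \<in> cubes" if "h \<in> F \<union> G" for h
  proof -
    have "h \<in> H" using that F(2) G(2) by blast
    then show ?thesis by (rule branching_cube[OF haar_support_branching])
  qed
  have "m > 0" unfolding m_def using F G measure_cube_pos[OF hc] by (subst Min_gr_iff) auto
  moreover have "x \<noteq> y \<and> m \<le> \<delta> x y"
    if X: "x \<in> space M" "y \<in> space M" and nz: "\<phi> x \<noteq> 0" "\<psi> y \<noteq> 0" for x y
  proof -
    have ne: "x \<noteq> y" using X nz disj by auto
    have "\<exists>h\<in>F \<union> G. h x \<noteq> h y"
    proof (rule ccontr)
      assume "\<not> ?thesis"
      then have "\<psi> x = \<psi> y" using G(3)[of x y] by auto
      then show False using X nz disj by auto
    qed
    then obtain h where h: "h \<in> F \<union> G" "h x \<noteq> h y" by blast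
    then have "haar_support h \<subseteq> join x y"
      using haar_const[of h "join x y" x y] F G join_cube[OF X ne] join(2,3)[OF X ne] by blast
    then have "measure M (haar_support h) \<le> \<delta> x y"
      using measure_cube_mono[OF hc[OF h(1)] join_cube[OF X ne]] by (simp add: dyadic_dist_join X ne)
    moreover have "m \<le> measure M (haar_support h)" unfolding m_def using h F G by (intro Min_le) auto
    ultimately show ?thesis using ne by simp
  qed
  ultimately show ?thesis using that by blast
qed

text \<open>The partial sums of the kernel are sums of products of functions of one variable, so
  their integrals are the partial sums of the bilinear form. Separation of the supports makes a
  multiple of \<bar>\<phi> x\<bar> \<bar>\<psi> y\<bar> a dominating function.\<close>

lemma kernel_represents:
  assumes U: "localized_family c U" and V: "localized_family c' V" and T: "represents U V T"
    and \<phi>: "\<phi> \<in> lin_span H" and \<psi>: "\<psi> \<in> lin_span H"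
    and disj: "{x \<in> space M. \<phi> x \<noteq> 0} \<inter> {x \<in> space M. \<psi> x \<noteq> 0} = {}"
  shows "integrable (M \<Otimes>\<^sub>M M) (\<lambda>(x, y). kernel U V x y * \<phi> x * \<psi> y)"
    and "L2_inner M (T \<phi>) \<psi> = (\<integral>(x, y). kernel U V x y * \<phi> x * \<psi> y \<partial>(M \<Otimes>\<^sub>M M))"
proof -
  let ?e = branching_seq
  obtain m where m: "m > 0" "\<And>x y. x \<in> space M \<Longrightarrow> y \<in> space M \<Longrightarrow> \<phi> x \<noteq> 0 \<Longrightarrow> \<psi> y \<noteq> 0 \<Longrightarrow> x \<noteq> y \<and> m \<le> \<delta> x y"
    using lin_span_supports_separated[OF \<phi> \<psi> disj] by blast
  have cc: "c > 0" "c' > 0" using localized_familyD(1) U V by blast+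
  define C where "C = c * c' / \<kappa> / m"
  have L: "\<phi> \<in> Lp M 2" "\<psi> \<in> Lp M 2" and I: "integrable M \<phi>" "integrable M \<psi>"
    using lin_span_H_facts \<phi> \<psi> by auto
  have [measurable]: "\<phi> \<in> borel_measurable M" "\<psi> \<in> borel_measurable M" using I by auto
  have eL: "U (?e n) \<in> Lp M 2" "V (?e n) \<in> Lp M 2" for n
    using localized_family_L2(1)[OF U branching_seq] localized_family_L2(1)[OF V branching_seq] by auto
  note [measurable] = Lp_measurable[OF eL(1)] Lp_measurable[OF eL(2)] kernel_measurable[OF U V]
  define S where "S N = (\<lambda>(x, y). (\<Sum>n<N. U (?e n) x * V (?e n) y) * \<phi> x * \<psi> y)" for N :: nat
  have Sb: "\<bar>S N (x, y)\<bar> \<le> C * (\<bar>\<phi> x\<bar> * \<bar>\<psi> y\<bar>)" and Sl: "(\<lambda>N. S N (x, y)) \<longlonglongrightarrow> kernel U V x y * \<phi> x * \<psi> y"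
    if X: "x \<in> space M" "y \<in> space M" for x y N
  proof -
    have "\<bar>S N (x, y)\<bar> \<le> C * (\<bar>\<phi> x\<bar> * \<bar>\<psi> y\<bar>) \<and> (\<lambda>N. S N (x, y)) \<longlonglongrightarrow> kernel U V x y * \<phi> x * \<psi> y"
    proof (cases "\<phi> x = 0 \<or> \<psi> y = 0")
      case True
      then show ?thesis by (auto simp: S_def)
    next
      case False
      then have ne: "x \<noteq> y" and le: "m \<le> \<delta> x y" using m(2)[OF X] by auto
      have "\<bar>\<Sum>n<N. U (?e n) x * V (?e n) y\<bar> \<le> (\<Sum>n<N. \<bar>U (?e n) x * V (?e n) y\<bar>)" by (rule sum_abs)
      also have "\<dots> \<le> c * c' / \<kappa> / \<delta> x y" by (rule kernel_finite_sum_le[OF U V X ne]) simp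
      also have "\<dots> \<le> C" unfolding C_def using cc \<kappa>(1) m(1) le by (intro divide_left_mono) auto
      finally have "\<bar>\<Sum>n<N. U (?e n) x * V (?e n) y\<bar> * (\<bar>\<phi> x\<bar> * \<bar>\<psi> y\<bar>) \<le> C * (\<bar>\<phi> x\<bar> * \<bar>\<psi> y\<bar>)"
        by (intro mult_right_mono) auto
      moreover have "summable (\<lambda>n. U (?e n) x * V (?e n) y)"
        using kernel_summable[OF U V X ne] by (rule summable_rabs_cancel)
      then have "(\<lambda>N. \<Sum>n<N. U (?e n) x * V (?e n) y) \<longlonglongrightarrow> kernel U V x y"
        unfolding kernel_def by (rule summable_LIMSEQ)
      then have "(\<lambda>N. (\<Sum>n<N. U (?e n) x * V (?e n) y) * \<phi> x * \<psi> y) \<longlonglongrightarrow> kernel U V x y * \<phi> x * \<psi> y"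
        by (intro tendsto_intros)
      ultimately show ?thesis by (simp add: S_def abs_mult mult.assoc)
    qed
    then show "\<bar>S N (x, y)\<bar> \<le> C * (\<bar>\<phi> x\<bar> * \<bar>\<psi> y\<bar>)" "(\<lambda>N. S N (x, y)) \<longlonglongrightarrow> kernel U V x y * \<phi> x * \<psi> y" by auto
  qed
  have W: "integrable (M \<Otimes>\<^sub>M M) (\<lambda>(x, y). C * (\<bar>\<phi> x\<bar> * \<bar>\<psi> y\<bar>))"
    using integrable_mult_right[OF integral_tensor_product(1)[OF sigma_finite integrable_abs[OF I(1)]
      integrable_abs[OF I(2)]], of C]
    by (simp add: case_prod_beta')
  have Sm: "S N \<in> borel_measurable (M \<Otimes>\<^sub>M M)" for N unfolding S_def by measurable
  have Km: "(\<lambda>(x, y). kernel U V x y * \<phi> x * \<psi> y) \<in> borel_measurable (M \<Otimes>\<^sub>M M)" by measurable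
  have lim: "AE z in M \<Otimes>\<^sub>M M. (\<lambda>N. S N z) \<longlonglongrightarrow> (case z of (x, y) \<Rightarrow> kernel U V x y * \<phi> x * \<psi> y)"
    using Sl by (intro AE_I2) (auto simp: space_pair_measure)
  have bnd: "AE z in M \<Otimes>\<^sub>M M. norm (S N z) \<le> (case z of (x, y) \<Rightarrow> C * (\<bar>\<phi> x\<bar> * \<bar>\<psi> y\<bar>))" for N
    using Sb by (intro AE_I2) (auto simp: space_pair_measure)
  show "integrable (M \<Otimes>\<^sub>M M) (\<lambda>(x, y). kernel U V x y * \<phi> x * \<psi> y)"
    by (rule integrable_dominated_convergence[OF Km Sm W lim bnd])
  have conv: "(\<lambda>N. integral\<^sup>L (M \<Otimes>\<^sub>M M) (S N)) \<longlonglongrightarrow> (\<integral>(x, y). kernel U V x y * \<phi> x * \<psi> y \<partial>(M \<Otimes>\<^sub>M M))"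
    by (rule integral_dominated_convergence[OF Km Sm W lim bnd])
  have val: "integral\<^sup>L (M \<Otimes>\<^sub>M M) (S N) = (\<Sum>n<N. L2_inner M \<phi> (U (?e n)) * L2_inner M (V (?e n)) \<psi>)" for N
  proof -
    have eq: "S N = (\<lambda>z. \<Sum>n<N. case z of (x, y) \<Rightarrow> (\<phi> x * U (?e n) x) * (V (?e n) y * \<psi> y))"
      unfolding S_def by (auto simp: sum_distrib_right sum_distrib_left mult_ac intro!: ext sum.cong)
    have "integral\<^sup>L (M \<Otimes>\<^sub>M M) (S N) = (\<Sum>n<N. \<integral>(x, y). (\<phi> x * U (?e n) x) * (V (?e n) y * \<psi> y) \<partial>(M \<Otimes>\<^sub>M M))"
      unfolding eq by (intro Bochner_Integration.integral_sum integral_tensor_product(1) sigma_finite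
        L2_integrable_mult L eL)
    also have "\<dots> = (\<Sum>n<N. L2_inner M \<phi> (U (?e n)) * L2_inner M (V (?e n)) \<psi>)"
      unfolding L2_inner_def by (intro sum.cong refl integral_tensor_product(2) sigma_finite
        L2_integrable_mult L eL)
    finally show ?thesis .
  qed
  have "((\<lambda>n. L2_inner M \<phi> (U (?e n)) * L2_inner M (V (?e n)) \<psi>) has_sum L2_inner M (T \<phi>) \<psi>) UNIV"
    using representsD(2)[OF T L] has_sum_reindex_bij_betw[OF branching_seq_bij, of
      "\<lambda>Q. L2_inner M \<phi> (U Q) * L2_inner M (V Q) \<psi>"] by simp
  then have "(\<lambda>N. \<Sum>n<N. L2_inner M \<phi> (U (?e n)) * L2_inner M (V (?e n)) \<psi>) \<longlonglongrightarrow> L2_inner M (T \<phi>) \<psi>"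
    using has_sum_imp_sums unfolding sums_def by blast
  then show "L2_inner M (T \<phi>) \<psi> = (\<integral>(x, y). kernel U V x y * \<phi> x * \<psi> y \<partial>(M \<Otimes>\<^sub>M M))"
    using conv unfolding val by (rule LIMSEQ_unique)
qed

theorem represents_CZ_operator:
  assumes U: "localized_family c U" and V: "localized_family c' V" and T: "represents U V T"
  shows "CZ_operator M \<delta> H T"
  unfolding CZ_operator_def
  using represents_Lp_bounded_linear_2[OF U V T] kernel_CZ[OF U V] kernel_represents[OF U V T] by blast

end

section \<open>The Haar shift\<close>

lemma L2_inner_sums_zero:
  assumes "\<And>i. i \<in> I \<Longrightarrow> f i \<in> Lp M 2" "\<And>j. j \<in> J \<Longrightarrow> g j \<in> Lp M 2"
    and "\<And>i j. i \<in> I \<Longrightarrow> j \<in> J \<Longrightarrow> L2_inner M (f i) (g j) = 0"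
  shows "L2_inner M (\<lambda>x. \<Sum>i\<in>I. f i x) (\<lambda>x. \<Sum>j\<in>J. g j x) = 0"
proof -
  have "(\<lambda>x. \<Sum>j\<in>J. g j x) \<in> Lp M 2" using assms(2) by (intro Lp_sum) auto
  then have "L2_inner M (\<lambda>x. \<Sum>i\<in>I. f i x) (\<lambda>x. \<Sum>j\<in>J. g j x) = (\<Sum>i\<in>I. \<Sum>j\<in>J. L2_inner M (f i) (g j))"
    using assms(1,2) by (simp add: L2_inner_sum_left L2_inner_sum_right)
  also have "\<dots> = 0" using assms(3) by simp
  finally show ?thesis .
qed

context haar_space
begin

definition haar_sum :: "'a set \<Rightarrow> 'a \<Rightarrow> real" where
  "haar_sum Q x = (\<Sum>h\<in>haars Q. h x)"

definition child_haar_sum :: "(('a \<Rightarrow> real) \<Rightarrow> real) \<Rightarrow> 'a set \<Rightarrow> 'a \<Rightarrow> real" where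
  "child_haar_sum \<alpha> Q x = (\<Sum>R\<in>children D Q. \<Sum>h\<in>haars R. \<alpha> h * h x)"

lemma haars_L2: "h \<in> haars Q \<Longrightarrow> h \<in> Lp M 2"
  using haarsD H_L2 by blast

text \<open>At most 1/\<kappa> Haar functions belong to Q, each of size at most 1/sqrt(\<kappa>
  \<mu>(Q)).\<close>

lemma haar_sum_localized: "localized_family (1 / \<kappa> / sqrt \<kappa>) haar_sum"
  unfolding localized_family_def
proof (intro conjI ballI impI)
  show "1 / \<kappa> / sqrt \<kappa> > 0" using \<kappa>(1) by simp
next
  fix Q assume Q: "Q \<in> \<B>"
  show "haar_sum Q \<in> borel_measurable M"
    unfolding haar_sum_def using haars_L2 by (intro borel_measurable_sum) (auto intro: Lp_measurable)
next
  fix Q x assume "Q \<in> \<B>" "x \<in> space M" "x \<notin> Q"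
  then show "haar_sum Q x = 0"
    unfolding haar_sum_def using haar_zero_outside haarsD by (intro sum.neutral) auto
next
  fix Q x assume Q: "Q \<in> \<B>" and x: "x \<in> space M"
  have "\<bar>haar_sum Q x\<bar> \<le> (\<Sum>h\<in>haars Q. \<bar>h x\<bar>)" unfolding haar_sum_def by (rule sum_abs)
  also have "\<dots> \<le> real (card (haars Q)) * (1 / sqrt (\<kappa> * measure M Q))"
    using haar_bound[OF haarsD(1) x] haarsD(2) by (intro sum_bounded_above) fastforce
  also have "\<dots> \<le> 1 / \<kappa> * (1 / sqrt (\<kappa> * measure M Q))"
    using card_haars_le \<kappa>(1) by (intro mult_right_mono) auto
  finally show "\<bar>haar_sum Q x\<bar> \<le> 1 / \<kappa> / sqrt \<kappa> / sqrt (measure M Q)" by (simp add: real_sqrt_mult)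
next
  fix Q W x y assume Q: "Q \<in> \<B>" and W: "W \<in> cubes" "\<not> Q \<subseteq> parent W" "x \<in> W" "y \<in> W"
  then have "\<not> Q \<subseteq> W" using parent_psubset[OF W(1)] by blast
  then show "haar_sum Q x = haar_sum Q y"
    unfolding haar_sum_def using haar_const[OF _ W(1) _ W(3,4)] haarsD by (intro sum.cong) auto
next
  fix Q Q' :: "'a set" assume "Q \<noteq> Q'"
  then have "L2_inner M h h' = 0" if "h \<in> haars Q" "h' \<in> haars Q'" for h h'
    using H_orthonormal[OF haarsD(1)[OF that(1)] haarsD(1)[OF that(2)]] haarsD(2)[OF that(1)] haarsD(2)[OF
      that(2)] by auto
  then show "L2_inner M (haar_sum Q) (haar_sum Q') = 0"
    unfolding haar_sum_def using haars_L2 by (intro L2_inner_sums_zero) auto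
qed

text \<open>One factor 1/\<kappa> of the constant counts the children, one the Haar functions of a
  child, and one comes from their size, as a child R has measure at least \<kappa> \<mu>(Q).
  Orthogonality holds because each cube has only one parent, so different Q involve different Haar
  functions.\<close>

lemma child_haar_sum_localized:
  assumes A: "A > 0" "\<And>h. h \<in> H \<Longrightarrow> \<bar>\<alpha> h\<bar> \<le> A"
  shows "localized_family (A / \<kappa> ^ 3) (child_haar_sum \<alpha>)"
  unfolding localized_family_def
proof (intro conjI ballI impI)
  show "A / \<kappa> ^ 3 > 0" using \<kappa>(1) A by simp
next
  fix Q assume Q: "Q \<in> \<B>"
  show "child_haar_sum \<alpha> Q \<in> borel_measurable M"
    unfolding child_haar_sum_def using haars_L2
    by (intro borel_measurable_sum borel_measurable_times) (auto intro: Lp_measurable)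
next
  fix Q x assume Q: "Q \<in> \<B>" and x: "x \<in> space M" "x \<notin> Q"
  have "h x = 0" if "R \<in> children D Q" "h \<in> haars R" for R h
    using haar_zero_outside[OF haarsD(1)[OF that(2)] x(1)] haarsD(2)[OF that(2)] child_subset[OF Q
      that(1)] x by blast
  then show "child_haar_sum \<alpha> Q x = 0" unfolding child_haar_sum_def by (auto intro!: sum.neutral)
next
  fix Q x assume Q: "Q \<in> \<B>" and x: "x \<in> space M"
  have Qp: "measure M Q > 0" using measure_cube_pos branching_cube[OF Q] by auto
  have R: "\<bar>\<Sum>h\<in>haars R. \<alpha> h * h x\<bar> \<le> A / \<kappa>\<^sup>2 / sqrt (measure M Q)" if R: "R \<in> children D Q" for R
  proof -
    have Rp: "measure M R > 0" using measure_cube_pos child_cube[OF Q R] by auto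
    have "\<kappa>\<^sup>2 * measure M Q \<le> \<kappa> * measure M R"
      using mult_left_mono[OF child_measure[OF Q R], of \<kappa>] \<kappa>(1) by (simp add: power2_eq_square mult.assoc)
    then have "sqrt (\<kappa>\<^sup>2 * measure M Q) \<le> sqrt (\<kappa> * measure M R)" by (rule real_sqrt_le_mono)
    then have s: "\<kappa> * sqrt (measure M Q) \<le> sqrt (\<kappa> * measure M R)" using \<kappa>(1) by (simp add: real_sqrt_mult)
    have h: "\<bar>\<alpha> h * h x\<bar> \<le> A * (1 / (\<kappa> * sqrt (measure M Q)))" if h: "h \<in> haars R" for h
    proof -
      have "\<bar>h x\<bar> \<le> 1 / sqrt (\<kappa> * measure M R)"
        using haar_bound[OF haarsD(1)[OF h] x] haarsD(2)[OF h] by simp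
      also have "\<dots> \<le> 1 / (\<kappa> * sqrt (measure M Q))"
        using s \<kappa>(1) Qp Rp by (intro divide_left_mono mult_pos_pos) auto
      finally show ?thesis unfolding abs_mult using A haarsD(1)[OF h] by (intro mult_mono) auto
    qed
    have "\<bar>\<Sum>h\<in>haars R. \<alpha> h * h x\<bar> \<le> (\<Sum>h\<in>haars R. \<bar>\<alpha> h * h x\<bar>)" by (rule sum_abs)
    also have "\<dots> \<le> real (card (haars R)) * (A * (1 / (\<kappa> * sqrt (measure M Q))))"
      by (rule sum_bounded_above[OF h])
    also have "\<dots> \<le> 1 / \<kappa> * (A * (1 / (\<kappa> * sqrt (measure M Q))))"
      using card_haars_le \<kappa>(1) A by (intro mult_right_mono) auto
    finally show ?thesis by (simp add: power2_eq_square)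
  qed
  have "\<bar>child_haar_sum \<alpha> Q x\<bar> \<le> (\<Sum>R\<in>children D Q. \<bar>\<Sum>h\<in>haars R. \<alpha> h * h x\<bar>)"
    unfolding child_haar_sum_def by (rule sum_abs)
  also have "\<dots> \<le> real (card (children D Q)) * (A / \<kappa>\<^sup>2 / sqrt (measure M Q))"
    by (rule sum_bounded_above[OF R])
  also have "\<dots> \<le> 1 / \<kappa> * (A / \<kappa>\<^sup>2 / sqrt (measure M Q))"
    using card_children(2)[OF Q] \<kappa>(1) A by (intro mult_right_mono) auto
  finally show "\<bar>child_haar_sum \<alpha> Q x\<bar> \<le> A / \<kappa> ^ 3 / sqrt (measure M Q)"
    by (simp add: power2_eq_square power3_eq_cube mult.assoc)
next
  fix Q W x y assume Q: "Q \<in> \<B>" and W: "W \<in> cubes" "\<not> Q \<subseteq> parent W" "x \<in> W" "y \<in> W"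
  have "h x = h y" if R: "R \<in> children D Q" and h: "h \<in> haars R" for R h
  proof (rule haar_const[OF haarsD(1)[OF h] W(1) _ W(3,4)])
    have "\<not> R \<subseteq> W"
    proof
      assume "R \<subseteq> W"
      then consider "R = W" | "R \<subset> W" by blast
      then show False
      proof cases
        case 1
        then show False using W(2) parent_unique[OF Q R] by simp
      next
        case 2
        then have "Q \<subseteq> W" using parent_least[OF child_cube[OF Q R] W(1)] parent_unique[OF Q R] by simp
        then show False using W(2) parent_psubset[OF W(1)] by blast
      qed
    qed
    then show "\<not> haar_support h \<subseteq> W" using haarsD(2)[OF h] by simp
  qed
  then show "child_haar_sum \<alpha> Q x = child_haar_sum \<alpha> Q y"
    unfolding child_haar_sum_def by (intro sum.cong refl) auto
next
  fix Q Q' assume Q: "Q \<in> \<B>" "Q' \<in> \<B>" "Q \<noteq> Q'"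
  have L: "(\<lambda>x. \<alpha> h * h x) \<in> Lp M 2" if "h \<in> haars R" for h R
    using haars_L2[OF that] by (intro Lp_cmult) auto
  have LS: "(\<lambda>x. \<Sum>h\<in>haars R. \<alpha> h * h x) \<in> Lp M 2" for R by (intro Lp_sum) (auto intro: L)
  show "L2_inner M (child_haar_sum \<alpha> Q) (child_haar_sum \<alpha> Q') = 0"
    unfolding child_haar_sum_def
  proof (rule L2_inner_sums_zero[OF LS LS], rule L2_inner_sums_zero[OF L L])
    fix R R' h h' assume R: "R \<in> children D Q" "R' \<in> children D Q'" and h: "h \<in> haars R" "h' \<in> haars R'"
    have "R \<noteq> R'" using parent_unique[OF Q(1) R(1)] parent_unique[OF Q(2) R(2)] Q(3) by auto
    then have "h \<noteq> h'" using haarsD(2) h by metis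
    then show "L2_inner M (\<lambda>x. \<alpha> h * h x) (\<lambda>x. \<alpha> h' * h' x) = 0"
      using H_orthonormal haarsD(1) h by (simp add: L2_inner_cmult_left L2_inner_cmult_right)
  qed
qed

text \<open>The sum over the children does not depend on h, so the double sum factors and each cube
  contributes a single coefficient.\<close>

lemma haar_shift_term_eq:
  assumes f: "f \<in> Lp M 2"
  shows "haar_shift_term M D H \<alpha> f = (\<lambda>Q x. L2_inner M f (haar_sum Q) * child_haar_sum \<alpha> Q x)"
proof (intro ext)
  fix Q x
  have "L2_inner M f (haar_sum Q) = (\<Sum>h\<in>haars Q. L2_inner M f h)"
    unfolding haar_sum_def using haars_L2 f by (intro L2_inner_sum_right) auto
  then show "haar_shift_term M D H \<alpha> f Q x = L2_inner M f (haar_sum Q) * child_haar_sum \<alpha> Q x"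
    unfolding haar_shift_term_def child_haar_sum_def by (simp add: sum_distrib_right)
qed

end

theorem theorem5p2:
  fixes M :: "'a measure"
    and d :: "'a \<Rightarrow> 'a \<Rightarrow> real"
    and lam :: real
    and D :: "int \<Rightarrow> 'a set set"
    and H :: "('a \<Rightarrow> real) set"
    and \<alpha> :: "('a \<Rightarrow> real) \<Rightarrow> real"
  assumes "homogeneous_type M d"
    and "dyadic_family M d lam D"
    and "\<exists>Q\<in>(\<Union>j. D j). space M = quadrant D Q"
    and "haar_system M d D H"
    and "bounded (\<alpha> ` H)"
  shows "(\<forall>f\<in>Lp M 2. \<exists>g. L2_has_sum M (haar_shift_term M D H \<alpha> f) g (branching D)) \<and>
    CZ_operator M (dyadic_dist M D) H (haar_shift M D H \<alpha>) \<and>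
    (\<forall>p>1. extends_bounded_Lp M p (haar_shift M D H \<alpha>)) \<and>
    extends_weak_type_1_1 M (haar_shift M D H \<alpha>)"
proof -
  interpret haar_space M d lam D H
    using assms by unfold_locales
  obtain A where A: "A > 0" "\<And>h. h \<in> H \<Longrightarrow> \<bar>\<alpha> h\<bar> \<le> A"
    using assms(5) unfolding bounded_pos by auto
  note U = haar_sum_localized and V = child_haar_sum_localized[of A \<alpha>, OF A]
  have ex: "\<exists>g. L2_has_sum M (haar_shift_term M D H \<alpha> f) g \<B>" if f: "f \<in> Lp M 2" for f
    unfolding haar_shift_term_eq[OF f] by (rule localized_family_series[OF U V f])
  have T: "represents haar_sum (child_haar_sum \<alpha>) (haar_shift M D H \<alpha>)"
  proof (rule representsI)
    fix f :: "'a \<Rightarrow> real" assume f: "f \<in> Lp M 2"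
    show "L2_has_sum M (\<lambda>Q x. L2_inner M f (haar_sum Q) * child_haar_sum \<alpha> Q x) (haar_shift M D H \<alpha> f) \<B>"
      using someI_ex[OF ex[OF f]] unfolding haar_shift_def haar_shift_term_eq[OF f] .
  qed
  show ?thesis
    using ex represents_CZ_operator[OF U V T] represents_extends_bounded_Lp[OF U V T]
      represents_extends_weak_type_1_1[OF U V T] by blast
qed

end
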